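(* The following five classes of groups coincide: the $Sym$-approximable groups, the $\prod(Sym)$-approximable groups, the $Alt$-approximable groups, the $\prod(Alt)$-approximable groups, and the sofic groups.
   Context: $Sym$ and $Alt$ are the classes of finite symmetric groups $S_m$ and finite alternating groups $A_m$ (acting on $[m]=\{1,\dots,m\}$). For a class $\mathcal{K}$ of groups, $\prod(\mathcal{K})$ is the class consisting of $\mathcal{K}$ and all finite direct products of groups from $\mathcal{K}$. For a group $H$, $X\subseteq H$ and $n\in\mathbb{N}$, put $C_n(X,H)=\{x_1^{g_1}\cdots x_n^{g_n} : x_i\in X\text{ or }x_i^{-1}\in X,\ g_i\in H\}$, where $x^g=g^{-1}xg$. A set $Y\subseteq H$ is $n$-separated from $X$ in $H$ if $Y\cap C_n(X,H)=\emptyset$. A group $G$ is $\mathcal{K}$-approximable if for every finite $\Phi\subset G$ and every $n\in\mathbb{N}$ there exist $H\in\mathcal{K}$ and a map $\phi:\Phi\to H$ such that $\phi(1)=1$ (when $1\in\Phi$) and $\phi(\Phi\setminus\{1\})$ is $n$-separated in $H$ from $\{\phi(g)\phi(h)(\phi(gh))^{-1} : g,h,gh\in\Phi\}$. The normalized Hamming length on $S_m$ is $\|h\|=|\{x\in[m] : xh\neq x\}|/m$. A group $G$ is sofic if there is a function $\alpha:G\to\mathbb{R}$ with $\alpha_1=0$ and $\alpha_g>0$ for $g\ne 1$ such that for every finite $\Phi\subset G$ and every $\epsilon>0$ there exist $m$ and a function $\phi:\Phi\to S_m$ with: $\phi(1)=1$ (when $1\in\Phi$); $\|\phi(g)\|\ge\alpha_g$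 for all $g\in\Phi$; and $\|\phi(gh)(\phi(g)\phi(h))^{-1}\|<\epsilon$ whenever $g,h,gh\in\Phi$. *)

theory Defs
  imports Complex_Main "HOL-Algebra.Sym_Groups" "HOL-Algebra.Product_Groups"
begin

definition conj_products :: "'h monoid \<Rightarrow> 'h set \<Rightarrow> nat \<Rightarrow> 'h set" where
  "conj_products H X n =
     {foldr (\<otimes>\<^bsub>H\<^esub>) (map (\<lambda>(x, g). inv\<^bsub>H\<^esub> g \<otimes>\<^bsub>H\<^esub> x \<otimes>\<^bsub>H\<^esub> g) ps) \<one>\<^bsub>H\<^esub> | ps.
        length ps = n \<and>
        (\<forall>(x, g) \<in> set ps. x \<in> carrier H \<and> g \<in> carrier H \<and> (x \<in> X \<or> inv\<^bsub>H\<^esub> x \<in> X))}"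

definition separated_from :: "'h monoid \<Rightarrow> nat \<Rightarrow> 'h set \<Rightarrow> 'h set \<Rightarrow> bool" where
  "separated_from H n Y X \<longleftrightarrow> Y \<inter> conj_products H X n = {}"

definition defects :: "'a monoid \<Rightarrow> 'h monoid \<Rightarrow> 'a set \<Rightarrow> ('a \<Rightarrow> 'h) \<Rightarrow> 'h set" where
  "defects G H \<Phi> \<phi> =
     {\<phi> g \<otimes>\<^bsub>H\<^esub> \<phi> h \<otimes>\<^bsub>H\<^esub> inv\<^bsub>H\<^esub> (\<phi> (g \<otimes>\<^bsub>G\<^esub> h)) | g h.
        g \<in> \<Phi> \<and> h \<in> \<Phi> \<and> g \<otimes>\<^bsub>G\<^esub> h \<in> \<Phi>}"

definition approximable :: "'h monoid set \<Rightarrow> 'a monoid \<Rightarrow> bool" where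
  "approximable K G \<longleftrightarrow>
     (\<forall>\<Phi> n. finite \<Phi> \<and> \<Phi> \<subseteq> carrier G \<longrightarrow>
        (\<exists>H\<in>K. \<exists>\<phi>\<in>\<Phi> \<rightarrow> carrier H.
           (\<one>\<^bsub>G\<^esub> \<in> \<Phi> \<longrightarrow> \<phi> \<one>\<^bsub>G\<^esub> = \<one>\<^bsub>H\<^esub>) \<and>
           separated_from H n (\<phi> ` (\<Phi> - {\<one>\<^bsub>G\<^esub>})) (defects G H \<Phi> \<phi>)))"

definition approximable_groups :: "'h monoid set \<Rightarrow> 'a monoid set" where
  "approximable_groups K = {G. group G \<and> approximable K G}"

text \<open>
  The index \<open>m = 0\<close> adds nothing to the next two classes: the records \<open>sym_group 0\<close> and
  \<open>sym_group 1\<close> are equal, and so are \<open>alt_group 0\<close> and \<open>alt_group 1\<close>.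
\<close>

definition Sym_class :: "(nat \<Rightarrow> nat) monoid set" where
  "Sym_class = range sym_group"

definition Alt_class :: "(nat \<Rightarrow> nat) monoid set" where
  "Alt_class = range alt_group"

text \<open>
  Finite direct products of \<open>k \<ge> 1\<close> members of \<open>K\<close>. A member of \<open>K\<close> and the product of
  that single factor have different types, so \<open>K\<close> itself is included up to isomorphism, as
  the case \<open>k = 1\<close>; see \<open>single_factor_iso\<close>.
\<close>

definition Prod_class :: "'h monoid set \<Rightarrow> (nat \<Rightarrow> 'h) monoid set" where
  "Prod_class K =
     {product_group {1..k} F | k F. k \<ge> 1 \<and> (\<forall>i\<in>{1..k}. F i \<in> K)}"

lemma single_factor_iso:
  assumes "H \<in> K"
  shows "product_group {1..1} (\<lambda>_. H) \<in> Prod_class K"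
    and "H \<cong> product_group {1..1::nat} (\<lambda>_. H)"
proof -
  show "product_group {1..1} (\<lambda>_. H) \<in> Prod_class K"
    using assms unfolding Prod_class_def by blast
  have "(\<lambda>x. \<lambda>i\<in>{1..1::nat}. x) \<in> iso H (product_group {1..1} (\<lambda>_. H))"
  proof (rule isoI)
    show "(\<lambda>x. \<lambda>i\<in>{1..1::nat}. x) \<in> hom H (product_group {1..1} (\<lambda>_. H))"
      by (auto simp: hom_def intro!: restrict_ext)
    show "bij_betw (\<lambda>x. \<lambda>i\<in>{1..1::nat}. x) (carrier H)
            (carrier (product_group {1..1} (\<lambda>_. H)))"
      by (rule bij_betw_byWitness[where f' = "\<lambda>f. f 1"])
         (auto simp: PiE_iff extensional_def fun_eq_iff restrict_def split: if_splits)
  qed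
  then show "H \<cong> product_group {1..1::nat} (\<lambda>_. H)"
    by (rule is_isoI)
qed

definition hamming_length :: "nat \<Rightarrow> (nat \<Rightarrow> nat) \<Rightarrow> real" where
  "hamming_length m h = real (card {x \<in> {1..m}. h x \<noteq> x}) / real m"

text \<open>
  Products in \<open>sym_group m\<close> are compositions of maps acting on the left. With permutations
  acting on the right one obtains the opposite group; inversion is a length-preserving isomorphism
  between the two, so the notions of soficity and approximability do not depend on this convention.
\<close>

definition sofic :: "'a monoid \<Rightarrow> bool" where
  "sofic G \<longleftrightarrow>
     (\<exists>\<alpha> :: 'a \<Rightarrow> real.
        \<alpha> \<one>\<^bsub>G\<^esub> = 0 \<and> (\<forall>g \<in> carrier G - {\<one>\<^bsub>G\<^esub>}. \<alpha> g > 0) \<and>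
        (\<forall>\<Phi> \<epsilon>. finite \<Phi> \<and> \<Phi> \<subseteq> carrier G \<and> \<epsilon> > 0 \<longrightarrow>
           (\<exists>m \<ge> 1. \<exists>\<phi>\<in>\<Phi> \<rightarrow> carrier (sym_group m).
              (\<one>\<^bsub>G\<^esub> \<in> \<Phi> \<longrightarrow> \<phi> \<one>\<^bsub>G\<^esub> = \<one>\<^bsub>sym_group m\<^esub>) \<and>
              (\<forall>g\<in>\<Phi>. hamming_length m (\<phi> g) \<ge> \<alpha> g) \<and>
              (\<forall>g\<in>\<Phi>. \<forall>h\<in>\<Phi>. g \<otimes>\<^bsub>G\<^esub> h \<in> \<Phi> \<longrightarrow>
                 hamming_length m
                   (\<phi> (g \<otimes>\<^bsub>G\<^esub> h) \<otimes>\<^bsub>sym_group m\<^esub>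
                     inv\<^bsub>sym_group m\<^esub> (\<phi> g \<otimes>\<^bsub>sym_group m\<^esub> \<phi> h)) < \<epsilon>))))"

definition sofic_groups :: "'a monoid set" where
  "sofic_groups = {G. group G \<and> sofic G}"

end

(*
  Sofic groups are approximable because conjugates and products of permutations of Hamming length
  at most e have length at most n e; doubling the points makes all permutations even.

  Conversely, let h lie in a direct product of symmetric and alternating groups, outside C_n(X) for a
  large n, where X is the set of defects. In degree at least 5 every even permutation whose support
  is at most k times that of x is a product of boundedly many conjugates of x and its inverse: it
  is essentially a product of two involutions, and involutions moving up to a fixed fraction of the
  support of x are commutators [x, c]. Using only the pattern x, x^-1, this can be done in all
  coordinates at once. Hence, unless h already escapes the normal closure of X in the product of the small
  quotients (the sign, or the whole group in degree at most 4), some coordinate of h has a support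
  larger than k times that of the same coordinate of every x in X. In the first case the quotient acts
  by translations; in the second case a suitable tensor power of that coordinate makes h long while
  X stays short. The number of steps in the small quotients is bounded independently of the number of
  factors, because only boundedly many types of coordinates occur. Tensoring the actions obtained for the
  various h gives sofic approximations with the uniform lower bound 1/2.
*)
theory Submission
  imports Defs
begin

section \<open>Involutions\<close>

text \<open>Approximability lets the length \<open>n\<close> be prescribed before the group and the
  map are known, so every bound may depend only on \<open>\<Phi>\<close> and on the desired ratio
  \<open>k\<close>, never on degrees. A direct product adds an obstacle of its own: one
  \<open>x\<close> acts in all coordinates at once, while different coordinates of \<open>h\<close>
  may need different elements of \<open>X\<close>. Commutators settle the first point, each being a
  conjugate of \<open>x\<close> times a conjugate of the inverse of \<open>x\<close> in whatever
  coordinate; cutting the element to be reached into \<open>card X\<close> pieces, one for each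
  dominating \<open>x\<close>, settles the second. Commutators are even even if \<open>x\<close> is
  odd, hence the separate treatment of the sign. The small quotients have to be matched before
  supports are compared: some \<open>y\<close> of bounded length \<open>M\<close> agrees with
  \<open>h\<close> there, and the inverse of \<open>y\<close> times \<open>h\<close> is trivial in
  small degrees, even in large ones, with support at most \<open>M + k\<close> times the largest one
  in \<open>X\<close>. A ratio of supports is the right measure because it survives in every degree,
  whereas the normalized length of \<open>h\<close> in its coordinate may be arbitrarily
  small.\<close>

abbreviation moved :: "('a \<Rightarrow> 'a) \<Rightarrow> 'a set" where
  "moved p \<equiv> {a. p a \<noteq> a}"

definition involution :: "('a \<Rightarrow> 'a) \<Rightarrow> bool" where
  "involution p \<longleftrightarrow> p \<circ> p = id"

lemma involution_apply: "involution p \<Longrightarrow> p (p a) = a"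
  by (simp add: involution_def pointfree_idE)

lemma involutionI: "(\<And>a. p (p a) = a) \<Longrightarrow> involution p"
  by (simp add: involution_def fun_eq_iff)

lemma involution_inv: "involution p \<Longrightarrow> inv' p = p"
  by (simp add: involution_def inv_unique_comp)

lemma involution_permutes:
  assumes "involution p" "moved p \<subseteq> S"
  shows "p permutes S"
proof -
  have "bij p"
    using assms(1) by (metis involution_apply involuntory_imp_bij)
  then show ?thesis
    using assms(2) by (auto simp: permutes_def bij_iff)
qed

lemma permutes_moved: "p permutes S \<Longrightarrow> moved p \<subseteq> S"
  by (auto simp: permutes_def)

lemma permutes_moved_self: "p permutes S \<Longrightarrow> p permutes moved p"
  by (auto simp: permutes_def)

lemma moved_comp: "moved (p \<circ> q) \<subseteq> moved p \<union> moved q"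
  by auto

lemma involution_image_iff: "involution p \<Longrightarrow> a \<in> p ` A \<longleftrightarrow> p a \<in> A"
  by (metis image_iff involution_apply)

lemma involution_inj_on: "involution p \<Longrightarrow> inj_on p A"
  by (rule inj_on_inverseI[where g = p]) (rule involution_apply)

lemma moved_transpose: "a \<noteq> b \<Longrightarrow> moved (transpose a b) = {a, b}"
  by (auto simp: transpose_def)

lemma involution_transpose: "involution (transpose a b)"
  by (simp add: involution_def)

text \<open>The linear order picks the smaller point of each 2-cycle as its representative; 2-cycles
  are counted and selected through these points below.\<close>

lemma card_moved_involution:
  fixes p :: "'a::linorder \<Rightarrow> 'a"
  assumes "involution p" "finite (moved p)"
  shows "card (moved p) = 2 * card {a. a < p a}"
proof -
  note [simp] = involution_apply[OF assms(1)] involution_image_iff[OF assms(1)]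
  have eq: "moved p = {a. a < p a} \<union> p ` {a. a < p a}"
    by auto
  have fin: "finite {a. a < p a}"
    by (rule finite_subset[OF _ assms(2)]) auto
  have "{a. a < p a} \<inter> p ` {a. a < p a} = {}"
    by auto
  moreover have "inj_on p {a. a < p a}"
    using assms(1) by (rule involution_inj_on)
  ultimately have "card ({a. a < p a} \<union> p ` {a. a < p a}) = 2 * card {a. a < p a}"
    using fin by (simp add: card_Un_disjoint card_image)
  then show ?thesis using eq by simp
qed

text \<open>The 2-cycles of \<open>p\<close> are disjoint, so \<open>j\<close> of them can form one
  factor and the others the second.\<close>

lemma involution_split:
  fixes p :: "'a::linorder \<Rightarrow> 'a"
  assumes p: "involution p" "finite (moved p)" and j: "2 * j \<le> card (moved p)"
  obtains q r where "involution q" "involution r" "p = q \<circ> r" "moved q \<subseteq> moved p"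
    "moved r \<subseteq> moved p" "card (moved q) = 2 * j" "card (moved r) = card (moved p) - 2 * j"
proof -
  note [simp] = involution_apply[OF p(1)] involution_image_iff[OF p(1)]
  have "j \<le> card {a. a < p a}"
    using j card_moved_involution[OF p] by simp
  then obtain A where A: "A \<subseteq> {a. a < p a}" "card A = j" "finite A"
    by (meson obtain_subset_with_card_n)
  define B where "B = A \<union> p ` A"
  have inv: "p a \<in> B \<longleftrightarrow> a \<in> B" for a
    by (auto simp: B_def)
  have "A \<inter> p ` A = {}"
  proof -
    have "\<not> (a \<in> A \<and> p a \<in> A)" for a
    proof
      assume "a \<in> A \<and> p a \<in> A"
      then have "a < p a" "p a < p (p a)" using A(1) by blast+
      then show False by auto
    qed
    then show ?thesis by auto
  qed
  moreover have "inj_on p A"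
    using p(1) by (rule involution_inj_on)
  ultimately have cB: "card B = 2 * j" and fB: "finite B"
    using A by (auto simp: B_def card_Un_disjoint card_image)
  have B: "B \<subseteq> moved p"
    using A(1) p(1) by (auto simp: B_def)
  define q where "q a = (if a \<in> B then p a else a)" for a
  define r where "r a = (if a \<in> B then a else p a)" for a
  have mq: "moved q = B" and mr: "moved r = moved p - B"
    using B by (auto simp: q_def r_def)
  show ?thesis
  proof
    show "involution q" "involution r" "p = q \<circ> r"
      using p(1) inv by (auto intro!: involutionI simp: q_def r_def fun_eq_iff)
    show "moved q \<subseteq> moved p" "moved r \<subseteq> moved p" "card (moved q) = 2 * j"
      using mq mr B cB by auto
    show "card (moved r) = card (moved p) - 2 * j"
      using mr B cB fB by (simp add: card_Diff_subset)
  qed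
qed

lemma card2_moved_transpose:
  assumes "p permutes S" "card (moved p) = 2"
  obtains a b where "a \<noteq> b" "p = transpose a b"
proof -
  obtain a b where ab: "moved p = {a, b}" "a \<noteq> b"
    using assms(2) by (auto simp: card_2_iff)
  then have "p permutes {a, b}"
    using permutes_moved_self[OF assms(1)] by simp
  moreover have "p \<noteq> id" using ab by auto
  ultimately show ?thesis using that ab(2) by (auto simp: permutes_doubleton_iff)
qed

text \<open>Removing one 2-cycle flips the parity and shortens the support by 2, which drives the
  induction.\<close>

lemma involution_evenperm_iff:
  fixes p :: "'a::linorder \<Rightarrow> 'a"
  assumes "involution p" "finite (moved p)"
  shows "evenperm p \<longleftrightarrow> 4 dvd card (moved p)"
  using assms
proof (induction "card (moved p)" arbitrary: p rule: less_induct)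
  case less
  show ?case
  proof (cases "moved p = {}")
    case True
    then have "p = id" by auto
    then show ?thesis by simp
  next
    case False
    have e: "even (card (moved p))"
      using card_moved_involution[OF less.prems] by simp
    have pos: "card (moved p) > 0"
      using False less.prems by (simp add: card_gt_0_iff)
    then have c2: "2 * 1 \<le> card (moved p)"
      using e by presburger
    obtain q r where qr: "involution q" "involution r" "p = q \<circ> r" "moved q \<subseteq> moved p"
      "moved r \<subseteq> moved p" "card (moved q) = 2 * 1" "card (moved r) = card (moved p) - 2 * 1"
      using involution_split[OF less.prems c2] by blast
    have perm: "q permutes moved p" "r permutes moved p"
      using qr involution_permutes by blast+
    then obtain a b where ab: "a \<noteq> b" "q = transpose a b"
      using card2_moved_transpose qr(6) by (metis mult_2 one_add_one)
    have IH: "evenperm r \<longleftrightarrow> 4 dvd card (moved r)"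
      using qr less.prems pos by (intro less.hyps) (auto intro: finite_subset)
    have "evenperm p \<longleftrightarrow> \<not> evenperm r"
      using perm less.prems ab
      by (subst qr(3), subst evenperm_comp) (auto simp: evenperm_swap intro: permutes_imp_permutation)
    also have "\<dots> \<longleftrightarrow> 4 dvd card (moved p)"
      unfolding IH qr(7) using e pos by presburger
    finally show ?thesis .
  qed
qed

text \<open>Matching 2-cycles with 2-cycles and fixed points with fixed points gives a conjugator.
  It can be made even because \<open>p\<close> commutes with each of its own 2-cycles, so one of
  them may be multiplied in; a 2-cycle exists because \<open>p\<close> moves something.\<close>

lemma involutions_conjugate:
  fixes p q :: "'a::linorder \<Rightarrow> 'a"
  assumes p: "involution p" "moved p \<subseteq> S" and q: "involution q" "moved q \<subseteq> S"
    and S: "finite S" and card: "card (moved p) = card (moved q)" and ne: "moved p \<noteq> {}"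
  obtains g where "g permutes S" "evenperm g" "q = g \<circ> p \<circ> inv' g"
proof -
  note [simp] = involution_apply[OF p(1)] involution_apply[OF q(1)]
  have fin: "finite (moved p)" "finite (moved q)"
    using p q S by (auto intro: finite_subset)
  have "card {a. a < p a} = card {a. a < q a}"
    using card_moved_involution[OF p(1) fin(1)] card_moved_involution[OF q(1) fin(2)] card by simp
  moreover have "finite {a. a < p a}" "finite {a. a < q a}"
    using fin by (auto intro: rev_finite_subset)
  ultimately obtain f where f: "bij_betw f {a. a < p a} {a. a < q a}"
    using finite_same_card_bij by blast
  have "card (S - moved p) = card (S - moved q)"
    using p q S card fin by (simp add: card_Diff_subset)
  then obtain h where h: "bij_betw h (S - moved p) (S - moved q)"
    using finite_same_card_bij S by blast
  \<comment> \<open>The bijection \<open>f\<close> is given on smaller points only; the value at a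
    larger point is forced by \<open>g \<circ> p = q \<circ> g\<close>.\<close>
  define g where "g a = (if a < p a then f a else if p a < a then q (f (p a))
      else if a \<in> S then h a else a)" for a
  have L: "bij_betw g {a. a < p a} {a. a < q a}"
    by (rule bij_betw_cong[THEN iffD1, OF _ f]) (simp add: g_def)
  have iq: "bij_betw q {a. a < q a} {a. q a < a}"
    by (rule bij_betw_byWitness[where f' = q]) (use q in auto)
  have ip: "bij_betw p {a. p a < a} {a. a < p a}"
    by (rule bij_betw_byWitness[where f' = p]) (use p in auto)
  have "bij_betw (q \<circ> (f \<circ> p)) {a. p a < a} {a. q a < a}"
    by (intro bij_betw_trans[OF _ iq] bij_betw_trans[OF ip f])
  then have U: "bij_betw g {a. p a < a} {a. q a < a}"
    by (rule bij_betw_cong[THEN iffD1, rotated]) (auto simp: g_def)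
  have F: "bij_betw g (S - moved p) (S - moved q)"
    by (rule bij_betw_cong[THEN iffD1, OF _ h]) (auto simp: g_def)
  have "bij_betw g (({a. a < p a} \<union> {a. p a < a}) \<union> (S - moved p))
      (({a. a < q a} \<union> {a. q a < a}) \<union> (S - moved q))"
    by (intro bij_betw_combine L U F) auto
  moreover have "({a. a < p a} \<union> {a. p a < a}) \<union> (S - moved p) = S"
    "({a. a < q a} \<union> {a. q a < a}) \<union> (S - moved q) = S"
    using p q by auto
  ultimately have "bij_betw g S S" by simp
  then have gS: "g permutes S"
  proof (rule bij_imp_permutes)
    fix a assume "a \<notin> S"
    then have "p a = a" using p(2) by auto
    then show "g a = a" using \<open>a \<notin> S\<close> by (simp add: g_def)
  qed
  have gp: "g (p a) = q (g a)" for a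
  proof -
    consider "a < p a" | "p a < a" | "p a = a" "a \<in> S" | "p a = a" "a \<notin> S"
      by (meson linorder_less_linear)
    then show ?thesis
    proof cases
      case 1
      then show ?thesis by (auto simp: g_def)
    next
      case 2
      then show ?thesis by (auto simp: g_def)
    next
      case 3
      then have "h a \<in> S - moved q" using h by (auto simp: bij_betw_def)
      then show ?thesis using 3 by (simp add: g_def)
    next
      case 4
      then have "q a = a" using q by auto
      then show ?thesis using 4 by (simp add: g_def)
    qed
  qed
  have conj: "q = k \<circ> p \<circ> inv' k" if "k permutes S" "\<And>a. k (p a) = q (k a)" for k
    using that by (auto simp: fun_eq_iff permutes_inverses)
  show ?thesis
  proof (cases "evenperm g")
    case True
    then show ?thesis using that gS conj gp by blast
  next
    case False
    obtain a where a: "p a \<noteq> a" using ne by auto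
    define k where "k = g \<circ> transpose a (p a)"
    have aS: "a \<in> S" "p a \<in> S" using p a by auto
    have t: "transpose a (p a) permutes S" using aS by (rule permutes_swap_id)
    have "k permutes S" unfolding k_def using gS t by (simp add: permutes_compose)
    moreover have "evenperm k"
      unfolding k_def using gS t S False a
      by (subst evenperm_comp) (auto intro: permutes_imp_permutation simp: evenperm_swap)
    moreover have "k (p b) = q (k b)" for b
    proof -
      have "transpose a (p a) (p b) = p (transpose a (p a) b)"
        using p(1) by (auto simp: transpose_def) (metis involution_apply)+
      then show ?thesis by (simp add: k_def gp)
    qed
    ultimately show ?thesis using that conj by blast
  qed
qed

lemma involution_with_moved:
  assumes "finite T" "even (card T)"
  obtains p where "involution p" "moved p = T"
proof -
  have "\<exists>p. involution p \<and> moved p = T" if "finite T" "card T = 2 * n" for n and T :: "'a set"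
    using that
  proof (induction n arbitrary: T)
    case 0
    then show ?case by (intro exI[of _ id]) (auto simp: involution_def)
  next
    case (Suc n)
    obtain a b U where T: "T = insert a (insert b U)" "a \<noteq> b" "a \<notin> U" "b \<notin> U" "card U = 2 * n" "finite U"
    proof -
      obtain a V where V: "T = insert a V" "a \<notin> V" "card V = Suc (2 * n)"
        using Suc.prems card_Suc_eq[of T "Suc (2 * n)"] by auto
      then obtain b U where U: "V = insert b U" "b \<notin> U" "card U = 2 * n"
        using card_Suc_eq[of V "2 * n"] by auto
      show ?thesis using that[of a b U] V U Suc.prems by auto
    qed
    obtain p where p: "involution p" "moved p = U" using Suc.IH T by blast
    note [simp] = involution_apply[OF p(1)]
    have ab: "p a = a" "p b = b" using p T by auto
    have pab: "p x = a \<longleftrightarrow> x = a" "p x = b \<longleftrightarrow> x = b" for x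
      using ab by (metis involution_apply p(1))+
    have "involution (transpose a b \<circ> p)"
      using ab pab by (intro involutionI) (simp add: transpose_def)
    moreover have "moved (transpose a b \<circ> p) = T"
      unfolding T(1) p(2)[symmetric] using ab pab T(2)
      by (auto simp: transpose_def split: if_splits)
    ultimately show ?case by blast
  qed
  then show ?thesis using assms that by (metis evenE)
qed

section \<open>Factorization into involutions, and sets moved off themselves\<close>

text \<open>On every orbit, reflect about a base point: \<open>u\<close> sends the
  \<open>i\<close>-th iterate of \<open>h\<close> at the base point to the \<open>i\<close>-th
  iterate of the inverse. Then \<open>u\<close> conjugates \<open>h\<close> into its inverse, as in
  a dihedral group, and so \<open>u \<circ> h\<close> is an involution too.\<close>

lemma two_involutions:
  assumes h: "h permutes S" and S: "finite S"
  obtains u v where "involution u" "involution v" "h = u \<circ> v" "moved u \<subseteq> moved h" "moved v \<subseteq> moved h"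
proof -
  let ?k = "inv' h"
  have hk: "h (?k x) = x" "?k (h x) = x" for x using h by (auto simp: permutes_inverses)
  obtain N where N: "h ^^ N = id" "N > 0"
    using permutation_is_nilpotent h S permutation_permutes by blast
  have kh: "(?k ^^ i) ((h ^^ i) x) = x" for i x
    by (induction i arbitrary: x) (auto simp: hk funpow_swap1)
  have hk': "(h ^^ i) ((?k ^^ i) x) = x" for i x
    by (induction i arbitrary: x) (auto simp: hk funpow_swap1)
  have hN: "(h ^^ (N * i)) x = x" for i x
    using N(1) by (simp add: funpow_mult[symmetric] )
  \<comment> \<open>Finite order turns powers of the inverse into powers of \<open>h\<close>, so
    forward orbits are full orbits. The subtraction in \<open>N * i - i\<close> is not truncated
    because \<open>N > 0\<close>.\<close>
  have k_eq: "(?k ^^ i) x = (h ^^ (N * i - i)) x" for i x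
  proof -
    have "N * i - i + i = N * i" using N(2) by (cases N) auto
    then have "(h ^^ (N * i - i)) ((h ^^ i) y) = y" for y
      using hN[of i y] by (metis funpow_add comp_apply)
    from this[of "(?k ^^ i) x"] show ?thesis by (simp add: hk')
  qed
  define orb where "orb x = {(h ^^ i) x | i. True}" for x
  have orb_h: "orb ((h ^^ i) x) = orb x" for i x
  proof
    show "orb ((h ^^ i) x) \<subseteq> orb x"
      unfolding orb_def by (auto simp flip: comp_apply[of "h ^^ _" "h ^^ _"] funpow_add)
    have "(h ^^ j) x = (h ^^ (j + (N * i - i))) ((h ^^ i) x)" for j
      by (simp add: funpow_add flip: k_eq) (simp add: kh)
    then show "orb x \<subseteq> orb ((h ^^ i) x)"
      unfolding orb_def by blast
  qed
  \<comment> \<open>The choice depends only on the set \<open>orb x\<close>, so all points of one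
    orbit share their base point.\<close>
  define r where "r x = (SOME y. y \<in> orb x)" for x
  have r_mem: "r x \<in> orb x" for x
    unfolding r_def by (rule someI[of _ "(h ^^ 0) x"]) (unfold orb_def, blast)
  have r_h: "r ((h ^^ i) x) = r x" for i x
    by (simp add: r_def orb_h)
  have ex: "\<exists>i. (h ^^ i) (r x) = x" for x
  proof -
    obtain j where "r x = (h ^^ j) x" using r_mem[of x] unfolding orb_def by auto
    then have "(h ^^ (N * j - j)) (r x) = x" by (simp flip: k_eq add: kh)
    then show ?thesis by blast
  qed
  \<comment> \<open>The exponent leading from \<open>r x\<close> to \<open>x\<close> is not unique;
    \<open>wd\<close> shows that \<open>u x\<close> does not depend on the one chosen.\<close>
  define u where "u x = (?k ^^ (SOME i. (h ^^ i) (r x) = x)) (r x)" for x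
  have wd: "(?k ^^ i) a = (?k ^^ j) a" if "(h ^^ i) a = (h ^^ j) a" for i j a
  proof -
    have *: "(?k ^^ i) a = (?k ^^ j) a" if eq: "(h ^^ i) a = (h ^^ j) a" and le: "i \<le> j" for i j
    proof -
      obtain d where j: "j = i + d" using le le_Suc_ex by blast
      have "(h ^^ i) a = (h ^^ i) ((h ^^ d) a)" using eq j by (simp add: funpow_add)
      then have "a = (h ^^ d) a" by (metis kh)
      then have "(?k ^^ d) a = a" by (metis kh)
      then show ?thesis using j by (simp add: funpow_add)
    qed
    show ?thesis using *[OF that] *[OF that[symmetric], symmetric] nat_le_linear by blast
  qed
  have u_eq: "u x = (?k ^^ i) (r x)" if "(h ^^ i) (r x) = x" for i x
    unfolding u_def by (rule wd) (simp only: someI_ex[OF ex[of x]] that)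
  have uu: "u (u x) = x" for x
  proof -
    obtain i where i: "(h ^^ i) (r x) = x" using ex by blast
    have ux: "u x = (h ^^ (N * i - i)) (r x)" using u_eq[OF i] k_eq by simp
    have rr: "r (r x) = r x" using r_h[of i "r x"] i by simp
    have "r (u x) = r x" using r_h[of _ "r x"] ux rr by simp
    then have "u (u x) = (?k ^^ (N * i - i)) (r x)"
      by (intro trans[OF u_eq[of "N * i - i"]]) (auto simp: ux)
    also have "\<dots> = x"
    proof -
      have "r x = (h ^^ (N * i - i)) x" using i by (metis k_eq kh)
      then show ?thesis by (simp add: kh)
    qed
    finally show ?thesis .
  qed
  have uh: "u (h x) = ?k (u x)" for x
  proof -
    obtain i where i: "(h ^^ i) (r x) = x" using ex by blast
    have "r (h x) = r x" using r_h[of 1 x] by simp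
    then have "u (h x) = (?k ^^ Suc i) (r x)" using i by (intro trans[OF u_eq[of "Suc i"]]) auto
    then show ?thesis using u_eq[OF i] by simp
  qed
  have fixed: "u x = x" if "h x = x" for x
  proof -
    have p: "(h ^^ i) x = x" for i by (induction i) (auto simp: that)
    then have "r x = x" using r_mem[of x] unfolding orb_def by auto
    then show ?thesis using u_eq[of 0 x] by simp
  qed
  show ?thesis
  proof
    show "involution u" using uu by (rule involutionI)
    show "involution (u \<circ> h)" by (rule involutionI) (simp add: uh uu hk)
    show "h = u \<circ> (u \<circ> h)" by (simp add: fun_eq_iff uu)
    show "moved u \<subseteq> moved h" "moved (u \<circ> h) \<subseteq> moved h" using fixed by auto
  qed
qed

text \<open>Take \<open>A\<close> of maximal size. A moved point outside \<open>A\<close>, the image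
  of \<open>A\<close> and the preimage of \<open>A\<close> could be added to \<open>A\<close>; hence
  these three sets cover the support, whence the factor 3.\<close>

lemma displaced_subset:
  assumes x: "x permutes S" and S: "finite S"
  obtains A where "A \<subseteq> S" "A \<inter> x ` A = {}" "card (moved x) \<le> 3 * card A"
proof -
  define P where "P A \<longleftrightarrow> A \<subseteq> S \<and> A \<inter> x ` A = {}" for A
  have "P {}" by (simp add: P_def)
  moreover have "\<forall>A. P A \<longrightarrow> card A < Suc (card S)"
    using S by (auto simp: P_def less_Suc_eq_le intro: card_mono)
  ultimately obtain A where A: "P A" "\<And>B. P B \<Longrightarrow> card B \<le> card A"
    using ex_has_greatest_nat[of P "{}" card "Suc (card S)"] by blast
  have fA: "finite A" using A(1) S by (auto simp: P_def intro: finite_subset)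
  have "moved x \<subseteq> A \<union> x ` A \<union> inv' x ` A"
  proof
    fix a assume a: "a \<in> moved x"
    show "a \<in> A \<union> x ` A \<union> inv' x ` A"
    proof (rule ccontr)
      assume n: "\<not> ?thesis"
      have "x a \<notin> A" using n x by (auto simp: permutes_inverses image_iff)
      then have "P (insert a A)"
        using A(1) a n permutes_moved[OF x] x by (auto simp: P_def permutes_def)
      then have "card (insert a A) \<le> card A" by (rule A(2))
      then show False using n fA by simp
    qed
  qed
  then have "card (moved x) \<le> card (A \<union> x ` A \<union> inv' x ` A)"
    using fA by (intro card_mono) auto
  also have "\<dots> \<le> card A + card (x ` A) + card (inv' x ` A)"
    by (metis add_le_mono1 card_Un_le le_trans)
  also have "\<dots> \<le> 3 * card A"
    using card_image_le[OF fA, of x] card_image_le[OF fA, of "inv' x"] by simp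
  finally show ?thesis using that A(1) by (auto simp: P_def)
qed

lemma involution_comp_disjoint:
  assumes "involution p" "involution q" "moved p \<inter> moved q = {}"
  shows "involution (p \<circ> q)" "moved (p \<circ> q) = moved p \<union> moved q"
proof -
  note pq = involution_apply[OF assms(1)] involution_apply[OF assms(2)]
  have fixed: "q a = a" if "p a \<noteq> a" for a using that assms(3) by auto
  have fixed': "q (p a) = p a" if "p a \<noteq> a" for a
    using fixed[of "p a"] that pq by metis
  have comm: "p (q a) = q (p a)" for a
    by (metis fixed fixed' pq)
  show "involution (p \<circ> q)"
    by (rule involutionI) (simp add: comm pq)
  show "moved (p \<circ> q) = moved p \<union> moved q"
    using fixed pq by (auto, metis+)
qed

lemma double_transposition:
  assumes "distinct [a, b, c, d]"
  shows "involution (transpose a b \<circ> transpose c d)" "moved (transpose a b \<circ> transpose c d) = {a, b, c, d}"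
    "card (moved (transpose a b \<circ> transpose c d)) = 4"
proof -
  have "moved (transpose a b) \<inter> moved (transpose c d) = {}"
    using assms by (simp add: moved_transpose)
  note * = involution_comp_disjoint[OF involution_transpose involution_transpose this]
  show "involution (transpose a b \<circ> transpose c d)" by (fact *(1))
  show "moved (transpose a b \<circ> transpose c d) = {a, b, c, d}"
    unfolding *(2) using assms by (auto simp: moved_transpose)
  then show "card (moved (transpose a b \<circ> transpose c d)) = 4"
    using assms by simp
qed

section \<open>Even permutations as products of commutators\<close>

text \<open>For distinct points, the 3-cycle sending \<open>a\<close> to \<open>b\<close>,
  \<open>b\<close> to \<open>c\<close> and \<open>c\<close> to \<open>a\<close>.\<close>

abbreviation cyc :: "'a \<Rightarrow> 'a \<Rightarrow> 'a \<Rightarrow> 'a \<Rightarrow> 'a" where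
  "cyc a b c \<equiv> transpose a b \<circ> transpose b c"

lemma inv_cyc: "inv' (cyc a b c) = transpose b c \<circ> transpose a b"
  by (simp add: o_inv_distrib)

lemma conj_transpose: "bij x \<Longrightarrow> x \<circ> transpose a b \<circ> inv' x = transpose (x a) (x b)"
  by (auto simp: fun_eq_iff transpose_def bij_is_inj bij_is_surj surj_f_inv_f)

text \<open>The first factor is the 3-cycle transported by \<open>x\<close>, the second the inverse
  of \<open>cyc a b c\<close>. Commutators with 3-cycles can thus be read off from the values of
  \<open>x\<close> at three points.\<close>

lemma commutator_cyc:
  assumes "bij x"
  shows "x \<circ> cyc a b c \<circ> inv' x \<circ> inv' (cyc a b c) =
    cyc (x a) (x b) (x c) \<circ> (transpose b c \<circ> transpose a b)"
proof -
  have "x \<circ> cyc a b c \<circ> inv' x = (x \<circ> transpose a b \<circ> inv' x) \<circ> (x \<circ> transpose b c \<circ> inv' x)"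
    using assms by (simp add: fun_eq_iff bij_is_inj)
  also have "\<dots> = cyc (x a) (x b) (x c)"
    using assms by (simp only: conj_transpose)
  finally show ?thesis by (simp only: inv_cyc)
qed

lemma cyc_permutes: "\<lbrakk>a \<in> S; b \<in> S; c \<in> S\<rbrakk> \<Longrightarrow> cyc a b c permutes S"
  by (intro permutes_compose permutes_swap_id)

lemma evenperm_cyc: "\<lbrakk>a \<noteq> b; b \<noteq> c\<rbrakk> \<Longrightarrow> evenperm (cyc a b c)"
  by (subst evenperm_comp) (auto simp: evenperm_swap permutation_swap_id)

section \<open>Length filtrations closed under even conjugation\<close>

text \<open>\<open>K n\<close> stands for the elements of length at most \<open>n\<close>, to be
  instantiated with products of \<open>n\<close> conjugates of commutators. Conjugation is assumed
  for even permutations only, so that symmetric and alternating groups are covered at once.\<close>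

locale perm_filtration =
  fixes S :: "'a::linorder set" and K :: "nat \<Rightarrow> ('a \<Rightarrow> 'a) set"
  assumes S_finite: "finite S"
    and K_permutes: "f \<in> K n \<Longrightarrow> f permutes S"
    and K_id: "id \<in> K n"
    and K_comp: "\<lbrakk>f \<in> K a; g \<in> K b\<rbrakk> \<Longrightarrow> f \<circ> g \<in> K (a + b)"
    and K_inv: "f \<in> K n \<Longrightarrow> inv' f \<in> K n"
    and K_conj: "\<lbrakk>f \<in> K n; g permutes S; evenperm g\<rbrakk> \<Longrightarrow> g \<circ> f \<circ> inv' g \<in> K n"
begin

lemma K_mono: "f \<in> K a \<Longrightarrow> a \<le> b \<Longrightarrow> f \<in> K b"
  using K_comp[OF _ K_id, of f a "b - a"] by simp

definition commutators_in :: "('a \<Rightarrow> 'a) \<Rightarrow> nat \<Rightarrow> bool" where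
  "commutators_in x n \<longleftrightarrow> x permutes S \<and>
     (\<forall>c. c permutes S \<and> evenperm c \<longrightarrow> x \<circ> c \<circ> inv' x \<circ> inv' c \<in> K n)"

text \<open>The commutator is \<open>y\<close> times a conjugate of the inverse of \<open>y\<close>,
  hence twice the length. Commutators can therefore be iterated on elements already
  obtained.\<close>

lemma commutators_in_K:
  assumes "y \<in> K n" shows "commutators_in y (2 * n)"
  unfolding commutators_in_def
proof (intro conjI allI impI)
  show "y permutes S" using assms by (rule K_permutes)
  fix c :: "'a \<Rightarrow> 'a" assume c: "c permutes S \<and> evenperm c"
  have "y \<circ> (c \<circ> inv' y \<circ> inv' c) \<in> K (n + n)"
    using assms c by (intro K_comp K_conj K_inv) auto
  then show "y \<circ> c \<circ> inv' y \<circ> inv' c \<in> K (2 * n)"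
    by (simp add: comp_assoc mult_2)
qed

lemma commutator_cyc_in:
  assumes "commutators_in y n" "distinct [a, b, c]" "{a, b, c} \<subseteq> S"
  shows "cyc (y a) (y b) (y c) \<circ> (transpose b c \<circ> transpose a b) \<in> K n"
proof -
  have "y \<circ> cyc a b c \<circ> inv' y \<circ> inv' (cyc a b c) \<in> K n"
    using assms cyc_permutes[of a S b c] evenperm_cyc[of a b c]
    unfolding commutators_in_def by auto
  moreover have "bij y"
    using assms(1) unfolding commutators_in_def by (auto intro: permutes_bij)
  ultimately show ?thesis by (simp only: commutator_cyc)
qed

text \<open>Along a path of four distinct points the two 3-cycles making up the commutator share two
  points, and their product is again a 3-cycle.\<close>

lemma path_cyc:
  assumes "commutators_in y n" "y a = b" "y b = c" "y c = d" "distinct [a, b, c, d]" "{a, b, c} \<subseteq> S"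
  shows "cyc a d b \<in> K n"
proof -
  have "cyc b c d \<circ> (transpose b c \<circ> transpose a b) \<in> K n"
    using commutator_cyc_in[of y n a b c] assms by auto
  also have "cyc b c d \<circ> (transpose b c \<circ> transpose a b) = cyc a d b"
    using assms(5) by (auto simp: fun_eq_iff transpose_def)
  finally show ?thesis .
qed

lemma cyc_fixed_double_transposition:
  assumes "commutators_in y n" "y a = b" "y b = c" "y c = a" "y d = d"
    "distinct [a, b, c, d]" "{a, b, c, d} \<subseteq> S"
  shows "transpose a b \<circ> transpose d c \<in> K n"
proof -
  have "cyc b c d \<circ> (transpose b d \<circ> transpose a b) \<in> K n"
    using commutator_cyc_in[of y n a b d] assms by auto
  also have "cyc b c d \<circ> (transpose b d \<circ> transpose a b) = transpose a b \<circ> transpose d c"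
    using assms(6) by (auto simp: fun_eq_iff transpose_def)
  finally show ?thesis .
qed

text \<open>A fourth point of \<open>S\<close> is fixed by the 3-cycle, so one more commutator gives
  a double transposition, at twice the length.\<close>

lemma cyc_double_transposition:
  assumes "cyc a b c \<in> K n" "distinct [a, b, c]" "{a, b, c} \<subseteq> S" "card S \<ge> 4"
  shows "\<exists>a b c d. distinct [a, b, c, d] \<and> {a, b, c, d} \<subseteq> S \<and> transpose a b \<circ> transpose c d \<in> K (2 * n)"
proof -
  have "\<not> S \<subseteq> {a, b, c}"
  proof
    assume "S \<subseteq> {a, b, c}"
    then have "card S \<le> card {a, b, c}" by (rule card_mono[rotated]) simp
    also have "\<dots> \<le> 3" by (simp add: card_insert_if)
    finally show False using assms(4) by linarith
  qed
  then obtain d where "d \<in> S" "d \<notin> {a, b, c}" by blast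
  then have "transpose a b \<circ> transpose d c \<in> K (2 * n)"
    using assms by (intro cyc_fixed_double_transposition[OF commutators_in_K[OF assms(1)]]) auto
  then have "distinct [a, b, d, c] \<and> {a, b, d, c} \<subseteq> S \<and> transpose a b \<circ> transpose d c \<in> K (2 * n)"
    using assms(2,3) \<open>d \<in> S\<close> \<open>d \<notin> {a, b, c}\<close> by auto
  then show ?thesis by blast
qed

text \<open>Let \<open>a\<close> be moved, \<open>b\<close> and \<open>c\<close> its next two
  iterates, and \<open>d\<close> a point outside them. The cases are that \<open>a\<close> lies in a
  2-cycle, in a longer cycle than a 3-cycle, or in a 3-cycle; for 2-cycles and 3-cycles they also
  depend on whether \<open>d\<close> is fixed. The bound 4 comes from the last case, which takes two
  further commutators.\<close>

lemma double_transposition_exists: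
  assumes x: "commutators_in x 1" "x \<noteq> id" and m: "card S \<ge> 5"
  shows "\<exists>a b c d. distinct [a, b, c, d] \<and> {a, b, c, d} \<subseteq> S \<and> transpose a b \<circ> transpose c d \<in> K 4"
    (is "?P 4")
proof -
  have mono: "?P 4" if "?P n" "n \<le> 4" for n
    using that(1) by (elim exE conjE) (intro exI conjI K_mono[OF _ that(2)])
  have xp: "x permutes S" using x(1) by (simp add: commutators_in_def)
  have inj: "x u = x v \<longleftrightarrow> u = v" for u v
    using permutes_inj[OF xp] by (auto dest: injD)
  have xm: "x u \<in> S \<longleftrightarrow> u \<in> S" for u
    using permutes_in_image[OF xp] .
  obtain a where a: "x a \<noteq> a" using x(2) by (auto simp: fun_eq_iff)
  define b where "b = x a"
  define c where "c = x b"
  have am: "a \<in> S" using a xp by (auto simp: permutes_def)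
  have mem: "a \<in> S" "b \<in> S" "c \<in> S"
    using am xm unfolding b_def c_def by blast+
  have bc: "b \<noteq> a" "c \<noteq> b" using a inj by (auto simp: b_def c_def)
  have "\<not> S \<subseteq> {a, b, c}"
  proof
    assume "S \<subseteq> {a, b, c}"
    then have "card S \<le> card {a, b, c}" by (rule card_mono[rotated]) simp
    also have "\<dots> \<le> 3" by (simp add: card_insert_if)
    finally show False using m by linarith
  qed
  then obtain d where d: "d \<in> S" "d \<noteq> a" "d \<noteq> b" "d \<noteq> c" by blast
  define e where "e = x d"
  have em: "e \<in> S" using d xm unfolding e_def by blast
  have xs: "x a = b" "x b = c" "x d = e" by (auto simp: b_def c_def e_def)
  consider "c = a" "e = d" | "c = a" "e \<noteq> d" | "c \<noteq> a" "x c \<noteq> a" | "c \<noteq> a" "x c = a" "e = d"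
    | "c \<noteq> a" "x c = a" "e \<noteq> d" by blast
  then show ?thesis
  proof cases
    case 1
    have "cyc b a d \<circ> (transpose b d \<circ> transpose a b) \<in> K 1"
      using commutator_cyc_in[of x 1 a b d] x(1) mem d bc xs 1 by auto
    also have "cyc b a d \<circ> (transpose b d \<circ> transpose a b) = cyc b d a"
      using d bc by (auto simp: fun_eq_iff transpose_def)
    finally have "?P (2 * 1)" by (rule cyc_double_transposition) (use mem d bc m in auto)
    then show ?thesis by (rule mono) simp
  next
    case 2
    have ne: "e \<noteq> a" "e \<noteq> b" using xs inj d 2 by metis+
    have "cyc b a e \<circ> (transpose b d \<circ> transpose a b) \<in> K 1"
      using commutator_cyc_in[of x 1 a b d] x(1) mem d bc xs 2 by auto
    also have "cyc b a e \<circ> (transpose b d \<circ> transpose a b) = transpose b e \<circ> transpose a d"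
      using d bc ne 2 by (auto simp: fun_eq_iff transpose_def)
    finally have "transpose b e \<circ> transpose a d \<in> K 1" .
    moreover have "distinct [b, e, a, d] \<and> {b, e, a, d} \<subseteq> S"
      using mem d bc em ne 2 by auto
    ultimately have "?P 1" by blast
    then show ?thesis by (rule mono) simp
  next
    case 3
    have ne: "x c \<noteq> c" "x c \<noteq> b" using xs inj bc 3 by metis+
    have "cyc a (x c) b \<in> K 1"
      using x(1) xs 3 bc ne mem by (intro path_cyc[of x _ a b c]) auto
    then have "?P (2 * 1)" by (rule cyc_double_transposition) (use mem bc ne 3 m xm[of c] in auto)
    then show ?thesis by (rule mono) simp
  next
    case 4
    have "transpose a b \<circ> transpose d c \<in> K 1"
      using x(1) xs 4 bc d mem by (intro cyc_fixed_double_transposition[of x]) auto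
    then have "distinct [a, b, d, c] \<and> {a, b, d, c} \<subseteq> S \<and> transpose a b \<circ> transpose d c \<in> K 1"
      using mem bc d 4(1) by auto
    then have "?P 1" by blast
    then show ?thesis by (rule mono) simp
  next
    case 5
    have ne: "e \<noteq> a" "e \<noteq> b" "e \<noteq> c" using xs inj d 5 by metis+
    \<comment> \<open>This commutator is a 5-cycle on \<open>b, a, d, c, e\<close>; its first four
      points form the path used next.\<close>
    have y: "cyc b c e \<circ> (transpose b d \<circ> transpose a b) \<in> K 1" (is "?y \<in> _")
      using commutator_cyc_in[of x 1 a b d] x(1) mem d bc xs 5 by auto
    have ys: "?y b = a" "?y a = d" "?y d = c"
      using d bc ne 5 by (auto simp: transpose_def)
    have "cyc b c a \<in> K (2 * 1)"
      by (rule path_cyc[OF commutators_in_K[OF y] ys]) (use mem bc d 5 in auto)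
    then have "?P (2 * (2 * 1))" by (rule cyc_double_transposition) (use mem bc 5 m in auto)
    then show ?thesis by (rule mono) simp
  qed
qed

end

section \<open>Reaching even permutations from the support of one element\<close>

locale large_perm_filtration = perm_filtration +
  fixes x :: "'a \<Rightarrow> 'a"
  assumes x_comm: "commutators_in x 1" and x_ne: "x \<noteq> id" and m5: "card S \<ge> 5"
begin

lemma x_permutes: "x permutes S"
  using x_comm by (simp add: commutators_in_def)

text \<open>Involutions of equal nonempty support size are conjugate under even permutations, so one
  member of \<open>K n\<close> brings in all the others of its size.\<close>

lemma involution_transfer:
  assumes "involution p" "moved p \<subseteq> S" "moved p \<noteq> {}" "p \<in> K n"
    and "involution q" "moved q \<subseteq> S" "card (moved q) = card (moved p)"
  shows "q \<in> K n"
proof -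
  obtain g where "g permutes S" "evenperm g" "q = g \<circ> p \<circ> inv' g"
    using involutions_conjugate[of p S q] assms S_finite by auto
  then show ?thesis using K_conj assms(4) by auto
qed

lemma involution4_in_K:
  assumes "involution q" "moved q \<subseteq> S" "card (moved q) = 4"
  shows "q \<in> K 4"
proof -
  obtain a b c d where *: "distinct [a, b, c, d]" "{a, b, c, d} \<subseteq> S" "transpose a b \<circ> transpose c d \<in> K 4"
    using double_transposition_exists[OF x_comm x_ne m5] by blast
  note dt = double_transposition[OF *(1)]
  show ?thesis
    using assms * dt by (intro involution_transfer[OF dt(1) _ _ *(3) assms(1)]) auto
qed

text \<open>Overlapping transpositions are separated by an auxiliary one: \<open>(a b)(c d)\<close>
  is the product of \<open>(a b)(e f)\<close> and \<open>(e f)(c d)\<close>. The overlapping pairs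
  occupy at most three points, and degree at least 5 leaves two for \<open>e\<close> and
  \<open>f\<close>.\<close>

lemma two_transpositions_in_K:
  assumes "a \<noteq> b" "c \<noteq> d" "{a, b, c, d} \<subseteq> S"
  shows "transpose a b \<circ> transpose c d \<in> K 8"
proof (cases "distinct [a, b, c, d]")
  case True
  then have "transpose a b \<circ> transpose c d \<in> K 4"
    using double_transposition[OF True] assms by (intro involution4_in_K) auto
  then show ?thesis by (rule K_mono) simp
next
  case False
  have "card {a, b, c, d} \<le> 3"
    using False assms(1,2) by (auto simp: card_insert_if)
  then have "2 \<le> card (S - {a, b, c, d})"
    using assms(3) m5 by (subst card_Diff_subset) auto
  then obtain T where "T \<subseteq> S - {a, b, c, d}" "card T = 2"
    by (meson obtain_subset_with_card_n)
  then obtain e f where ef: "e \<noteq> f" "{e, f} \<subseteq> S - {a, b, c, d}"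
    by (auto simp: card_2_iff)
  have "transpose a b \<circ> transpose e f \<in> K 4" "transpose e f \<circ> transpose c d \<in> K 4"
    using ef assms double_transposition[of a b e f] double_transposition[of e f c d]
    by (auto intro!: involution4_in_K)
  from K_comp[OF this] show ?thesis
    by (simp add: fun_eq_iff comp_def)
qed

text \<open>
  On a set \<open>T\<close> that \<open>x\<close> moves off itself, \<open>x c x\<inverse> c\<inverse>\<close> is the disjoint union of the
  involution \<open>c\<close> and its translate, so arbitrarily large involutions up to a fixed fraction of
  the support of \<open>x\<close> are single commutators.
\<close>

lemma involution8_in_K:
  assumes A: "A \<subseteq> S" "A \<inter> x ` A = {}" and i: "4 * i \<le> card A"
    and q: "involution q" "moved q \<subseteq> S" "card (moved q) = 8 * i"
  shows "q \<in> K 1"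
proof (cases "i = 0")
  case True
  then have "moved q = {}" using q finite_subset[OF q(2) S_finite] by simp
  then have "q = id" by auto
  then show ?thesis using K_id by simp
next
  case False
  \<comment> \<open>Since 4 divides the size of \<open>T\<close>, the involution \<open>c\<close> is
    even and its commutator with \<open>x\<close> is available; that commutator moves twice as many
    points.\<close>
  obtain T where T: "T \<subseteq> A" "card T = 4 * i" "finite T"
    using i by (meson obtain_subset_with_card_n)
  obtain c where c: "involution c" "moved c = T"
    using involution_with_moved[of T] T by auto
  have c_perm: "c permutes S"
    using involution_permutes[OF c(1)] c(2) T A by auto
  have c_even: "evenperm c"
    using involution_evenperm_iff[OF c(1)] c(2) T by auto
  define c' where "c' = x \<circ> c \<circ> inv' x"
  have ix: "inv' x (x a) = a" "x (inv' x a) = a" for a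
    using permutes_inverses[OF x_permutes] by auto
  have c': "involution c'"
    using involution_apply[OF c(1)] by (intro involutionI) (simp add: c'_def ix)
  have "c' a \<noteq> a \<longleftrightarrow> inv' x a \<in> T" for a
    unfolding c(2)[symmetric] c'_def by (simp, metis ix)
  moreover have "a \<in> x ` T \<longleftrightarrow> inv' x a \<in> T" for a
    by (metis image_iff ix)
  ultimately have mc': "moved c' = x ` T" by auto
  have xT: "x ` T \<inter> T = {}" using T(1) A(2) by blast
  then have disj: "moved c' \<inter> moved c = {}" using mc' c(2) by simp
  have "c' \<circ> c \<in> K 1"
    using x_comm c_perm c_even involution_inv[OF c(1)]
    unfolding commutators_in_def c'_def by auto
  moreover have y: "involution (c' \<circ> c)" "moved (c' \<circ> c) = x ` T \<union> T"
    using involution_comp_disjoint[OF c' c(1) disj] mc' c(2) by auto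
  moreover have "card (x ` T \<union> T) = 8 * i"
    using T xT card_image[OF permutes_inj_on[OF x_permutes], of T]
    by (simp add: card_Un_disjoint)
  moreover have "x ` T \<union> T \<subseteq> S"
    using T A permutes_in_image[OF x_permutes] by auto
  moreover have "x ` T \<union> T \<noteq> {}" using T False by auto
  ultimately show ?thesis
    using q by (intro involution_transfer[OF y(1) _ _ _ q(1,2)]) auto
qed

text \<open>One commutator reaches the multiples of 8 up to \<open>8 * R\<close> as support sizes;
  an additional double transposition, of cost 4, fills in the other multiples of 4 and extends the
  range to \<open>8 * R + 4\<close>. Larger supports are cut into pieces of that size, each of cost
  at most 5.\<close>

lemma even_involution_in_K:
  assumes A: "A \<subseteq> S" "A \<inter> x ` A = {}" and R: "4 * R \<le> card A"
    and "involution p" "moved p \<subseteq> S" "4 dvd card (moved p)" "card (moved p) \<le> j * (8 * R + 4)"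
  shows "p \<in> K (5 * j)"
  using assms(4-)
proof (induction j arbitrary: p)
  case 0
  then have "moved p = {}" using finite_subset[OF 0(2) S_finite] by simp
  then have "p = id" by auto
  then show ?case using K_id[of 0] by (simp only: mult_0_right)
next
  case (Suc j)
  have small: "p \<in> K 5" if p: "involution p" "moved p \<subseteq> S"
    "4 dvd card (moved p)" "card (moved p) \<le> 8 * R + 4" for p
  proof (cases "8 dvd card (moved p)")
    case True
    then obtain i where i: "card (moved p) = 8 * i" by (elim dvdE)
    then have "4 * i \<le> card A" using p(4) R by presburger
    then have "p \<in> K 1" using i p by (intro involution8_in_K[OF A, of i]) auto
    then show ?thesis by (rule K_mono) simp
  next
    case False
    define i where "i = card (moved p) div 8"
    have i: "card (moved p) = 8 * i + 4" using False p(3) unfolding i_def by presburger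
    then have iA: "4 * i \<le> card A" using p(4) R by presburger
    have fin: "finite (moved p)" by (rule finite_subset[OF p(2) S_finite])
    obtain q r where qr: "involution q" "involution r" "p = q \<circ> r" "moved q \<subseteq> moved p"
      "moved r \<subseteq> moved p" "card (moved q) = 2 * 2" "card (moved r) = card (moved p) - 2 * 2"
      using involution_split[OF p(1) fin, of 2] i by auto
    have "q \<in> K 4" using qr p by (intro involution4_in_K) auto
    moreover have "r \<in> K 1"
      using qr p i iA by (intro involution8_in_K[OF A, of i]) auto
    ultimately show ?thesis using K_comp[of q 4 r 1] qr(3) by simp
  qed
  show ?case
  proof (cases "card (moved p) \<le> 8 * R + 4")
    case True
    then have "p \<in> K 5" using Suc.prems by (intro small) auto
    then show ?thesis by (rule K_mono) simp
  next
    case False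
    have fin: "finite (moved p)" by (rule finite_subset[OF Suc.prems(2) S_finite])
    \<comment> \<open>The piece split off has size \<open>8 * R + 4\<close>, a multiple of 4, so
      both factors remain even.\<close>
    obtain q r where qr: "involution q" "involution r" "p = q \<circ> r" "moved q \<subseteq> moved p"
      "moved r \<subseteq> moved p" "card (moved q) = 2 * (4 * R + 2)"
      "card (moved r) = card (moved p) - 2 * (4 * R + 2)"
      using involution_split[OF Suc.prems(1) fin, of "4 * R + 2"] False by auto
    have q4: "4 dvd card (moved q)" unfolding qr(6) by presburger
    have "q \<in> K 5" by (rule small[OF qr(1) _ q4]) (use qr Suc.prems in auto)
    moreover have "r \<in> K (5 * j)"
    proof (rule Suc.IH)
      show "4 dvd card (moved r)" using q4 Suc.prems(3) unfolding qr(6,7) by (intro dvd_diff_nat)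
      show "card (moved r) \<le> j * (8 * R + 4)" unfolding qr(7) using Suc.prems(4) by simp
    qed (use qr Suc.prems in auto)
    ultimately have "q \<circ> r \<in> K (5 + 5 * j)" by (rule K_comp)
    then show ?thesis unfolding qr(3)[symmetric] by simp
  qed
qed

text \<open>In \<open>h = u \<circ> v\<close> the two involutions have equal parity. If they are
  odd, a transposition is split off from each in such a way that both stand in the middle, where
  their product costs 8. Each remaining even involution costs \<open>15 * k\<close>, which is
  \<open>5 * (3 * k)\<close> with the 3 from \<open>displaced_subset\<close>.\<close>

lemma evenperm_in_K:
  assumes h: "h permutes S" "evenperm h" "card (moved h) \<le> k * card (moved x)"
  shows "h \<in> K (30 * k + 8)"
proof -
  obtain A where A: "A \<subseteq> S" "A \<inter> x ` A = {}" and cA: "card (moved x) \<le> 3 * card A"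
    using displaced_subset[OF x_permutes S_finite] by auto
  \<comment> \<open>Rounding loses at most three points of \<open>A\<close>. They are absorbed by
    \<open>8 * R + 4\<close>, which stays positive even if \<open>A\<close> has fewer than four
    points.\<close>
  define R where "R = card A div 4"
  have R: "4 * R \<le> card A" by (simp add: R_def)
  have "card A \<le> 4 * R + 3" unfolding R_def by presburger
  then have "card (moved x) \<le> 3 * (8 * R + 4)" using cA by simp
  then have "k * card (moved x) \<le> k * (3 * (8 * R + 4))" by (rule mult_le_mono2)
  then have hb: "card (moved h) \<le> (3 * k) * (8 * R + 4)" using h(3) by (simp add: algebra_simps)
  obtain u v where uv: "involution u" "involution v" "h = u \<circ> v" "moved u \<subseteq> moved h" "moved v \<subseteq> moved h"
    using two_involutions[OF h(1) S_finite] by auto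
  have hm: "moved h \<subseteq> S" using permutes_moved[OF h(1)] .
  have fh: "finite (moved h)" by (rule finite_subset[OF hm S_finite])
  have um: "moved u \<subseteq> S" and vm: "moved v \<subseteq> S" using uv hm by auto
  have fu: "finite (moved u)" and fv: "finite (moved v)"
    using uv fh by (auto intro: finite_subset)
  have up: "u permutes S" and vp: "v permutes S"
    using involution_permutes uv um vm by auto
  have small: "p \<in> K (15 * k)" if "involution p" "moved p \<subseteq> moved h" "4 dvd card (moved p)" for p
  proof -
    have "card (moved p) \<le> card (moved h)" using that fh by (intro card_mono)
    then have "p \<in> K (5 * (3 * k))"
      using that hm hb by (intro even_involution_in_K[OF A R]) auto
    then show ?thesis by simp
  qed
  have par: "evenperm u \<longleftrightarrow> evenperm v"
    using h(2) up vp unfolding uv(3) by (subst (asm) evenperm_comp) (auto intro: permutes_imp_permutation[OF S_finite])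
  show ?thesis
  proof (cases "evenperm u")
    case True
    then have "u \<in> K (15 * k)" "v \<in> K (15 * k)"
      using small[OF uv(1,4)] small[OF uv(2,5)] par
        involution_evenperm_iff[OF uv(1) fu] involution_evenperm_iff[OF uv(2) fv] by auto
    from K_comp[OF this] show ?thesis unfolding uv(3) by (rule K_mono) simp
  next
    case False
    have *: "\<exists>q a b. involution q \<and> moved q \<subseteq> moved p \<and> 4 dvd card (moved q) \<and> a \<noteq> b \<and> {a, b} \<subseteq> moved p
        \<and> p = transpose a b \<circ> q"
      if p: "involution p" "finite (moved p)" "\<not> evenperm p" for p :: "'a \<Rightarrow> 'a"
    proof -
      have n4: "\<not> 4 dvd card (moved p)" using involution_evenperm_iff[OF p(1,2)] p(3) by simp
      moreover have e: "even (card (moved p))" using card_moved_involution[OF p(1,2)] by simp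
      ultimately have c2: "2 * 1 \<le> card (moved p)" by presburger
      obtain q r where qr: "involution q" "involution r" "p = q \<circ> r" "moved q \<subseteq> moved p"
        "moved r \<subseteq> moved p" "card (moved q) = 2 * 1" "card (moved r) = card (moved p) - 2 * 1"
        using involution_split[OF p(1,2) c2] by blast
      have "q permutes moved p" using qr involution_permutes by blast
      then obtain a b where ab: "a \<noteq> b" "q = transpose a b"
        using card2_moved_transpose[of q "moved p"] qr(6) by auto
      have "{a, b} \<subseteq> moved p" using qr(4) moved_transpose[OF ab(1)] unfolding ab(2) by simp
      moreover have "4 dvd card (moved r)" unfolding qr(7) using n4 e c2 by presburger
      ultimately show ?thesis using qr ab by blast
    qed
    obtain q a b where q: "involution q" "moved q \<subseteq> moved u" "4 dvd card (moved q)" "a \<noteq> b"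
      "{a, b} \<subseteq> moved u" "u = transpose a b \<circ> q"
      using *[OF uv(1) fu False] by blast
    \<comment> \<open>Inverting the involution \<open>u\<close> moves its transposition to the
      right, next to the one split off from \<open>v\<close>.\<close>
    have u': "u = q \<circ> transpose a b"
    proof -
      have "u = inv' u" using involution_inv[OF uv(1)] by simp
      also have "\<dots> = inv' q \<circ> inv' (transpose a b)"
        unfolding q(6) using involution_permutes[OF q(1) subset_refl]
        by (intro o_inv_distrib) (auto intro: permutes_bij)
      finally show ?thesis using involution_inv[OF q(1)] by simp
    qed
    obtain r c d where r: "involution r" "moved r \<subseteq> moved v" "4 dvd card (moved r)" "c \<noteq> d"
      "{c, d} \<subseteq> moved v" "v = transpose c d \<circ> r"
      using *[OF uv(2) fv] par False by blast
    have "{a, b, c, d} \<subseteq> S" using q(5) r(5) um vm by auto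
    then have t: "transpose a b \<circ> transpose c d \<in> K 8"
      using q(4) r(4) by (intro two_transpositions_in_K)
    have "q \<in> K (15 * k)" "r \<in> K (15 * k)" 
      using small[OF q(1)] small[OF r(1)] q(2,3) r(2,3) uv(4,5) by auto
    then have "q \<circ> (transpose a b \<circ> transpose c d) \<circ> r \<in> K (15 * k + 8 + 15 * k)"
      by (intro K_comp t)
    moreover have "h = q \<circ> (transpose a b \<circ> transpose c d) \<circ> r"
      using uv(3) u' r(6) by (simp add: comp_assoc)
    ultimately show ?thesis by (simp add: K_mono)
  qed
qed

end

section \<open>Products of conjugates\<close>

lemma conj_products_0 [simp]: "conj_products H X 0 = {\<one>\<^bsub>H\<^esub>}"
  by (auto simp: conj_products_def)

lemma conj_products_Suc:
  "conj_products H X (Suc n) =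
     {inv\<^bsub>H\<^esub> g \<otimes>\<^bsub>H\<^esub> x \<otimes>\<^bsub>H\<^esub> g \<otimes>\<^bsub>H\<^esub> c | g x c. x \<in> carrier H \<and> g \<in> carrier H \<and>
        (x \<in> X \<or> inv\<^bsub>H\<^esub> x \<in> X) \<and> c \<in> conj_products H X n}"
proof (rule subset_antisym; rule subsetI)
  fix a assume "a \<in> conj_products H X (Suc n)"
  then obtain ps where ps: "length ps = Suc n"
    "\<forall>(x, g) \<in> set ps. x \<in> carrier H \<and> g \<in> carrier H \<and> (x \<in> X \<or> inv\<^bsub>H\<^esub> x \<in> X)"
    "a = foldr (\<otimes>\<^bsub>H\<^esub>) (map (\<lambda>(x, g). inv\<^bsub>H\<^esub> g \<otimes>\<^bsub>H\<^esub> x \<otimes>\<^bsub>H\<^esub> g) ps) \<one>\<^bsub>H\<^esub>"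
    unfolding conj_products_def by blast
  then obtain x g qs where "ps = (x, g) # qs" "length qs = n"
    by (metis length_Suc_conv surj_pair)
  then show "a \<in> {inv\<^bsub>H\<^esub> g \<otimes>\<^bsub>H\<^esub> x \<otimes>\<^bsub>H\<^esub> g \<otimes>\<^bsub>H\<^esub> c | g x c. x \<in> carrier H \<and> g \<in> carrier H \<and>
        (x \<in> X \<or> inv\<^bsub>H\<^esub> x \<in> X) \<and> c \<in> conj_products H X n}"
    using ps unfolding conj_products_def by auto
next
  fix a assume "a \<in> {inv\<^bsub>H\<^esub> g \<otimes>\<^bsub>H\<^esub> x \<otimes>\<^bsub>H\<^esub> g \<otimes>\<^bsub>H\<^esub> c | g x c. x \<in> carrier H \<and> g \<in> carrier H \<and>
        (x \<in> X \<or> inv\<^bsub>H\<^esub> x \<in> X) \<and> c \<in> conj_products H X n}"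
  then obtain g x c where *: "a = inv\<^bsub>H\<^esub> g \<otimes>\<^bsub>H\<^esub> x \<otimes>\<^bsub>H\<^esub> g \<otimes>\<^bsub>H\<^esub> c" "x \<in> carrier H" "g \<in> carrier H"
    "x \<in> X \<or> inv\<^bsub>H\<^esub> x \<in> X" "c \<in> conj_products H X n" by blast
  then obtain ps where ps: "length ps = n"
    "\<forall>(x, g) \<in> set ps. x \<in> carrier H \<and> g \<in> carrier H \<and> (x \<in> X \<or> inv\<^bsub>H\<^esub> x \<in> X)"
    "c = foldr (\<otimes>\<^bsub>H\<^esub>) (map (\<lambda>(x, g). inv\<^bsub>H\<^esub> g \<otimes>\<^bsub>H\<^esub> x \<otimes>\<^bsub>H\<^esub> g) ps) \<one>\<^bsub>H\<^esub>"
    unfolding conj_products_def by blast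
  show "a \<in> conj_products H X (Suc n)"
    unfolding conj_products_def
    by (rule CollectI, rule exI[of _ "(x, g) # ps"]) (use * ps in auto)
qed

section \<open>Rules for products of conjugates in a fixed group\<close>

locale conj_group = group G for G :: "'a monoid" (structure)
begin

lemma inv_cancel:
  "\<lbrakk>x \<in> carrier G; y \<in> carrier G\<rbrakk> \<Longrightarrow> inv x \<otimes> (x \<otimes> y) = y"
  "\<lbrakk>x \<in> carrier G; y \<in> carrier G\<rbrakk> \<Longrightarrow> x \<otimes> (inv x \<otimes> y) = y"
  by (simp_all flip: m_assoc)

lemma conj_products_SucI:
  "\<lbrakk>x \<in> carrier G; g \<in> carrier G; x \<in> X \<or> inv x \<in> X; c \<in> conj_products G X n\<rbrakk>
    \<Longrightarrow> inv g \<otimes> x \<otimes> g \<otimes> c \<in> conj_products G X (Suc n)"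
  unfolding conj_products_Suc by blast

lemma conj_products_closed: "a \<in> conj_products G X n \<Longrightarrow> a \<in> carrier G"
  by (induction n arbitrary: a) (auto simp: conj_products_Suc)

lemma conj_products_mult:
  "\<lbrakk>a \<in> conj_products G X n; b \<in> conj_products G X k\<rbrakk> \<Longrightarrow> a \<otimes> b \<in> conj_products G X (n + k)"
proof (induction n arbitrary: a)
  case 0
  then show ?case by (simp add: conj_products_closed)
next
  case (Suc n)
  then obtain g x c where *: "a = inv g \<otimes> x \<otimes> g \<otimes> c" "x \<in> carrier G" "g \<in> carrier G"
    "x \<in> X \<or> inv x \<in> X" "c \<in> conj_products G X n"
    unfolding conj_products_Suc by blast
  then have "a \<otimes> b = inv g \<otimes> x \<otimes> g \<otimes> (c \<otimes> b)"
    using conj_products_closed[OF Suc.prems(2)] conj_products_closed[OF *(5)] by (simp add: m_assoc)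
  then show ?case using conj_products_SucI[of x g X "c \<otimes> b" "n + k"] * Suc by simp
qed

lemma conj_products_generator:
  assumes "x \<in> carrier G" "g \<in> carrier G" "x \<in> X \<or> inv x \<in> X"
  shows "inv g \<otimes> x \<otimes> g \<in> conj_products G X 1"
  using conj_products_SucI[OF assms, of \<one> 0] assms by simp

lemma conj_products_base: "x \<in> X \<Longrightarrow> x \<in> carrier G \<Longrightarrow> x \<in> conj_products G X 1"
  using conj_products_generator[of x \<one> X] by simp

text \<open>Factors equal to \<open>\<one>\<close> serve as padding. They make the sets increase
  with \<open>n\<close>, which is why the defects will be arranged to contain
  \<open>\<one>\<close>.\<close>

lemma conj_products_one: "\<one> \<in> X \<Longrightarrow> \<one> \<in> conj_products G X n"
proof (induction n)
  case (Suc n)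
  then show ?case using conj_products_SucI[of \<one> \<one> X \<one> n] by simp
qed simp

lemma conj_products_mono:
  assumes "\<one> \<in> X" "n \<le> k" "a \<in> conj_products G X n"
  shows "a \<in> conj_products G X k"
  using conj_products_mult[OF assms(3) conj_products_one[OF assms(1), of "k - n"]] assms(2)
    conj_products_closed[OF assms(3)] by simp

lemma conj_products_conj:
  "\<lbrakk>a \<in> conj_products G X n; h \<in> carrier G\<rbrakk> \<Longrightarrow> inv h \<otimes> a \<otimes> h \<in> conj_products G X n"
proof (induction n arbitrary: a)
  case 0
  then show ?case by simp
next
  case (Suc n)
  then obtain g x c where *: "a = inv g \<otimes> x \<otimes> g \<otimes> c" "x \<in> carrier G" "g \<in> carrier G"
    "x \<in> X \<or> inv x \<in> X" "c \<in> conj_products G X n"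
    unfolding conj_products_Suc by blast
  have c: "c \<in> carrier G" by (rule conj_products_closed[OF *(5)])
  have "inv h \<otimes> a \<otimes> h = inv (g \<otimes> h) \<otimes> x \<otimes> (g \<otimes> h) \<otimes> (inv h \<otimes> c \<otimes> h)"
    using * c Suc.prems(2) by (simp add: m_assoc inv_mult_group inv_cancel)
  also have "\<dots> \<in> conj_products G X (Suc n)"
    using * Suc by (intro conj_products_SucI) auto
  finally show ?case .
qed

lemma conj_products_conj':
  "\<lbrakk>a \<in> conj_products G X n; h \<in> carrier G\<rbrakk> \<Longrightarrow> h \<otimes> a \<otimes> inv h \<in> conj_products G X n"
  using conj_products_conj[of a X n "inv h"] by simp

lemma conj_products_inv: "a \<in> conj_products G X n \<Longrightarrow> inv a \<in> conj_products G X n"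
proof (induction n arbitrary: a)
  case 0
  then show ?case by simp
next
  case (Suc n)
  then obtain g x c where *: "a = inv g \<otimes> x \<otimes> g \<otimes> c" "x \<in> carrier G" "g \<in> carrier G"
    "x \<in> X \<or> inv x \<in> X" "c \<in> conj_products G X n"
    unfolding conj_products_Suc by blast
  have c: "c \<in> carrier G" by (rule conj_products_closed[OF *(5)])
  have "inv a = inv c \<otimes> (inv g \<otimes> inv x \<otimes> g)"
    using * c by (simp add: m_assoc inv_mult_group)
  also have "\<dots> \<in> conj_products G X (n + 1)"
    using * by (intro conj_products_mult[OF Suc.IH] conj_products_generator) auto
  finally show ?case by simp
qed

text \<open>Subadditivity and invariance suffice, so the same induction serves for the Hamming
  length and for the number of points moved in one coordinate of a product.\<close>

lemma conj_products_length:
  fixes l :: "'a \<Rightarrow> real"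
  assumes one: "l \<one> = 0"
    and mult: "\<And>a b. \<lbrakk>a \<in> carrier G; b \<in> carrier G\<rbrakk> \<Longrightarrow> l (a \<otimes> b) \<le> l a + l b"
    and inv: "\<And>a. a \<in> carrier G \<Longrightarrow> l (inv a) = l a"
    and conj: "\<And>a g. \<lbrakk>a \<in> carrier G; g \<in> carrier G\<rbrakk> \<Longrightarrow> l (inv g \<otimes> a \<otimes> g) = l a"
    and X: "\<And>x. x \<in> X \<Longrightarrow> l x \<le> B"
  shows "a \<in> conj_products G X n \<Longrightarrow> l a \<le> real n * B"
proof (induction n arbitrary: a)
  case 0
  then show ?case using one by simp
next
  case (Suc n)
  then obtain g x c where *: "a = inv g \<otimes> x \<otimes> g \<otimes> c" "x \<in> carrier G" "g \<in> carrier G"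
    "x \<in> X \<or> inv x \<in> X" "c \<in> conj_products G X n"
    unfolding conj_products_Suc by blast
  have "l a \<le> l (inv g \<otimes> x \<otimes> g) + l c"
    unfolding *(1) using * by (intro mult conj_products_closed[of c X n]) auto
  also have "l (inv g \<otimes> x \<otimes> g) = l x" using * by (intro conj)
  also have "l x \<le> B" using *(4) X inv[OF *(2)] by metis
  finally show ?case using Suc.IH[OF *(5)] by (simp add: algebra_simps)
qed

lemma conj_products_hom:
  assumes H: "group H" and f: "f \<in> hom G H"
  shows "a \<in> conj_products G X n \<Longrightarrow> f a \<in> conj_products H (f ` X) n"
proof (induction n arbitrary: a)
  interpret f: group_hom G H f
    using f H by (simp add: group_hom_def group_hom_axioms_def is_group)
  {
    case 0
    then show ?case by simp
  next
    case (Suc n)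
    then obtain g x c where *: "a = inv g \<otimes> x \<otimes> g \<otimes> c" "x \<in> carrier G" "g \<in> carrier G"
      "x \<in> X \<or> inv x \<in> X" "c \<in> conj_products G X n"
      unfolding conj_products_Suc by blast
    have "f a = inv\<^bsub>H\<^esub> (f g) \<otimes>\<^bsub>H\<^esub> f x \<otimes>\<^bsub>H\<^esub> f g \<otimes>\<^bsub>H\<^esub> f c"
      using * conj_products_closed[OF *(5)] by simp
    moreover have "f x \<in> f ` X \<or> inv\<^bsub>H\<^esub> (f x) \<in> f ` X"
      using *(4) f.hom_inv[OF *(2)] by force
    ultimately show ?case
      unfolding conj_products_Suc using * Suc.IH[OF *(5)] f.hom_closed by blast
  }
qed

text \<open>The sets form an increasing chain in which each is determined by its predecessor. The
  chain is therefore constant from its first repetition on, and a repetition occurs within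
  \<open>order G\<close> steps.\<close>

lemma conj_products_stable:
  assumes fin: "finite (carrier G)" and one: "\<one> \<in> X" and a: "a \<in> conj_products G X n"
  shows "a \<in> conj_products G X (order G)"
proof -
  let ?C = "conj_products G X"
  have finC: "finite (?C i)" for i
    by (rule finite_subset[OF _ fin]) (auto intro: conj_products_closed)
  have sub: "?C i \<subseteq> ?C j" if "i \<le> j" for i j
    using conj_products_mono[OF one that] by blast
  have "\<exists>i\<le>order G. ?C i = ?C (Suc i)"
  proof (rule ccontr)
    assume *: "\<not> ?thesis"
    have "i \<le> Suc (order G) \<Longrightarrow> Suc i \<le> card (?C i)" for i
    proof (induction i)
      case (Suc i)
      then have "?C i \<subset> ?C (Suc i)" using * sub[of i "Suc i"] by auto
      then have "card (?C i) < card (?C (Suc i))" by (rule psubset_card_mono[OF finC])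
      then show ?case using Suc by simp
    qed simp
    from this[of "order G"] have "Suc (order G) \<le> card (?C (order G))" by simp
    also have "\<dots> \<le> order G"
      unfolding order_def by (rule card_mono[OF fin]) (auto intro: conj_products_closed)
    finally show False by simp
  qed
  then obtain i where i: "i \<le> order G" "?C i = ?C (Suc i)" by blast
  have "?C (i + j) = ?C i" for j
  proof (induction j)
    case (Suc j)
    have "?C (Suc (i + j)) = ?C (Suc i)" using Suc by (simp add: conj_products_Suc)
    then show ?case using i by simp
  qed simp
  then have "?C n \<subseteq> ?C i"
    using sub[of n "i + n"] by simp
  then show ?thesis using a sub[OF i(1)] by blast
qed

text \<open>Longer products give nothing new, so the set is closed under multiplication: for
  \<open>X\<close> inside the group it is the normal closure of \<open>X\<close>.\<close>

lemma conj_products_normal: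
  assumes fin: "finite (carrier G)" and one: "\<one> \<in> X"
  shows "conj_products G X (order G) \<lhd> G"
proof (rule normal_invI)
  show "subgroup (conj_products G X (order G)) G"
  proof
    fix a b assume "a \<in> conj_products G X (order G)" "b \<in> conj_products G X (order G)"
    from conj_products_mult[OF this] show "a \<otimes> b \<in> conj_products G X (order G)"
      by (rule conj_products_stable[OF fin one])
  qed (use conj_products_closed conj_products_one[OF one] conj_products_inv in auto)
qed (rule conj_products_conj')

end

section \<open>Commutators with a fixed element in symmetric and alternating groups\<close>

definition commutators_with :: "'h monoid \<Rightarrow> 'h \<Rightarrow> 'h set" where
  "commutators_with H x = {x \<otimes>\<^bsub>H\<^esub> c \<otimes>\<^bsub>H\<^esub> inv\<^bsub>H\<^esub> x \<otimes>\<^bsub>H\<^esub> inv\<^bsub>H\<^esub> c | c. c \<in> carrier H}"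

lemma (in conj_group) one_in_commutators_with: "x \<in> carrier G \<Longrightarrow> \<one> \<in> commutators_with G x"
  by (auto simp: commutators_with_def intro!: exI[of _ \<one>])

text \<open>
  The pattern \<open>x, x\<inverse>\<close> is the same for every \<open>y\<close>; in a direct product this allows the
  conjugators to be chosen independently in each coordinate.
\<close>

lemma (in conj_group) commutators_with_pattern:
  assumes x: "x \<in> carrier G" and y: "y \<in> carrier G" "y \<in> commutators_with G x \<or> inv y \<in> commutators_with G x"
    and g: "g \<in> carrier G"
  obtains a b where "a \<in> carrier G" "b \<in> carrier G"
    "inv g \<otimes> y \<otimes> g = (inv a \<otimes> x \<otimes> a) \<otimes> (inv b \<otimes> inv x \<otimes> b)"
proof -
  have comm: "\<exists>a b. a \<in> carrier G \<and> b \<in> carrier G \<and> y = (inv a \<otimes> x \<otimes> a) \<otimes> (inv b \<otimes> inv x \<otimes> b)"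
  proof (cases "y \<in> commutators_with G x")
    case True
    then obtain c where c: "c \<in> carrier G" "y = x \<otimes> c \<otimes> inv x \<otimes> inv c"
      unfolding commutators_with_def by blast
    then have "y = (inv \<one> \<otimes> x \<otimes> \<one>) \<otimes> (inv (inv c) \<otimes> inv x \<otimes> inv c)"
      using x by (simp add: m_assoc)
    then show ?thesis using c by blast
  next
    case False
    then obtain c where c: "c \<in> carrier G" "inv y = x \<otimes> c \<otimes> inv x \<otimes> inv c"
      using y unfolding commutators_with_def by blast
    then have "y = inv (x \<otimes> c \<otimes> inv x \<otimes> inv c)" using y(1) by (metis inv_inv)
    also have "\<dots> = (inv (inv c) \<otimes> x \<otimes> inv c) \<otimes> (inv \<one> \<otimes> inv x \<otimes> \<one>)"
      using x c by (simp add: m_assoc inv_mult_group)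
    finally show ?thesis using c by blast
  qed
  then obtain a b where ab: "a \<in> carrier G" "b \<in> carrier G"
    "y = (inv a \<otimes> x \<otimes> a) \<otimes> (inv b \<otimes> inv x \<otimes> b)" by blast
  have "inv g \<otimes> y \<otimes> g = (inv (a \<otimes> g) \<otimes> x \<otimes> (a \<otimes> g)) \<otimes> (inv (b \<otimes> g) \<otimes> inv x \<otimes> (b \<otimes> g))"
    unfolding ab(3) using ab(1,2) x g by (simp add: m_assoc inv_mult_group inv_cancel)
  then show ?thesis using that[of "a \<otimes> g" "b \<otimes> g"] ab g by simp
qed

definition is_perm_group :: "nat \<Rightarrow> (nat \<Rightarrow> nat) monoid \<Rightarrow> bool" where
  "is_perm_group m F \<longleftrightarrow> F = sym_group m \<or> F = alt_group m"

lemma perm_group_simps: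
  assumes "is_perm_group m F"
  shows "group F" "\<And>f g. f \<otimes>\<^bsub>F\<^esub> g = f \<circ> g" "\<one>\<^bsub>F\<^esub> = id" "finite (carrier F)"
    "\<And>f. f \<in> carrier F \<Longrightarrow> f permutes {1..m}"
    "\<And>f. f permutes {1..m} \<Longrightarrow> evenperm f \<Longrightarrow> f \<in> carrier F"
    "\<And>f. f \<in> carrier F \<Longrightarrow> inv\<^bsub>F\<^esub> f = inv' f"
proof -
  have "finite (carrier (sym_group m))"
    using finite_permutations[of "{1..m}"] by (simp add: sym_group_def)
  moreover have "finite (carrier (alt_group m))"
    by (rule finite_subset[OF _ calculation]) (auto simp: sym_group_carrier alt_group_carrier)
  ultimately show "finite (carrier F)"
    using assms by (auto simp: is_perm_group_def)
  show "inv\<^bsub>F\<^esub> f = inv' f" if "f \<in> carrier F" for f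
    using assms that by (auto simp: is_perm_group_def alt_group_inv_equality)
qed (use assms sym_group_is_group alt_group_is_group in \<open>auto simp: is_perm_group_def sym_group_mult
      alt_group_mult sym_group_one alt_group_one sym_group_carrier alt_group_carrier simp del: One_nat_def\<close>)

text \<open>This is the filtration argument applied to \<open>F\<close>. Length is counted in
  commutators rather than in conjugates of \<open>x\<close>, because a factorization into
  commutators can be carried out in all coordinates of a direct product simultaneously.\<close>

lemma evenperm_in_commutator_products:
  assumes F: "is_perm_group m F" and m: "m \<ge> 5" and x: "x \<in> carrier F"
    and h: "h permutes {1..m}" "evenperm h" "card (moved h) \<le> k * card (moved x)"
  shows "h \<in> conj_products F (commutators_with F x) (30 * k + 8)"
proof (cases "x = id")
  case True
  have "finite (moved h)" using permutes_moved[OF h(1)] by (rule finite_subset) simp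
  then have "h = id" using h(3) True by auto
  then show ?thesis
    using conj_group.conj_products_one[OF conj_group.intro[OF perm_group_simps(1)[OF F]]]
      conj_group.one_in_commutators_with[OF conj_group.intro[OF perm_group_simps(1)[OF F]] x]
    by (metis perm_group_simps(3)[OF F])
next
  case False
  interpret F: conj_group F by (rule conj_group.intro[OF perm_group_simps(1)[OF F]])
  note S = perm_group_simps[OF F]
  let ?K = "conj_products F (commutators_with F x)"
  have one: "\<one>\<^bsub>F\<^esub> \<in> commutators_with F x" by (rule F.one_in_commutators_with[OF x])
  interpret perm_filtration "{1..m}" ?K
  proof
    show "f \<in> ?K n \<Longrightarrow> f permutes {1..m}" for f n
      using F.conj_products_closed S(5) by blast
    show "id \<in> ?K n" for n using F.conj_products_one[OF one] S(3) by simp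
    show "\<lbrakk>f \<in> ?K a; g \<in> ?K b\<rbrakk> \<Longrightarrow> f \<circ> g \<in> ?K (a + b)" for f g a b
      using F.conj_products_mult S(2) by metis
    show "f \<in> ?K n \<Longrightarrow> inv' f \<in> ?K n" for f n
      using F.conj_products_inv S(7) F.conj_products_closed by metis
    show "g \<circ> f \<circ> inv' g \<in> ?K n" if "f \<in> ?K n" "g permutes {1..m}" "evenperm g" for f g n
      using F.conj_products_conj'[OF that(1) S(6)[OF that(2,3)]] S(7)[OF S(6)[OF that(2,3)]]
      by (simp add: S(2))
  qed simp
  interpret large_perm_filtration "{1..m}" ?K x
  proof
    show "commutators_in x 1"
      unfolding commutators_in_def
    proof (intro conjI allI impI)
      show "x permutes {1..m}" using S(5) x .
      fix c assume c: "c permutes {1..m} \<and> evenperm c"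
      then have cF: "c \<in> carrier F" using S(6) by blast
      then have "x \<otimes>\<^bsub>F\<^esub> c \<otimes>\<^bsub>F\<^esub> inv\<^bsub>F\<^esub> x \<otimes>\<^bsub>F\<^esub> inv\<^bsub>F\<^esub> c \<in> ?K 1"
        using x by (intro F.conj_products_base) (auto simp: commutators_with_def)
      then show "x \<circ> c \<circ> inv' x \<circ> inv' c \<in> ?K 1"
        using S(7) x cF by (simp add: S(2))
    qed
  qed (use False m in auto)
  show ?thesis using h by (rule evenperm_in_K)
qed

section \<open>Permutation representations and their lengths\<close>

text \<open>Numbering the points turns a finite action into a homomorphism to a symmetric group.
  Translations of a group and actions on pairs can then be used without encoding them by
  numbers.\<close>

lemma action_hom:
  assumes fin: "finite \<Omega>" "\<Omega> \<noteq> {}"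
    and bij: "\<And>y. y \<in> carrier H \<Longrightarrow> bij_betw (\<rho> y) \<Omega> \<Omega>"
    and mult: "\<And>y z \<omega>. \<lbrakk>y \<in> carrier H; z \<in> carrier H; \<omega> \<in> \<Omega>\<rbrakk> \<Longrightarrow> \<rho> (y \<otimes>\<^bsub>H\<^esub> z) \<omega> = \<rho> y (\<rho> z \<omega>)"
  obtains L \<psi> where "L \<ge> 1" "\<psi> \<in> hom H (sym_group L)"
    "\<And>y. y \<in> carrier H \<Longrightarrow> hamming_length L (\<psi> y) = real (card {\<omega> \<in> \<Omega>. \<rho> y \<omega> \<noteq> \<omega>}) / real (card \<Omega>)"
proof -
  define L where "L = card \<Omega>"
  obtain f where f: "bij_betw f {1..L} \<Omega>"
    using ex_bij_betw_nat_finite_1[OF fin(1)] unfolding L_def by blast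
  define g where "g = inv_into {1..L} f"
  have g: "bij_betw g \<Omega> {1..L}"
    unfolding g_def by (rule bij_betw_inv_into[OF f])
  have gf: "g (f j) = j" if "j \<in> {1..L}" for j
    using f that unfolding g_def by (simp add: bij_betw_inv_into_left)
  have fg: "f (g \<omega>) = \<omega>" if "\<omega> \<in> \<Omega>" for \<omega>
    using f that unfolding g_def by (simp add: bij_betw_inv_into_right)
  have f_mem: "f j \<in> \<Omega>" if "j \<in> {1..L}" for j using f that by (auto simp: bij_betw_def)
  have g_mem: "g \<omega> \<in> {1..L}" if "\<omega> \<in> \<Omega>" for \<omega> using g that unfolding bij_betw_def by blast
  have r_mem: "\<rho> y \<omega> \<in> \<Omega>" if "y \<in> carrier H" "\<omega> \<in> \<Omega>" for y \<omega>
    using bij[OF that(1)] that(2) by (auto simp: bij_betw_def)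
  define \<psi> where "\<psi> y j = (if j \<in> {1..L} then g (\<rho> y (f j)) else j)" for y j
  show ?thesis
  proof
    show "L \<ge> 1" using fin by (simp add: L_def Suc_le_eq card_gt_0_iff)
    show "\<psi> \<in> hom H (sym_group L)"
    proof (rule homI)
      fix y assume y: "y \<in> carrier H"
      have "bij_betw (g \<circ> (\<rho> y \<circ> f)) {1..L} {1..L}"
        by (intro bij_betw_trans[OF _ g] bij_betw_trans[OF f bij[OF y]])
      then have "bij_betw (\<psi> y) {1..L} {1..L}"
        by (rule bij_betw_cong[THEN iffD1, rotated]) (simp add: \<psi>_def)
      then show "\<psi> y \<in> carrier (sym_group L)"
        unfolding sym_group_carrier by (rule bij_imp_permutes) (auto simp: \<psi>_def)
    next
      fix y z assume yz: "y \<in> carrier H" "z \<in> carrier H"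
      show "\<psi> (y \<otimes>\<^bsub>H\<^esub> z) = \<psi> y \<otimes>\<^bsub>sym_group L\<^esub> \<psi> z"
        unfolding sym_group_mult
      proof
        fix j
        show "\<psi> (y \<otimes>\<^bsub>H\<^esub> z) j = (\<psi> y \<circ> \<psi> z) j"
        proof (cases "j \<in> {1..L}")
          case True
          have "f j \<in> \<Omega>" using True by (rule f_mem)
          then have "\<psi> y (g (\<rho> z (f j))) = g (\<rho> y (\<rho> z (f j)))"
            using g_mem[OF r_mem[OF yz(2)]] fg[OF r_mem[OF yz(2)]] by (simp add: \<psi>_def)
          then show ?thesis using True mult[OF yz] \<open>f j \<in> \<Omega>\<close> by (simp add: \<psi>_def)
        next
          case False
          then show ?thesis unfolding \<psi>_def comp_apply by (simp only: if_False)
        qed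
      qed
    qed
    fix y assume y: "y \<in> carrier H"
    have eq: "{j \<in> {1..L}. \<psi> y j \<noteq> j} = g ` {\<omega> \<in> \<Omega>. \<rho> y \<omega> \<noteq> \<omega>}"
    proof (rule subset_antisym; rule subsetI)
      fix j assume j: "j \<in> {j \<in> {1..L}. \<psi> y j \<noteq> j}"
      then have "\<rho> y (f j) \<noteq> f j" using gf by (auto simp: \<psi>_def)
      then show "j \<in> g ` {\<omega> \<in> \<Omega>. \<rho> y \<omega> \<noteq> \<omega>}"
        using j f_mem gf by (intro image_eqI[of _ _ "f j"]) auto
    next
      fix j assume "j \<in> g ` {\<omega> \<in> \<Omega>. \<rho> y \<omega> \<noteq> \<omega>}"
      then obtain \<omega> where \<omega>: "\<omega> \<in> \<Omega>" "\<rho> y \<omega> \<noteq> \<omega>" "j = g \<omega>" by blast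
      have "g (\<rho> y \<omega>) \<noteq> g \<omega>" using \<omega> fg r_mem[OF y \<omega>(1)] by metis
      then have "\<psi> y j \<noteq> j" using \<omega> g_mem fg by (simp add: \<psi>_def)
      then show "j \<in> {j \<in> {1..L}. \<psi> y j \<noteq> j}" using \<omega> g_mem by blast
    qed
    have "inj_on g {\<omega> \<in> \<Omega>. \<rho> y \<omega> \<noteq> \<omega>}"
      using g by (auto simp: bij_betw_def intro: inj_on_subset)
    then show "hamming_length L (\<psi> y) = real (card {\<omega> \<in> \<Omega>. \<rho> y \<omega> \<noteq> \<omega>}) / real (card \<Omega>)"
      unfolding hamming_length_def eq by (simp add: card_image L_def)
  qed
qed

section \<open>Normalized length, translations and tensor products\<close>

lemma hamming_length_nonneg: "0 \<le> hamming_length m f"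
  by (simp add: hamming_length_def)

lemma hamming_length_le_1: "hamming_length m f \<le> 1"
proof -
  have "card {x \<in> {1..m}. f x \<noteq> x} \<le> card {1..m}" by (rule card_mono) auto
  then show ?thesis by (cases "m = 0") (auto simp: hamming_length_def divide_le_eq_1)
qed

lemma one_minus_hamming_length:
  "m \<ge> 1 \<Longrightarrow> 1 - hamming_length m f = real (card {x \<in> {1..m}. f x = x}) / real m"
proof -
  assume m: "m \<ge> 1"
  have "card {1..m} = card ({x \<in> {1..m}. f x \<noteq> x} \<union> {x \<in> {1..m}. f x = x})"
    by (rule arg_cong[where f = card]) auto
  also have "\<dots> = card {x \<in> {1..m}. f x \<noteq> x} + card {x \<in> {1..m}. f x = x}"
    by (rule card_Un_disjoint) auto
  finally have "real m = real (card {x \<in> {1..m}. f x \<noteq> x}) + real (card {x \<in> {1..m}. f x = x})"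
    by simp
  then show ?thesis using m by (simp add: hamming_length_def field_simps)
qed

lemma hamming_length_id [simp]: "hamming_length m id = 0" "hamming_length m (\<lambda>x. x) = 0"
  by (simp_all add: hamming_length_def)

text \<open>Left translation by a nontrivial element has no fixed point.\<close>

lemma cayley_hom:
  assumes "group H" "finite (carrier H)"
  obtains L \<psi> where "L \<ge> 1" "\<psi> \<in> hom H (sym_group L)"
    "\<And>y. y \<in> carrier H \<Longrightarrow> hamming_length L (\<psi> y) = (if y = \<one>\<^bsub>H\<^esub> then 0 else 1)"
proof -
  interpret group H by fact
  have ne: "carrier H \<noteq> {}" using one_closed by blast
  have bij: "bij_betw (\<lambda>\<omega>. y \<otimes>\<^bsub>H\<^esub> \<omega>) (carrier H) (carrier H)" if "y \<in> carrier H" for y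
    by (rule bij_betw_byWitness[where f' = "\<lambda>\<omega>. inv\<^bsub>H\<^esub> y \<otimes>\<^bsub>H\<^esub> \<omega>"])
      (use that in \<open>auto simp flip: m_assoc\<close>)
  obtain L \<psi> where *: "L \<ge> 1" "\<psi> \<in> hom H (sym_group L)"
    "\<And>y. y \<in> carrier H \<Longrightarrow> hamming_length L (\<psi> y) =
      real (card {\<omega> \<in> carrier H. y \<otimes>\<^bsub>H\<^esub> \<omega> \<noteq> \<omega>}) / real (card (carrier H))"
    by (rule action_hom[OF assms(2) ne bij]) (auto simp: m_assoc)
  have "{\<omega> \<in> carrier H. y \<otimes>\<^bsub>H\<^esub> \<omega> \<noteq> \<omega>} = (if y = \<one>\<^bsub>H\<^esub> then {} else carrier H)" if "y \<in> carrier H" for y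
    using that by auto
  then have "hamming_length L (\<psi> y) = (if y = \<one>\<^bsub>H\<^esub> then 0 else 1)" if "y \<in> carrier H" for y
    using that *(3)[OF that] assms(2) ne by (simp add: card_gt_0_iff)
  then show ?thesis using that * by blast
qed

text \<open>In the action on pairs a point is fixed exactly if both components are, so the
  proportions of fixed points multiply.\<close>

lemma tensor_hom:
  assumes H: "\<psi>1 \<in> hom H (sym_group L1)" "\<psi>2 \<in> hom H (sym_group L2)" and L: "L1 \<ge> 1" "L2 \<ge> 1"
  obtains L \<psi> where "L \<ge> 1" "\<psi> \<in> hom H (sym_group L)"
    "\<And>y. y \<in> carrier H \<Longrightarrow> 1 - hamming_length L (\<psi> y) =
      (1 - hamming_length L1 (\<psi>1 y)) * (1 - hamming_length L2 (\<psi>2 y))"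
proof -
  let ?\<Omega> = "{1..L1} \<times> {1..L2}"
  let ?\<rho> = "\<lambda>y. map_prod (\<psi>1 y) (\<psi>2 y)"
  have p: "\<psi>1 y permutes {1..L1}" "\<psi>2 y permutes {1..L2}" if "y \<in> carrier H" for y
    using H that by (auto simp: hom_def sym_group_carrier Pi_iff simp del: One_nat_def)
  have m: "\<psi>1 (y \<otimes>\<^bsub>H\<^esub> z) = \<psi>1 y \<circ> \<psi>1 z" "\<psi>2 (y \<otimes>\<^bsub>H\<^esub> z) = \<psi>2 y \<circ> \<psi>2 z"
    if "y \<in> carrier H" "z \<in> carrier H" for y z
    using H that by (auto simp: hom_def sym_group_mult)
  have bij: "bij_betw (?\<rho> y) ?\<Omega> ?\<Omega>" if "y \<in> carrier H" for y
    using p[OF that] by (intro bij_betw_map_prod permutes_imp_bij)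
  obtain L \<psi> where *: "L \<ge> 1" "\<psi> \<in> hom H (sym_group L)"
    "\<And>y. y \<in> carrier H \<Longrightarrow> hamming_length L (\<psi> y) = real (card {\<omega> \<in> ?\<Omega>. ?\<rho> y \<omega> \<noteq> \<omega>}) / real (card ?\<Omega>)"
    by (rule action_hom[of ?\<Omega> H ?\<rho>]) (use L bij m in auto)
  have "1 - hamming_length L (\<psi> y) = (1 - hamming_length L1 (\<psi>1 y)) * (1 - hamming_length L2 (\<psi>2 y))"
    if y: "y \<in> carrier H" for y
  proof -
    let ?A = "{x \<in> {1..L1}. \<psi>1 y x = x}" and ?B = "{x \<in> {1..L2}. \<psi>2 y x = x}"
    have eq: "{\<omega> \<in> ?\<Omega>. ?\<rho> y \<omega> \<noteq> \<omega>} = ?\<Omega> - ?A \<times> ?B" by auto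
    have sub: "?A \<times> ?B \<subseteq> ?\<Omega>" by auto
    have "card {\<omega> \<in> ?\<Omega>. ?\<rho> y \<omega> \<noteq> \<omega>} + card (?A \<times> ?B) = card ?\<Omega>"
      unfolding eq using card_mono[OF _ sub] by (subst card_Diff_subset[OF _ sub]) auto
    then have "real (card {\<omega> \<in> ?\<Omega>. ?\<rho> y \<omega> \<noteq> \<omega>}) = real (card ?\<Omega>) - real (card ?A) * real (card ?B)"
      by (simp add: card_cartesian_product flip: of_nat_mult of_nat_add)
    then have "hamming_length L (\<psi> y) = (real L1 * real L2 - real (card ?A) * real (card ?B)) / (real L1 * real L2)"
      using *(3)[OF y] by (simp add: card_cartesian_product)
    then show ?thesis
      unfolding one_minus_hamming_length[OF L(1)] one_minus_hamming_length[OF L(2)]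
      using L by (simp add: field_simps)
  qed
  then show ?thesis using that * by blast
qed

lemma tensor_family_hom:
  assumes "finite A"
    and "\<And>a. a \<in> A \<Longrightarrow> L a \<ge> 1" "\<And>a. a \<in> A \<Longrightarrow> \<psi> a \<in> hom H (sym_group (L a))"
  shows "\<exists>M\<ge>1. \<exists>\<Psi>\<in>hom H (sym_group M). \<forall>y\<in>carrier H.
    1 - hamming_length M (\<Psi> y) = (\<Prod>a\<in>A. 1 - hamming_length (L a) (\<psi> a y))"
  using assms
proof (induction A rule: finite_induct)
  case empty
  have "(\<lambda>_. id) \<in> hom H (sym_group 1)" by (auto simp: hom_def sym_group_def)
  then show ?case by (intro exI[of _ 1] conjI bexI[of _ "\<lambda>_. id"]) auto
next
  case (insert a A)
  have "\<exists>M\<ge>1. \<exists>\<Psi>\<in>hom H (sym_group M). \<forall>y\<in>carrier H.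
      1 - hamming_length M (\<Psi> y) = (\<Prod>a\<in>A. 1 - hamming_length (L a) (\<psi> a y))"
    using insert.prems by (intro insert.IH) auto
  then obtain M \<Psi> where *: "M \<ge> 1" "\<Psi> \<in> hom H (sym_group M)"
    "\<And>y. y \<in> carrier H \<Longrightarrow> 1 - hamming_length M (\<Psi> y) = (\<Prod>a\<in>A. 1 - hamming_length (L a) (\<psi> a y))"
    by blast
  have "\<psi> a \<in> hom H (sym_group (L a))" "L a \<ge> 1" using insert.prems by auto
  from tensor_hom[OF this(1) *(2) this(2) *(1)] obtain N \<Psi>' where "N \<ge> 1" "\<Psi>' \<in> hom H (sym_group N)"
    "\<And>y. y \<in> carrier H \<Longrightarrow> 1 - hamming_length N (\<Psi>' y) =
      (1 - hamming_length (L a) (\<psi> a y)) * (1 - hamming_length M (\<Psi> y))"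
    by blast
  then show ?case using insert.hyps *(3) by (intro exI[of _ N] conjI bexI[of _ \<Psi>']) auto
qed

text \<open>
  A power of a permutation representation with \<open>q \<approx> 1 / l\<close> factors raises length \<open>l\<close>
  to at least \<open>1 - 1/e\<close>, and multiplies every length by at most \<open>q\<close>.
\<close>

lemma amplify_hom:
  fixes k :: real
  assumes \<psi>: "\<psi> \<in> hom H (sym_group m)" and m: "m \<ge> 1" and k: "k > 0"
    and h: "h \<in> carrier H" "hamming_length m (\<psi> h) > 0"
    and X: "X \<subseteq> carrier H" "\<And>x. x \<in> X \<Longrightarrow> k * hamming_length m (\<psi> x) \<le> hamming_length m (\<psi> h)"
  obtains M \<Psi> where "M \<ge> 1" "\<Psi> \<in> hom H (sym_group M)" "hamming_length M (\<Psi> h) \<ge> 1 / 2"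
    "\<And>x. x \<in> X \<Longrightarrow> hamming_length M (\<Psi> x) \<le> 2 / k"
proof -
  define l where "l = hamming_length m (\<psi> h)"
  have l: "0 < l" "l \<le> 1" using h hamming_length_le_1 by (auto simp: l_def)
  define q where "q = nat \<lceil>1 / l\<rceil>"
  have q1: "1 / l \<le> real q" unfolding q_def by (rule real_nat_ceiling_ge)
  have "real q \<le> 1 / l + 1"
    unfolding q_def using l by (simp add: of_nat_nat ceiling_le_iff)
  \<comment> \<open>The 1 added by rounding up is at most \<open>1 / l\<close>, since
    \<open>l\<close> is at most 1.\<close>
  then have q2: "real q \<le> 2 / l"
    using l by (simp add: field_simps)
  obtain M \<Psi> where *: "M \<ge> 1" "\<Psi> \<in> hom H (sym_group M)"
    "\<And>y. y \<in> carrier H \<Longrightarrow> 1 - hamming_length M (\<Psi> y) = (1 - hamming_length m (\<psi> y)) ^ q"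
    using tensor_family_hom[of "{..<q}" "\<lambda>_. m" "\<lambda>_. \<psi>" H] \<psi> m by (auto simp: prod_constant)
  show ?thesis
  proof
    have "(1 - l) ^ q \<le> exp (- l) ^ q"
      using l exp_ge_add_one_self[of "- l"] by (intro power_mono) auto
    also have "\<dots> = exp (- (real q * l))" by (simp add: exp_of_nat_mult[symmetric])
    also have "\<dots> \<le> exp (- 1)" using q1 l by (simp add: field_simps)
    also have "\<dots> \<le> 1 / 2"
      using exp_ge_add_one_self[of 1] by (simp add: exp_minus field_simps)
    finally show "hamming_length M (\<Psi> h) \<ge> 1 / 2"
      using *(3)[OF h(1)] unfolding l_def by linarith
  next
    fix x assume x: "x \<in> X"
    let ?t = "hamming_length m (\<psi> x)"
    have t: "?t \<le> l / k" using X(2)[OF x] k unfolding l_def by (simp add: field_simps)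
    have "1 + real q * (- ?t) \<le> (1 + (- ?t)) ^ q"
      by (rule Bernoulli_inequality) (simp add: hamming_length_le_1)
    then have "hamming_length M (\<Psi> x) \<le> real q * ?t"
      using *(3)[of x] x X(1) by auto
    also have "\<dots> \<le> (2 / l) * (l / k)"
      using q2 t l by (intro mult_mono) (auto simp: hamming_length_nonneg)
    also have "\<dots> = 2 / k" using l by simp
    finally show "hamming_length M (\<Psi> x) \<le> 2 / k" .
  qed (use * in auto)
qed

text \<open>The quotient of \<open>D\<close> by the normal closure of \<open>X\<close> acts on
  itself by translations: there \<open>X\<close> becomes trivial, while \<open>h\<close> moves every
  point.\<close>

lemma quotient_hom:
  assumes D: "group D" "finite (carrier D)" and X: "X \<subseteq> carrier D" "\<one>\<^bsub>D\<^esub> \<in> X"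
    and h: "h \<in> carrier D" "h \<notin> conj_products D X (order D)"
  obtains L \<psi> where "L \<ge> 1" "\<psi> \<in> hom D (sym_group L)" "hamming_length L (\<psi> h) = 1"
    "\<And>x. x \<in> X \<Longrightarrow> hamming_length L (\<psi> x) = 0"
proof -
  interpret conj_group D using D(1) by (rule conj_group.intro)
  define N where "N = conj_products D X (order D)"
  interpret N: normal N D unfolding N_def by (rule conj_products_normal[OF D(2) X(2)])
  have fin: "finite (carrier (D Mod N))"
    unfolding FactGroup_def RCOSETS_def using D(2) by simp
  obtain L \<psi> where \<psi>: "L \<ge> 1" "\<psi> \<in> hom (D Mod N) (sym_group L)"
    "\<And>y. y \<in> carrier (D Mod N) \<Longrightarrow> hamming_length L (\<psi> y) = (if y = \<one>\<^bsub>D Mod N\<^esub> then 0 else 1)"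
    using cayley_hom[OF N.factorgroup_is_group fin] by blast
  have proj: "(#>\<^bsub>D\<^esub>) N \<in> hom D (D Mod N)" by (rule N.r_coset_hom_Mod)
  have len: "hamming_length L (\<psi> (N #>\<^bsub>D\<^esub> y)) = (if y \<in> N then 0 else 1)" if "y \<in> carrier D" for y
  proof -
    have "N #>\<^bsub>D\<^esub> y \<in> carrier (D Mod N)" using proj that by (auto simp: hom_def)
    moreover have "N #>\<^bsub>D\<^esub> y = \<one>\<^bsub>D Mod N\<^esub> \<longleftrightarrow> y \<in> N"
      using N.is_subgroup that rcos_self[of y N] coset_join2[of y N] by (auto simp: one_FactGroup)
    ultimately show ?thesis using \<psi>(3) by auto
  qed
  have xN: "x \<in> N" if x: "x \<in> X" for x
    unfolding N_def using conj_products_base[OF x] x X(1)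
    by (intro conj_products_stable[OF D(2) X(2)]) auto
  show ?thesis
  proof (rule that[of L "\<psi> \<circ> (#>\<^bsub>D\<^esub>) N"])
    show "\<psi> \<circ> (#>\<^bsub>D\<^esub>) N \<in> hom D (sym_group L)" using proj \<psi>(2) by (auto simp: hom_def Pi_iff)
    show "hamming_length L ((\<psi> \<circ> (#>\<^bsub>D\<^esub>) N) h) = 1" using len[OF h(1)] h(2) by (simp add: N_def)
    show "hamming_length L ((\<psi> \<circ> (#>\<^bsub>D\<^esub>) N) x) = 0" if "x \<in> X" for x
      using len[of x] xN[OF that] that X(1) by auto
  qed (rule \<psi>(1))
qed

section \<open>Direct products of permutation groups\<close>

declare carrier_product_group [simp del] mult_product_group [simp del]
  one_product_group [simp del] inv_product_group [simp del]

locale group_family =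
  fixes I :: "'i set" and F :: "'i \<Rightarrow> 'h monoid"
  assumes F_group: "i \<in> I \<Longrightarrow> group (F i)"
begin

abbreviation P where "P \<equiv> product_group I F"

lemma P_conj_group: "conj_group P"
  by (intro conj_group.intro product_group F_group)

lemma P_mult: "i \<in> I \<Longrightarrow> (a \<otimes>\<^bsub>P\<^esub> b) i = a i \<otimes>\<^bsub>F i\<^esub> b i"
  by (simp add: mult_product_group)

lemma P_one: "i \<in> I \<Longrightarrow> \<one>\<^bsub>P\<^esub> i = \<one>\<^bsub>F i\<^esub>"
  by (simp add: one_product_group)

lemma P_inv: "a \<in> carrier P \<Longrightarrow> i \<in> I \<Longrightarrow> (inv\<^bsub>P\<^esub> a) i = inv\<^bsub>F i\<^esub> (a i)"
  by (simp add: inv_product_group carrier_product_group F_group)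

lemma P_mem: "a \<in> carrier P \<Longrightarrow> i \<in> I \<Longrightarrow> a i \<in> carrier (F i)"
  by (auto simp: carrier_product_group)

lemma P_restrict: "(\<And>i. i \<in> I \<Longrightarrow> a i \<in> carrier (F i)) \<Longrightarrow> restrict a I \<in> carrier P"
  by (simp add: carrier_product_group restrict_PiE_iff)

lemma P_eqI: "\<lbrakk>a \<in> carrier P; b \<in> carrier P; \<And>i. i \<in> I \<Longrightarrow> a i = b i\<rbrakk> \<Longrightarrow> a = b"
  unfolding carrier_product_group by (rule PiE_ext)

sublocale P: conj_group P by (rule P_conj_group)

lemmas P_simps = P_mult P_one P_inv P_mem

text \<open>All coordinates follow the pattern of a conjugate of \<open>x i\<close> and a conjugate
  of its inverse. The conjugators found coordinate by coordinate therefore assemble into two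
  elements of the product that conjugate \<open>x\<close> and its inverse; each commutator counts
  twice.\<close>

lemma lift_commutator_products:
  assumes x: "x \<in> carrier P" "x \<in> X" and y: "y \<in> carrier P"
    and "\<And>i. i \<in> I \<Longrightarrow> y i \<in> conj_products (F i) (commutators_with (F i) (x i)) n"
  shows "y \<in> conj_products P X (2 * n)"
  using y assms(4)
proof (induction n arbitrary: y)
  case 0
  then have "y = \<one>\<^bsub>P\<^esub>" by (intro P_eqI) (auto simp: P_one)
  then show ?case by simp
next
  case (Suc n)
  have "\<exists>a b c. a \<in> carrier (F i) \<and> b \<in> carrier (F i) \<and>
      c \<in> conj_products (F i) (commutators_with (F i) (x i)) n \<and>
      y i = (inv\<^bsub>F i\<^esub> a \<otimes>\<^bsub>F i\<^esub> x i \<otimes>\<^bsub>F i\<^esub> a) \<otimes>\<^bsub>F i\<^esub> (inv\<^bsub>F i\<^esub> b \<otimes>\<^bsub>F i\<^esub> inv\<^bsub>F i\<^esub> (x i) \<otimes>\<^bsub>F i\<^esub> b) \<otimes>\<^bsub>F i\<^esub> c"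
    if i: "i \<in> I" for i
  proof -
    interpret Fi: conj_group "F i" by (rule conj_group.intro[OF F_group[OF i]])
    obtain g w c where *: "y i = inv\<^bsub>F i\<^esub> g \<otimes>\<^bsub>F i\<^esub> w \<otimes>\<^bsub>F i\<^esub> g \<otimes>\<^bsub>F i\<^esub> c"
      "w \<in> carrier (F i)" "g \<in> carrier (F i)"
      "w \<in> commutators_with (F i) (x i) \<or> inv\<^bsub>F i\<^esub> w \<in> commutators_with (F i) (x i)"
      "c \<in> conj_products (F i) (commutators_with (F i) (x i)) n"
      using Suc.prems(2)[OF i] unfolding conj_products_Suc by blast
    show ?thesis
      using Fi.commutators_with_pattern[OF P_mem[OF x(1) i] *(2,4,3)] *(1,5) by metis
  qed
  then obtain a b c where abc: "\<And>i. i \<in> I \<Longrightarrow> a i \<in> carrier (F i)" "\<And>i. i \<in> I \<Longrightarrow> b i \<in> carrier (F i)"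
    "\<And>i. i \<in> I \<Longrightarrow> c i \<in> conj_products (F i) (commutators_with (F i) (x i)) n"
    "\<And>i. i \<in> I \<Longrightarrow> y i = (inv\<^bsub>F i\<^esub> (a i) \<otimes>\<^bsub>F i\<^esub> x i \<otimes>\<^bsub>F i\<^esub> a i) \<otimes>\<^bsub>F i\<^esub>
        (inv\<^bsub>F i\<^esub> (b i) \<otimes>\<^bsub>F i\<^esub> inv\<^bsub>F i\<^esub> (x i) \<otimes>\<^bsub>F i\<^esub> b i) \<otimes>\<^bsub>F i\<^esub> c i"
    by metis
  have c_mem: "c i \<in> carrier (F i)" if "i \<in> I" for i
    using conj_group.conj_products_closed[OF conj_group.intro[OF F_group[OF that]]] abc(3) that by blast
  define A B C where "A = restrict a I" and "B = restrict b I" and "C = restrict c I"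
  have ABC: "A \<in> carrier P" "B \<in> carrier P" "C \<in> carrier P"
    unfolding A_def B_def C_def using abc c_mem by (auto intro!: P_restrict)
  have ABC': "A i = a i" "B i = b i" "C i = c i" if "i \<in> I" for i
    using that by (auto simp: A_def B_def C_def)
  have "y = (inv\<^bsub>P\<^esub> A \<otimes>\<^bsub>P\<^esub> x \<otimes>\<^bsub>P\<^esub> A) \<otimes>\<^bsub>P\<^esub> (inv\<^bsub>P\<^esub> B \<otimes>\<^bsub>P\<^esub> inv\<^bsub>P\<^esub> x \<otimes>\<^bsub>P\<^esub> B) \<otimes>\<^bsub>P\<^esub> C"
    using ABC x Suc.prems(1) by (intro P_eqI) (auto simp: P_simps abc(4) ABC')
  also have "\<dots> \<in> conj_products P X (1 + 1 + 2 * n)"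
  proof (intro P.conj_products_mult P.conj_products_generator)
    show "C \<in> conj_products P X (2 * n)"
      using ABC abc(3) ABC' by (intro Suc.IH) auto
  qed (use ABC x in auto)
  finally show ?case by simp
qed

end

text \<open>
  The quotients of permutation groups that are not reached from a single nontrivial element: the
  whole group in degree at most four, and the sign, embedded by \<open>-1 \<mapsto> (1 2)\<close>, in degree at
  least five.
\<close>

definition small_quotient :: "nat \<Rightarrow> (nat \<Rightarrow> nat) \<Rightarrow> nat \<Rightarrow> nat" where
  "small_quotient m f = (if m \<le> 4 then f else if evenperm f then id else transpose 1 2)"

text \<open>A common target of fixed size leaves only finitely many possible images, whatever the
  degrees. Groups of degree at most 4 are kept whole, their elements fixing the additional
  points.\<close>

lemma small_quotient_hom:
  assumes "is_perm_group m F"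
  shows "small_quotient m \<in> hom F (sym_group 4)"
proof (rule homI)
  fix f assume "f \<in> carrier F"
  then have f: "f permutes {1..m}" using perm_group_simps(5)[OF assms] by blast
  show "small_quotient m f \<in> carrier (sym_group 4)"
    using f by (auto simp: small_quotient_def sym_group_carrier simp del: One_nat_def
        intro: permutes_subset permutes_swap_id)
next
  fix f g assume "f \<in> carrier F" "g \<in> carrier F"
  then have "permutation f" "permutation g"
    using perm_group_simps(5)[OF assms] permutes_imp_permutation finite_atLeastAtMost by blast+
  then show "small_quotient m (f \<otimes>\<^bsub>F\<^esub> g) = small_quotient m f \<otimes>\<^bsub>sym_group 4\<^esub> small_quotient m g"
    by (simp add: small_quotient_def perm_group_simps(2)[OF assms] sym_group_mult evenperm_comp)
qed

lemma small_quotient_eq_id: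
  assumes "small_quotient m f = id"
  shows "m \<le> 4 \<Longrightarrow> f = id" "\<not> m \<le> 4 \<Longrightarrow> evenperm f"
  using assms transpose_eq_id_iff[of 1 "2::nat"] by (auto simp: small_quotient_def split: if_splits)

lemma card_moved_comp:
  assumes "finite (moved p)" "finite (moved q)"
  shows "card (moved (p \<circ> q)) \<le> card (moved p) + card (moved q)"
proof -
  have "card (moved (p \<circ> q)) \<le> card (moved p \<union> moved q)"
    using assms moved_comp by (intro card_mono) auto
  also have "\<dots> \<le> card (moved p) + card (moved q)" by (rule card_Un_le)
  finally show ?thesis .
qed

lemma inv_eq_iff_bij: "bij p \<Longrightarrow> inv' p y = x \<longleftrightarrow> p x = y"
  using bij_inv_eq_iff[of p x y] by auto

lemma moved_inv: "bij p \<Longrightarrow> moved (inv' p) = moved p"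
  by (auto simp: inv_eq_iff_bij)

lemma card_moved_conj:
  assumes "bij g"
  shows "card (moved (inv' g \<circ> p \<circ> g)) = card (moved p)"
proof -
  have eq: "moved (inv' g \<circ> p \<circ> g) = g -` moved p"
    using assms by (auto simp: inv_eq_iff_bij)
  show ?thesis
    unfolding eq using assms by (intro card_vimage_inj) (auto simp: bij_is_inj bij_is_surj)
qed

section \<open>Coordinates of a product of permutation groups\<close>

locale perm_family =
  fixes I :: "'i set" and F :: "'i \<Rightarrow> (nat \<Rightarrow> nat) monoid" and deg :: "'i \<Rightarrow> nat"
  assumes F_perm: "i \<in> I \<Longrightarrow> is_perm_group (deg i) (F i)"
begin

sublocale group_family I F
  by (rule group_family.intro) (rule perm_group_simps(1)[OF F_perm])

lemma coordinate_permutes: "a \<in> carrier P \<Longrightarrow> i \<in> I \<Longrightarrow> a i permutes {1..deg i}"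
  using perm_group_simps(5)[OF F_perm] P_mem by blast

lemma coordinate_finite: "a \<in> carrier P \<Longrightarrow> i \<in> I \<Longrightarrow> finite (moved (a i))"
  using permutes_moved[OF coordinate_permutes] by (meson finite_atLeastAtMost finite_subset)

lemma coordinate_bij: "a \<in> carrier P \<Longrightarrow> i \<in> I \<Longrightarrow> bij (a i)"
  using coordinate_permutes permutes_bij by blast

lemma coordinate_mult: "i \<in> I \<Longrightarrow> (a \<otimes>\<^bsub>P\<^esub> b) i = a i \<circ> b i"
  using perm_group_simps(2)[OF F_perm] by (simp add: P_mult)

lemma coordinate_inv: "a \<in> carrier P \<Longrightarrow> i \<in> I \<Longrightarrow> (inv\<^bsub>P\<^esub> a) i = inv' (a i)"
  using perm_group_simps(7)[OF F_perm] by (simp add: P_inv P_mem)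

lemma coordinate_hom: "i \<in> I \<Longrightarrow> (\<lambda>a. a i) \<in> hom P (sym_group (deg i))"
  using coordinate_permutes by (auto simp: hom_def sym_group_carrier sym_group_mult coordinate_mult)

text \<open>The number of points moved in coordinate \<open>i\<close> is a length on the product
  that is invariant under conjugation and inversion.\<close>

lemma card_moved_conj_products:
  assumes i: "i \<in> I" and X: "X \<subseteq> carrier P" "\<And>x. x \<in> X \<Longrightarrow> card (moved (x i)) \<le> B"
    and y: "y \<in> conj_products P X n"
  shows "card (moved (y i)) \<le> n * B"
proof -
  have "real (card (moved (y i))) \<le> real n * real B"
  proof (rule P.conj_products_length[OF _ _ _ _ _ y, where l = "\<lambda>a. real (card (moved (a i)))"])
    show "real (card (moved (\<one>\<^bsub>P\<^esub> i))) = 0"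
      using i perm_group_simps(3)[OF F_perm[OF i]] by (simp add: P_one)
    show "real (card (moved ((a \<otimes>\<^bsub>P\<^esub> b) i))) \<le> real (card (moved (a i))) + real (card (moved (b i)))"
      if "a \<in> carrier P" "b \<in> carrier P" for a b
      unfolding coordinate_mult[OF i] of_nat_add[symmetric] of_nat_le_iff
      by (intro card_moved_comp coordinate_finite that i)
    show "real (card (moved ((inv\<^bsub>P\<^esub> a) i))) = real (card (moved (a i)))" if "a \<in> carrier P" for a
      by (simp only: coordinate_inv[OF that i] moved_inv[OF coordinate_bij[OF that i]])
    show "real (card (moved ((inv\<^bsub>P\<^esub> g \<otimes>\<^bsub>P\<^esub> a \<otimes>\<^bsub>P\<^esub> g) i))) = real (card (moved (a i)))"
      if "a \<in> carrier P" "g \<in> carrier P" for a g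
      by (simp only: coordinate_mult[OF i] coordinate_inv[OF that(2) i] card_moved_conj[OF coordinate_bij[OF that(2) i]])
    show "real (card (moved (x i))) \<le> real B" if "x \<in> X" for x
      using X(2)[OF that] by simp
  qed
  then show ?thesis by (simp flip: of_nat_mult)
qed

text \<open>Each coordinate is assigned some \<open>x\<close> in \<open>X\<close> with sufficiently
  large support there. The part of \<open>z\<close> on the coordinates assigned to one
  \<open>x\<close> is reached by commutators with that \<open>x\<close>: a trivial small quotient
  means that \<open>z i\<close> is even in degree at least 5 and trivial below. The parts live on
  disjoint sets of coordinates and multiply to \<open>z\<close>, whence the factor
  \<open>card X\<close>.\<close>

lemma small_kernel_in_conj_products:
  assumes X: "finite X" "X \<subseteq> carrier P" "\<one>\<^bsub>P\<^esub> \<in> X" and z: "z \<in> carrier P"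
    and ker: "\<And>i. i \<in> I \<Longrightarrow> small_quotient (deg i) (z i) = id"
    and bound: "\<And>i. i \<in> I \<Longrightarrow> \<exists>x\<in>X. card (moved (z i)) \<le> k * card (moved (x i))"
  shows "z \<in> conj_products P X (2 * (30 * k + 8) * card X)"
proof -
  have "\<forall>i\<in>I. \<exists>x. x \<in> X \<and> card (moved (z i)) \<le> k * card (moved (x i))"
    using bound by blast
  from bchoice[OF this] obtain w where w: "\<And>i. i \<in> I \<Longrightarrow> w i \<in> X"
    "\<And>i. i \<in> I \<Longrightarrow> card (moved (z i)) \<le> k * card (moved (w i i))"
    by blast
  define part where "part Y = (\<lambda>i\<in>I. if w i \<in> Y then z i else id)" for Y
  have id_mem: "id \<in> carrier (F i)" if "i \<in> I" for i
    using group.is_monoid[OF F_group[OF that]] monoid.one_closed perm_group_simps(3)[OF F_perm[OF that]]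
    by metis
  have part_mem: "part Y \<in> carrier P" for Y
    unfolding part_def using z id_mem by (intro P_restrict) (auto simp: P_mem)
  have single: "part {x} \<in> conj_products P X (2 * (30 * k + 8))" if x: "x \<in> X" for x
  proof (rule lift_commutator_products[OF _ x part_mem])
    show xP: "x \<in> carrier P" using x X(2) by blast
    fix i assume i: "i \<in> I"
    interpret Fi: conj_group "F i" by (rule conj_group.intro[OF F_group[OF i]])
    have triv: "id \<in> conj_products (F i) (commutators_with (F i) (x i)) n" for n
      using Fi.conj_products_one[OF Fi.one_in_commutators_with[OF P_mem[OF xP i]]]
        perm_group_simps(3)[OF F_perm[OF i]] by metis
    show "part {x} i \<in> conj_products (F i) (commutators_with (F i) (x i)) (30 * k + 8)"
    proof (cases "w i = x \<and> \<not> deg i \<le> 4")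
      case True
      then have "z i \<in> conj_products (F i) (commutators_with (F i) (x i)) (30 * k + 8)"
        using small_quotient_eq_id(2)[OF ker[OF i]] w(2)[OF i] i z xP
        by (intro evenperm_in_commutator_products[OF F_perm[OF i]] coordinate_permutes P_mem) auto
      then show ?thesis using True i by (simp add: part_def)
    next
      case False
      then have "part {x} i = id" using small_quotient_eq_id(1)[OF ker[OF i]] i by (auto simp: part_def)
      then show ?thesis using triv by simp
    qed
  qed
  have "part Y \<in> conj_products P X (2 * (30 * k + 8) * card Y)" if "finite Y" "Y \<subseteq> X" for Y
    using that
  proof (induction Y rule: finite_induct)
    case empty
    have "part {} = \<one>\<^bsub>P\<^esub>"
      using perm_group_simps(3)[OF F_perm]
      by (intro P_eqI[OF part_mem]) (auto simp: part_def P_one)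
    then show ?case by simp
  next
    case (insert x Y)
    have "part (insert x Y) = part {x} \<otimes>\<^bsub>P\<^esub> part Y"
      using insert.hyps
      by (intro P_eqI[OF part_mem P.m_closed[OF part_mem part_mem]]) (auto simp: coordinate_mult part_def)
    also have "\<dots> \<in> conj_products P X (2 * (30 * k + 8) + 2 * (30 * k + 8) * card Y)"
      using insert by (intro P.conj_products_mult single) auto
    finally show ?case using insert.hyps by (simp add: algebra_simps)
  qed
  from this[OF X(1) subset_refl] have "part X \<in> conj_products P X (2 * (30 * k + 8) * card X)" .
  moreover have "part X = z"
    using part_mem z w(1) by (intro P_eqI) (auto simp: part_def)
  ultimately show ?thesis by simp
qed

end

section \<open>Small quotients and the separation of one element\<close>

context perm_family
begin

definition quotients :: "'i \<Rightarrow> (nat \<Rightarrow> nat) set" where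
  "quotients i = small_quotient (deg i) ` carrier (F i)"

lemma subgroup_quotients: "i \<in> I \<Longrightarrow> subgroup (quotients i) (sym_group 4)"
  unfolding quotients_def
  using small_quotient_hom[OF F_perm] F_group sym_group_is_group
  by (intro group_hom.img_is_subgroup) (simp add: group_hom_def group_hom_axioms_def)

lemma small_quotient_mult:
  assumes "a \<in> carrier P" "b \<in> carrier P" "i \<in> I"
  shows "small_quotient (deg i) ((a \<otimes>\<^bsub>P\<^esub> b) i) = small_quotient (deg i) (a i) \<circ> small_quotient (deg i) (b i)"
  using assms hom_mult[OF small_quotient_hom[OF F_perm[OF assms(3)]]]
  by (simp add: P_simps sym_group_mult)

lemma small_quotient_inv:
  assumes "a \<in> carrier P" "i \<in> I"
  shows "small_quotient (deg i) ((inv\<^bsub>P\<^esub> a) i) = inv' (small_quotient (deg i) (a i))"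
proof -
  interpret group_hom "F i" "sym_group 4" "small_quotient (deg i)"
    using small_quotient_hom[OF F_perm[OF assms(2)]] F_group[OF assms(2)] sym_group_is_group
    by (simp add: group_hom_def group_hom_axioms_def)
  show ?thesis using assms by (simp add: P_simps)
qed

text \<open>
  The product of the small quotients has unboundedly many factors, but coordinates of equal type
  cannot be told apart by uniform elements, so only one factor per type matters.
\<close>

lemma small_quotient_reduction:
  fixes ty :: "'i \<Rightarrow> 't" and q :: "'t \<Rightarrow> (nat \<Rightarrow> nat) set" and X :: "('i \<Rightarrow> nat \<Rightarrow> nat) set"
  defines "D \<equiv> product_group (ty ` I) (\<lambda>t. (sym_group 4)\<lparr>carrier := q t\<rparr>)"
  defines "uniform a \<equiv> \<forall>i\<in>I. \<forall>j\<in>I. ty i = ty j \<longrightarrow>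
      small_quotient (deg i) (a i) = small_quotient (deg j) (a j)"
  assumes q: "\<And>i. i \<in> I \<Longrightarrow> q (ty i) = quotients i" and fin: "finite (ty ` I)"
    and X: "X \<subseteq> carrier P" "\<one>\<^bsub>P\<^esub> \<in> X" "\<And>x. x \<in> X \<Longrightarrow> uniform x"
    and h: "h \<in> carrier P" "uniform h" and M: "order D \<le> M"
  shows "(\<exists>L\<ge>1. \<exists>\<psi>\<in>hom P (sym_group L). hamming_length L (\<psi> h) = 1 \<and>
            (\<forall>x\<in>X. hamming_length L (\<psi> x) = 0)) \<or>
         (\<exists>y\<in>conj_products P X M. \<forall>i\<in>I. small_quotient (deg i) (y i) = small_quotient (deg i) (h i))"
proof -
  let ?Q = "\<lambda>t. (sym_group 4)\<lparr>carrier := q t\<rparr>"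
  have Q_group: "group (?Q t)" if "t \<in> ty ` I" for t
    using that q subgroup_quotients group.subgroup_imp_group[OF sym_group_is_group] by auto
  interpret D: group_family "ty ` I" ?Q
    by (rule group_family.intro) (rule Q_group)
  note D_fold = D_def[symmetric]
  have Dg: "group D" unfolding D_def by (rule D.P.is_group)
  have Q_fin: "finite (q t)" if "t \<in> ty ` I" for t
    using that q by (auto simp: quotients_def perm_group_simps(4)[OF F_perm])
  have D_fin: "finite (carrier D)"
    unfolding D_def carrier_product_group using fin Q_fin by (intro finite_PiE) auto
  \<comment> \<open>One coordinate represents all those of its type; the map \<open>\<theta>\<close>
    built from these loses no small quotient of a uniform element.\<close>
  define r where "r t = (SOME i. i \<in> I \<and> ty i = t)" for t
  have r: "r t \<in> I" "ty (r t) = t" if t: "t \<in> ty ` I" for t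
  proof -
    have "\<exists>i. i \<in> I \<and> ty i = t" using t by blast
    from someI_ex[OF this] show "r t \<in> I" "ty (r t) = t" unfolding r_def by auto
  qed
  define \<theta> where "\<theta> a = (\<lambda>t\<in>ty ` I. small_quotient (deg (r t)) (a (r t)))" for a
  have \<theta>_mem: "\<theta> a \<in> carrier D" if "a \<in> carrier P" for a
    unfolding \<theta>_def D_def
  proof (rule D.P_restrict)
    fix t assume t: "t \<in> ty ` I"
    have "q t = quotients (r t)" using q[OF r(1)[OF t]] r(2)[OF t] by simp
    then show "small_quotient (deg (r t)) (a (r t)) \<in> carrier (?Q t)"
      using P_mem[OF that r(1)[OF t]] by (simp add: quotients_def)
  qed
  have \<theta>_hom: "\<theta> \<in> hom P D"
  proof (rule homI)
    fix a b assume ab: "a \<in> carrier P" "b \<in> carrier P"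
    show "\<theta> (a \<otimes>\<^bsub>P\<^esub> b) = \<theta> a \<otimes>\<^bsub>D\<^esub> \<theta> b"
      unfolding D_def mult_product_group[of "ty ` I" ?Q] \<theta>_def
      by (rule restrict_ext) (simp add: small_quotient_mult[OF ab r(1)] sym_group_mult)
  qed (rule \<theta>_mem)
  have \<theta>_uniform: "\<theta> a (ty i) = small_quotient (deg i) (a i)" if "uniform a" "i \<in> I" for a i
  proof -
    have t: "ty i \<in> ty ` I" using that(2) by blast
    have "small_quotient (deg (r (ty i))) (a (r (ty i))) = small_quotient (deg i) (a i)"
      using that r[OF t] unfolding uniform_def by blast
    then show ?thesis using t by (simp add: \<theta>_def)
  qed
  interpret \<theta>: group_hom P D \<theta>
    using \<theta>_hom Dg by (simp add: group_hom_def group_hom_axioms_def P.is_group)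
  have inv_uniform: "uniform a" if "a \<in> carrier P" "uniform (inv\<^bsub>P\<^esub> a)" for a
  proof -
    have "small_quotient (deg i) (a i) = inv' (small_quotient (deg i) ((inv\<^bsub>P\<^esub> a) i))" if "i \<in> I" for i
      using small_quotient_inv[of "inv\<^bsub>P\<^esub> a" i] that \<open>a \<in> carrier P\<close> by simp
    then show ?thesis using that(2) unfolding uniform_def by metis
  qed
  \<comment> \<open>By definition \<open>q (ty i)\<close> is the full image of \<open>F i\<close>,
    so a conjugator in \<open>D\<close> lifts in each coordinate separately.\<close>
  have lift: "\<exists>g'\<in>carrier P. \<forall>i\<in>I. small_quotient (deg i) (g' i) = g (ty i)" if g: "g \<in> carrier D" for g
  proof -
    have "\<exists>f\<in>carrier (F i). small_quotient (deg i) f = g (ty i)" if i: "i \<in> I" for i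
    proof -
      have "g (ty i) \<in> quotients i"
        using D.P_mem[of g "ty i"] g i q by (simp add: D_def)
      then show ?thesis by (auto simp: quotients_def)
    qed
    then obtain f where f: "\<And>i. i \<in> I \<Longrightarrow> f i \<in> carrier (F i)"
      "\<And>i. i \<in> I \<Longrightarrow> small_quotient (deg i) (f i) = g (ty i)" by metis
    then show ?thesis by (intro bexI[of _ "restrict f I"] P_restrict) auto
  qed
  have D_inv: "(inv\<^bsub>D\<^esub> d) t = inv' (d t)" if d: "d \<in> carrier D" and t: "t \<in> ty ` I" for d t
  proof -
    have sg: "subgroup (q t) (sym_group 4)" using t q subgroup_quotients by auto
    have dt: "d t \<in> q t" using D.P_mem[of d t] d t by (simp add: D_def)
    have "(inv\<^bsub>D\<^esub> d) t = inv\<^bsub>?Q t\<^esub> (d t)" using D.P_inv[of d t] d t by (simp add: D_def)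
    also have "\<dots> = inv\<^bsub>sym_group 4\<^esub> (d t)"
      by (rule group.m_inv_consistent[OF sym_group_is_group sg dt])
    also have "\<dots> = inv' (d t)"
      using subgroup.mem_carrier[OF sg dt] by simp
    finally show ?thesis .
  qed
  have D_mult: "(d \<otimes>\<^bsub>D\<^esub> e) t = d t \<circ> e t" if "t \<in> ty ` I" for d e t
    using D.P_mult[OF that] by (simp add: D_def sym_group_mult)
  \<comment> \<open>A product of conjugates in \<open>D\<close> lifts factor by factor, so its
    length does not change when passing from one coordinate per type to all coordinates.\<close>
  have lift_products: "\<exists>y\<in>conj_products P X n. \<forall>i\<in>I. small_quotient (deg i) (y i) = d (ty i)"
    if "d \<in> conj_products D (\<theta> ` X) n" for d n
    using that
  proof (induction n arbitrary: d)
    case 0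
    have "small_quotient (deg i) (\<one>\<^bsub>P\<^esub> i) = d (ty i)" if "i \<in> I" for i
      using \<theta>_uniform[OF X(3)[OF X(2)] that] 0 by (simp only: \<theta>.hom_one conj_products_0 singleton_iff)
    then show ?case by (intro bexI[of _ "\<one>\<^bsub>P\<^esub>"]) auto
  next
    case (Suc n)
    then obtain g u c where *: "d = inv\<^bsub>D\<^esub> g \<otimes>\<^bsub>D\<^esub> u \<otimes>\<^bsub>D\<^esub> g \<otimes>\<^bsub>D\<^esub> c" "u \<in> carrier D" "g \<in> carrier D"
      "u \<in> \<theta> ` X \<or> inv\<^bsub>D\<^esub> u \<in> \<theta> ` X" "c \<in> conj_products D (\<theta> ` X) n"
      unfolding conj_products_Suc by blast
    obtain x where x: "x \<in> carrier P" "x \<in> X \<or> inv\<^bsub>P\<^esub> x \<in> X" "\<theta> x = u"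
    proof (cases "u \<in> \<theta> ` X")
      case True
      then show ?thesis using that X(1) by blast
    next
      case False
      then obtain x where "x \<in> X" "\<theta> x = inv\<^bsub>D\<^esub> u" using *(4) by force
      then show ?thesis
        using that[of "inv\<^bsub>P\<^esub> x"] X(1) *(2) by auto
    qed
    have ux: "uniform x" using x X(3) inv_uniform by blast
    obtain g' where g': "g' \<in> carrier P" "\<And>i. i \<in> I \<Longrightarrow> small_quotient (deg i) (g' i) = g (ty i)"
      using lift[OF *(3)] by blast
    obtain y where y: "y \<in> conj_products P X n" "\<And>i. i \<in> I \<Longrightarrow> small_quotient (deg i) (y i) = c (ty i)"
      using Suc.IH[OF *(5)] by blast
    have yP: "y \<in> carrier P" by (rule P.conj_products_closed[OF y(1)])
    show ?case
    proof (intro bexI ballI)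
      show "inv\<^bsub>P\<^esub> g' \<otimes>\<^bsub>P\<^esub> x \<otimes>\<^bsub>P\<^esub> g' \<otimes>\<^bsub>P\<^esub> y \<in> conj_products P X (Suc n)"
        by (intro P.conj_products_SucI x g' y)
      fix i assume i: "i \<in> I"
      have "small_quotient (deg i) (x i) = u (ty i)" using \<theta>_uniform[OF ux i] x(3) by simp
      then show "small_quotient (deg i) ((inv\<^bsub>P\<^esub> g' \<otimes>\<^bsub>P\<^esub> x \<otimes>\<^bsub>P\<^esub> g' \<otimes>\<^bsub>P\<^esub> y) i) = d (ty i)"
        unfolding *(1) using g' x(1) y(2) yP i *(3)
        by (simp add: small_quotient_mult small_quotient_inv D_mult D_inv)
    qed
  qed
  have \<theta>X: "\<theta> ` X \<subseteq> carrier D" "\<one>\<^bsub>D\<^esub> \<in> \<theta> ` X"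
    using X \<theta>_mem \<theta>.hom_one by (auto intro: rev_image_eqI)
  show ?thesis
  \<comment> \<open>Length \<open>order D\<close> already exhausts the normal closure of the image
    of \<open>X\<close>. Membership of \<open>\<theta> h\<close> gives \<open>y\<close> after
    padding to length \<open>M\<close>; otherwise the quotient separates \<open>h\<close>.\<close>
  proof (cases "\<theta> h \<in> conj_products D (\<theta> ` X) (order D)")
    case True
    then have "\<theta> h \<in> conj_products D (\<theta> ` X) M"
      using conj_group.conj_products_mono[OF conj_group.intro[OF Dg] \<theta>X(2) M] by blast
    from lift_products[OF this] show ?thesis using \<theta>_uniform[OF h(2)] by auto
  next
    case False
    obtain L \<psi> where \<psi>: "L \<ge> 1" "\<psi> \<in> hom D (sym_group L)" "hamming_length L (\<psi> (\<theta> h)) = 1"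
      "\<And>x. x \<in> \<theta> ` X \<Longrightarrow> hamming_length L (\<psi> x) = 0"
      using quotient_hom[OF Dg D_fin \<theta>X \<theta>_mem[OF h(1)] False] by blast
    have "\<psi> \<circ> \<theta> \<in> hom P (sym_group L)" using \<psi>(2) \<theta>_hom by (auto simp: hom_def Pi_iff)
    then show ?thesis using \<psi> by (intro disjI1 exI[of _ L] conjI bexI[of _ "\<psi> \<circ> \<theta>"]) auto
  qed
qed

text \<open>The length in \<open>sep\<close> is \<open>M\<close> for an element \<open>y\<close>
  matching the small quotients of \<open>h\<close>, plus the cost of the correction. The correction
  has ratio \<open>M + k\<close>: in each coordinate \<open>y\<close> moves at most \<open>M\<close>
  times, and \<open>h\<close> at most \<open>k\<close> times, as many points as the element of
  \<open>X\<close> with the largest support there.\<close>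

lemma separating_hom:
  assumes q: "\<And>i. i \<in> I \<Longrightarrow> q (ty i) = quotients i" and fin: "finite (ty ` I)"
    and X: "finite X" "X \<subseteq> carrier P" "\<one>\<^bsub>P\<^esub> \<in> X"
    and h: "h \<in> carrier P"
    and uniform: "\<And>a i j. \<lbrakk>a \<in> insert h X; i \<in> I; j \<in> I; ty i = ty j\<rbrakk> \<Longrightarrow>
        small_quotient (deg i) (a i) = small_quotient (deg j) (a j)"
    and M: "order (product_group (ty ` I) (\<lambda>t. (sym_group 4)\<lparr>carrier := q t\<rparr>)) \<le> M"
    and k: "k \<ge> (2::nat)" and c: "card X \<le> c"
    and sep: "h \<notin> conj_products P X (M + 2 * (30 * (M + k) + 8) * c)"
  shows "\<exists>L\<ge>1. \<exists>\<psi>\<in>hom P (sym_group L). hamming_length L (\<psi> h) \<ge> 1 / 2 \<and>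
            (\<forall>x\<in>X. hamming_length L (\<psi> x) \<le> 2 / real k)"
proof -
  consider (quotient) L \<psi> where "L \<ge> 1" "\<psi> \<in> hom P (sym_group L)" "hamming_length L (\<psi> h) = 1"
      "\<forall>x\<in>X. hamming_length L (\<psi> x) = 0"
    | (support) i where "i \<in> I" "\<And>x. x \<in> X \<Longrightarrow> k * card (moved (x i)) < card (moved (h i))"
    | (close) y where "y \<in> conj_products P X M"
      "\<And>i. i \<in> I \<Longrightarrow> small_quotient (deg i) (y i) = small_quotient (deg i) (h i)"
      "\<And>i. i \<in> I \<Longrightarrow> \<exists>x\<in>X. card (moved (h i)) \<le> k * card (moved (x i))"
  proof -
    have "(\<exists>L\<ge>1. \<exists>\<psi>\<in>hom P (sym_group L). hamming_length L (\<psi> h) = 1 \<and>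
            (\<forall>x\<in>X. hamming_length L (\<psi> x) = 0)) \<or>
         (\<exists>y\<in>conj_products P X M. \<forall>i\<in>I. small_quotient (deg i) (y i) = small_quotient (deg i) (h i))"
      by (rule small_quotient_reduction[OF q fin X(2,3) _ h _ M]) (use uniform in blast)+
    then show ?thesis
    proof (elim disjE bexE)
      assume "\<exists>L\<ge>1. \<exists>\<psi>\<in>hom P (sym_group L). hamming_length L (\<psi> h) = 1 \<and>
            (\<forall>x\<in>X. hamming_length L (\<psi> x) = 0)"
      then show ?thesis using quotient by blast
    next
      fix y assume y: "y \<in> conj_products P X M"
        "\<forall>i\<in>I. small_quotient (deg i) (y i) = small_quotient (deg i) (h i)"
      show ?thesis
      proof (cases "\<exists>i\<in>I. \<forall>x\<in>X. k * card (moved (x i)) < card (moved (h i))")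
        case True
        then show ?thesis using support by blast
      next
        case False
        then have "\<exists>x\<in>X. card (moved (h i)) \<le> k * card (moved (x i))" if "i \<in> I" for i
          using that by (auto simp: not_less)
        then show ?thesis using close[OF y(1)] y(2) by blast
      qed
    qed
  qed
  then show ?thesis
  proof cases
    case quotient
    then show ?thesis by (intro exI[of _ L] conjI bexI[of _ \<psi>]) auto
  next
    case support
    have perm: "moved (a i) \<subseteq> {1..deg i}" if "a \<in> carrier P" for a
      using permutes_moved[OF coordinate_permutes[OF that support(1)]] .
    have len: "hamming_length (deg i) (a i) = real (card (moved (a i))) / real (deg i)" if "a \<in> carrier P" for a
    proof -
      have "{x \<in> {1..deg i}. a i x \<noteq> x} = moved (a i)" using perm[OF that] by auto
      then show ?thesis by (simp add: hamming_length_def)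
    qed
    have pos: "card (moved (h i)) > 0" using support(2)[OF X(3)] by simp
    have "moved (h i) \<noteq> {}" using pos by (metis card.empty less_irrefl)
    then have deg: "deg i \<ge> 1" using perm[OF h] by auto
    have bound: "real k * hamming_length (deg i) (x i) \<le> hamming_length (deg i) (h i)" if x: "x \<in> X" for x
    proof -
      have "real k * real (card (moved (x i))) \<le> real (card (moved (h i)))"
        using support(2)[OF x] by (simp flip: of_nat_mult)
      then show ?thesis using len[OF h] len[of x] x X(2) deg
        by (auto simp: divide_right_mono)
    qed
    have hp: "hamming_length (deg i) (h i) > 0" using len[OF h] pos deg by simp
    have kp: "real k > 0" using k by simp
    obtain L \<psi> where "L \<ge> 1" "\<psi> \<in> hom P (sym_group L)" "hamming_length L (\<psi> h) \<ge> 1 / 2"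
      "\<And>x. x \<in> X \<Longrightarrow> hamming_length L (\<psi> x) \<le> 2 / real k"
      using amplify_hom[where \<psi> = "\<lambda>a. a i" and H = P and m = "deg i" and k = "real k" and h = h and X = X, OF coordinate_hom[OF support(1)] deg kp h hp X(2)] bound by blast
    then show ?thesis by (intro exI[of _ L] conjI bexI[of _ \<psi>]) auto
  next
    case close
    have y: "y \<in> carrier P" by (rule P.conj_products_closed[OF close(1)])
    \<comment> \<open>The correction: \<open>h\<close> is \<open>y\<close> times \<open>z\<close>,
      and all small quotients of \<open>z\<close> are trivial.\<close>
    define z where "z = inv\<^bsub>P\<^esub> y \<otimes>\<^bsub>P\<^esub> h"
    have z: "z \<in> carrier P" using y h by (simp add: z_def)
    have zi: "z i = inv' (y i) \<circ> h i" if "i \<in> I" for i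
      using y that by (simp add: z_def coordinate_mult coordinate_inv)
    have "z \<in> conj_products P X (2 * (30 * (M + k) + 8) * card X)"
    proof (rule small_kernel_in_conj_products[OF X z])
      fix i assume i: "i \<in> I"
      interpret qi: group_hom "F i" "sym_group 4" "small_quotient (deg i)"
        using small_quotient_hom[OF F_perm[OF i]] F_group[OF i] sym_group_is_group
        by (simp add: group_hom_def group_hom_axioms_def)
      have "small_quotient (deg i) (h i) permutes {1..4}"
        using qi.hom_closed[OF P_mem[OF h i]] by (simp only: sym_group_carrier)
      then show "small_quotient (deg i) (z i) = id"
        using y h i close(2)[OF i] by (simp add: z_def small_quotient_mult small_quotient_inv permutes_inv_o)
      \<comment> \<open>One \<open>x\<close> of largest support in coordinate \<open>i\<close>
        bounds both \<open>y\<close> and \<open>h\<close>.\<close>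
      obtain x where x: "x \<in> X" "\<And>x'. x' \<in> X \<Longrightarrow> card (moved (x' i)) \<le> card (moved (x i))"
      proof -
        let ?f = "\<lambda>x. card (moved (x i))"
        have "Max (?f ` X) \<in> ?f ` X" using X by (intro Max_in) auto
        then obtain x where "x \<in> X" "?f x = Max (?f ` X)" by auto
        then show ?thesis using that[of x] X(1) by simp
      qed
      have "card (moved (y i)) \<le> M * card (moved (x i))"
        using card_moved_conj_products[OF i X(2) _ close(1), where B = "card (moved (x i))"] x(2) by blast
      moreover have "card (moved (h i)) \<le> k * card (moved (x i))"
        using close(3)[OF i] x(2) by (meson le_trans mult_le_mono2)
      moreover have "card (moved (z i)) \<le> card (moved (y i)) + card (moved (h i))"
        using card_moved_comp[of "inv' (y i)" "h i"] coordinate_finite[OF y i] coordinate_finite[OF h i]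
        unfolding zi[OF i] by (simp only: moved_inv[OF coordinate_bij[OF y i]])
      ultimately have "card (moved (z i)) \<le> (M + k) * card (moved (x i))"
        by (simp add: algebra_simps)
      then show "\<exists>x\<in>X. card (moved (z i)) \<le> (M + k) * card (moved (x i))" using x(1) by blast
    qed
    from P.conj_products_mult[OF close(1) this]
    have "h \<in> conj_products P X (M + 2 * (30 * (M + k) + 8) * card X)"
      using y h by (simp add: z_def P.inv_cancel)
    then have "h \<in> conj_products P X (M + 2 * (30 * (M + k) + 8) * c)"
      by (rule P.conj_products_mono[OF X(3), rotated]) (intro add_left_mono mult_le_mono2 c)
    then show ?thesis using sep by simp
  qed
qed

end

section \<open>Sofic groups\<close>

lemma hamming_length_moved:
  assumes "f permutes {1..m}"
  shows "hamming_length m f = real (card (moved f)) / real m"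
proof -
  have "{x \<in> {1..m}. f x \<noteq> x} = moved f" using permutes_moved[OF assms] by auto
  then show ?thesis by (simp add: hamming_length_def)
qed

lemma hamming_length_inv: "f permutes {1..m} \<Longrightarrow> hamming_length m (inv' f) = hamming_length m f"
  using permutes_inv[of f "{1..m}"] by (simp add: hamming_length_moved moved_inv permutes_bij)

lemma hamming_length_comp:
  assumes "f permutes {1..m}" "g permutes {1..m}"
  shows "hamming_length m (f \<circ> g) \<le> hamming_length m f + hamming_length m g"
proof -
  have "finite (moved f)" "finite (moved g)"
    using assms permutes_moved finite_subset[OF _ finite_atLeastAtMost] by blast+
  then have "real (card (moved (f \<circ> g))) \<le> real (card (moved f)) + real (card (moved g))"
    using card_moved_comp[of f g] by linarith
  then show ?thesis
    unfolding hamming_length_moved[OF assms(1)] hamming_length_moved[OF assms(2)]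
      hamming_length_moved[OF permutes_compose[OF assms(2,1)]] add_divide_distrib[symmetric]
    by (rule divide_right_mono) simp
qed

lemma hamming_length_conj:
  assumes "f permutes {1..m}" "g permutes {1..m}"
  shows "hamming_length m (inv' g \<circ> f \<circ> g) = hamming_length m f"
proof -
  have "inv' g \<circ> f \<circ> g permutes {1..m}"
    by (intro permutes_compose permutes_inv assms)
  then show ?thesis
    using card_moved_conj[OF permutes_bij[OF assms(2)], of f]
    by (simp only: hamming_length_moved assms(1))
qed

lemma hamming_length_conj_products:
  assumes F: "is_perm_group m F" and X: "\<And>x. x \<in> X \<Longrightarrow> hamming_length m x \<le> \<epsilon>"
    and y: "y \<in> conj_products F X n"
  shows "hamming_length m y \<le> real n * \<epsilon>"
proof -
  interpret conj_group F by (rule conj_group.intro[OF perm_group_simps(1)[OF F]])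
  note S = perm_group_simps[OF F]
  show ?thesis
    by (rule conj_products_length[OF _ _ _ _ X y])
      (simp_all only: S(2,3,7) hamming_length_id hamming_length_inv[OF S(5)]
        hamming_length_comp[OF S(5) S(5)] hamming_length_conj[OF S(5) S(5)])
qed

section \<open>From soficity to approximability\<close>

text \<open>The assumption \<open>K\<close> provides length-preserving homomorphisms into members of
  the class, so one argument serves symmetric and alternating groups. Images of nontrivial elements
  are too long to be products of \<open>n\<close> conjugates of short defects.\<close>

lemma sofic_imp_approximable:
  assumes sofic: "sofic G"
    and K: "\<And>m. m \<ge> 1 \<Longrightarrow> \<exists>M F. F \<in> K \<and> is_perm_group M F \<and> (\<exists>f\<in>hom (sym_group m) F.
      \<forall>p. p permutes {1..m} \<longrightarrow> hamming_length M (f p) = hamming_length m p)"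
  shows "approximable K G"
  unfolding approximable_def
proof (intro allI impI)
  fix \<Phi> n assume \<Phi>: "finite \<Phi> \<and> \<Phi> \<subseteq> carrier G"
  obtain \<alpha> where \<alpha>: "\<forall>g \<in> carrier G - {\<one>\<^bsub>G\<^esub>}. \<alpha> g > (0::real)"
    and appr: "\<forall>\<Phi> \<epsilon>. finite \<Phi> \<and> \<Phi> \<subseteq> carrier G \<and> \<epsilon> > 0 \<longrightarrow>
           (\<exists>m \<ge> 1. \<exists>\<phi>\<in>\<Phi> \<rightarrow> carrier (sym_group m).
              (\<one>\<^bsub>G\<^esub> \<in> \<Phi> \<longrightarrow> \<phi> \<one>\<^bsub>G\<^esub> = \<one>\<^bsub>sym_group m\<^esub>) \<and>
              (\<forall>g\<in>\<Phi>. hamming_length m (\<phi> g) \<ge> \<alpha> g) \<and>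
              (\<forall>g\<in>\<Phi>. \<forall>h\<in>\<Phi>. g \<otimes>\<^bsub>G\<^esub> h \<in> \<Phi> \<longrightarrow>
                 hamming_length m
                   (\<phi> (g \<otimes>\<^bsub>G\<^esub> h) \<otimes>\<^bsub>sym_group m\<^esub>
                     inv\<^bsub>sym_group m\<^esub> (\<phi> g \<otimes>\<^bsub>sym_group m\<^esub> \<phi> h)) < \<epsilon>))"
    using sofic unfolding sofic_def by (elim exE conjE) (rule that)
  \<comment> \<open>The extra value 1 keeps the minimum defined and positive when
    \<open>\<Phi>\<close> has no nontrivial element.\<close>
  define a where "a = Min (insert 1 (\<alpha> ` (\<Phi> - {\<one>\<^bsub>G\<^esub>})))"
  have a_pos: "a > 0" unfolding a_def using \<Phi> \<alpha> by (subst Min_gr_iff) auto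
  have a_le: "a \<le> \<alpha> g" if "g \<in> \<Phi> - {\<one>\<^bsub>G\<^esub>}" for g
    unfolding a_def using \<Phi> that by (intro Min_le) auto
  \<comment> \<open>Dividing by \<open>Suc n\<close> makes the estimate \<open>n\<epsilon>\<close>
    strict and covers \<open>n = 0\<close>.\<close>
  define \<epsilon> where "\<epsilon> = a / real (Suc n)"
  have \<epsilon>: "\<epsilon> > 0" using a_pos by (simp add: \<epsilon>_def)
  have n\<epsilon>: "real n * \<epsilon> < a" using a_pos by (simp add: \<epsilon>_def field_simps)
  have "finite \<Phi> \<and> \<Phi> \<subseteq> carrier G \<and> \<epsilon> > 0" using \<Phi> \<epsilon> by blast
  note ex = appr[THEN spec, THEN spec, THEN mp, OF this]
  obtain m \<phi> where m: "m \<ge> 1" and \<phi>: "\<phi> \<in> \<Phi> \<rightarrow> carrier (sym_group m)"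
      "\<one>\<^bsub>G\<^esub> \<in> \<Phi> \<longrightarrow> \<phi> \<one>\<^bsub>G\<^esub> = \<one>\<^bsub>sym_group m\<^esub>" "\<forall>g\<in>\<Phi>. hamming_length m (\<phi> g) \<ge> \<alpha> g"
    and def: "\<forall>g\<in>\<Phi>. \<forall>h\<in>\<Phi>. g \<otimes>\<^bsub>G\<^esub> h \<in> \<Phi> \<longrightarrow> hamming_length m (\<phi> (g \<otimes>\<^bsub>G\<^esub> h) \<otimes>\<^bsub>sym_group m\<^esub>
                     inv\<^bsub>sym_group m\<^esub> (\<phi> g \<otimes>\<^bsub>sym_group m\<^esub> \<phi> h)) < \<epsilon>"
    using ex by (elim exE bexE conjE) (rule that)
  obtain M F f where F: "F \<in> K" "is_perm_group M F" and f: "f \<in> hom (sym_group m) F"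
    "\<And>p. p permutes {1..m} \<Longrightarrow> hamming_length M (f p) = hamming_length m p"
    using K[OF m] by blast
  interpret S: group "sym_group m" by (rule sym_group_is_group)
  interpret f: group_hom "sym_group m" F f
    using f(1) perm_group_simps(1)[OF F(2)] by (simp add: group_hom_def group_hom_axioms_def S.is_group)
  have \<phi>m: "\<phi> g \<in> carrier (sym_group m)" if "g \<in> \<Phi>" for g using \<phi>(1) that by blast
  have def': "hamming_length M x \<le> \<epsilon>" if x: "x \<in> defects G F \<Phi> (f \<circ> \<phi>)" for x
  proof -
    obtain g h where gh: "g \<in> \<Phi>" "h \<in> \<Phi>" "g \<otimes>\<^bsub>G\<^esub> h \<in> \<Phi>"
      "x = f (\<phi> g) \<otimes>\<^bsub>F\<^esub> f (\<phi> h) \<otimes>\<^bsub>F\<^esub> inv\<^bsub>F\<^esub> (f (\<phi> (g \<otimes>\<^bsub>G\<^esub> h)))"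
      using x unfolding defects_def by auto
    define u where "u = \<phi> (g \<otimes>\<^bsub>G\<^esub> h) \<otimes>\<^bsub>sym_group m\<^esub> inv\<^bsub>sym_group m\<^esub> (\<phi> g \<otimes>\<^bsub>sym_group m\<^esub> \<phi> h)"
    have u: "u \<in> carrier (sym_group m)" using gh \<phi>m by (simp add: u_def del: sym_group_inv_equality)
    \<comment> \<open>The defect measured by soficity is the inverse of the one used in
      approximability; inversion preserves the length.\<close>
    have "x = f (inv\<^bsub>sym_group m\<^esub> u)"
      unfolding gh(4) u_def using gh \<phi>m
      by (simp add: S.inv_mult_group S.m_assoc f.H.m_assoc del: sym_group_inv_equality)
    then have "hamming_length M x = hamming_length m (inv' u)"
      using u f(2)[of "inv' u"] sym_group_inv_closed[OF u] by (simp add: sym_group_carrier del: One_nat_def)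
    also have "\<dots> = hamming_length m u"
      using u by (intro hamming_length_inv) (simp add: sym_group_carrier del: One_nat_def)
    also have "\<dots> \<le> \<epsilon>" using def gh unfolding u_def by (intro less_imp_le) blast
    finally show ?thesis .
  qed
  have sep: "separated_from F n ((f \<circ> \<phi>) ` (\<Phi> - {\<one>\<^bsub>G\<^esub>})) (defects G F \<Phi> (f \<circ> \<phi>))"
    unfolding separated_from_def
  proof (rule ccontr)
    assume "(f \<circ> \<phi>) ` (\<Phi> - {\<one>\<^bsub>G\<^esub>}) \<inter> conj_products F (defects G F \<Phi> (f \<circ> \<phi>)) n \<noteq> {}"
    then obtain g where g: "g \<in> \<Phi> - {\<one>\<^bsub>G\<^esub>}" "f (\<phi> g) \<in> conj_products F (defects G F \<Phi> (f \<circ> \<phi>)) n"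
      by auto
    have "a \<le> hamming_length m (\<phi> g)" using a_le[OF g(1)] \<phi>(3) g(1) by force
    also have "\<dots> = hamming_length M (f (\<phi> g))"
      using f(2)[of "\<phi> g"] \<phi>m g(1) by (simp add: sym_group_carrier del: One_nat_def)
    also have "\<dots> \<le> real n * \<epsilon>"
      by (rule hamming_length_conj_products[OF F(2) def' g(2)])
    finally show False using n\<epsilon> by simp
  qed
  show "\<exists>H\<in>K. \<exists>\<phi>\<in>\<Phi> \<rightarrow> carrier H. (\<one>\<^bsub>G\<^esub> \<in> \<Phi> \<longrightarrow> \<phi> \<one>\<^bsub>G\<^esub> = \<one>\<^bsub>H\<^esub>) \<and>
           separated_from H n (\<phi> ` (\<Phi> - {\<one>\<^bsub>G\<^esub>})) (defects G H \<Phi> \<phi>)"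
    using F(1) sep \<phi>(2) \<phi>m by (intro bexI[of _ F] bexI[of _ "f \<circ> \<phi>"]) auto
qed

text \<open>The diagonal action on two copies of the points is even and preserves the length.\<close>

definition double_perm :: "nat \<Rightarrow> (nat \<Rightarrow> nat) \<Rightarrow> nat \<Rightarrow> nat" where
  "double_perm m p = p \<circ> map_permutation {1..m} (\<lambda>x. x + m) p"

lemma double_perm_apply:
  assumes "p permutes {1..m}"
  shows "double_perm m p x = (if x \<in> {m + 1..2 * m} then p (x - m) + m else p x)"
proof -
  have img: "(\<lambda>x. x + m) ` {1..m} = {m + 1..2 * m}"
    using image_add_atLeastAtMost'[of m 1 m] by (simp add: add.commute mult_2)
  show ?thesis
  proof (cases "x \<in> {m + 1..2 * m}")
    case True
    define y where "y = x - m"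
    have y: "x = y + m" "y \<in> {1..m}" using True by (auto simp: y_def)
    have "map_permutation {1..m} (\<lambda>x. x + m) p x = p y + m"
      unfolding y(1) using map_permutation_apply[of "\<lambda>x. x + m" "{1..m}" y p] y(2) by (simp add: inj_on_def)
    moreover have "p y \<in> {1..m}" using permutes_in_image[OF assms] y(2) by blast
    then have "p (p y + m) = p y + m" using assms by (intro permutes_not_in[of p "{1..m}"]) auto
    ultimately show ?thesis using True y(1) by (simp add: double_perm_def)
  next
    case False
    then have "map_permutation {1..m} (\<lambda>x. x + m) p x = x"
      by (simp only: map_permutation_def restrict_id_def img if_False)
    then show ?thesis unfolding double_perm_def using False by (simp only: comp_apply if_False)
  qed
qed

lemma double_perm_hom: "double_perm m \<in> hom (sym_group m) (alt_group (2 * m))"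
proof (rule homI)
  fix p assume "p \<in> carrier (sym_group m)"
  then have p: "p permutes {1..m}" unfolding sym_group_carrier .
  have inj: "inj_on (\<lambda>x. x + m) {1..m}" by (simp add: inj_on_def)
  have "bij_betw (\<lambda>x. x + m) {1..m} ((\<lambda>x. x + m) ` {1..m})" using inj by (simp add: bij_betw_def)
  then have q: "map_permutation {1..m} (\<lambda>x. x + m) p permutes (\<lambda>x. x + m) ` {1..m}"
    using p by (rule map_permutation_permutes)
  have perm: "double_perm m p permutes {1..2 * m}"
    unfolding double_perm_def
    by (intro permutes_compose permutes_subset[OF q] permutes_subset[OF p]) auto
  \<comment> \<open>Both copies of \<open>p\<close> have the same parity, so their product is
    even.\<close>
  have "evenperm (double_perm m p)"
    unfolding double_perm_def
    using permutes_imp_permutation[OF _ p] permutes_imp_permutation[OF _ q]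
      evenperm_map_permutation[OF inj p] by (subst evenperm_comp) auto
  then show "double_perm m p \<in> carrier (alt_group (2 * m))"
    using perm by (simp only: alt_group_carrier)
next
  fix p q assume "p \<in> carrier (sym_group m)" "q \<in> carrier (sym_group m)"
  then have pq: "p permutes {1..m}" "q permutes {1..m}" by (simp_all only: sym_group_carrier)
  have "double_perm m (p \<circ> q) x = double_perm m p (double_perm m q x)" for x
  proof -
    note dp = double_perm_apply[OF pq(1)] and dq = double_perm_apply[OF pq(2)]
      and dpq = double_perm_apply[OF permutes_compose[OF pq(2,1)]]
    have qm: "q y \<in> {1..m}" if "y \<in> {1..m}" for y using permutes_in_image[OF pq(2)] that by blast
    show ?thesis
    proof (cases "x \<in> {m + 1..2 * m}")
      case True
      then have "x - m \<in> {1..m}" by auto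
      from qm[OF this] have "q (x - m) + m \<in> {m + 1..2 * m}" by auto
      then show ?thesis using True by (simp only: dp dq dpq if_True comp_apply diff_add_inverse2)
    next
      case False
      have "q x \<notin> {m + 1..2 * m}"
      proof (cases "x \<in> {1..m}")
        case True
        from qm[OF this] show ?thesis by auto
      next
        case False': False
        from permutes_not_in[OF pq(2) this] show ?thesis using False by simp
      qed
      then show ?thesis using False by (simp only: dp dq dpq if_False comp_apply)
    qed
  qed
  then show "double_perm m (p \<otimes>\<^bsub>sym_group m\<^esub> q) = double_perm m p \<otimes>\<^bsub>alt_group (2 * m)\<^esub> double_perm m q"
    by (simp add: sym_group_mult alt_group_mult fun_eq_iff)
qed

lemma hamming_length_double_perm:
  assumes p: "p permutes {1..m}"
  shows "hamming_length (2 * m) (double_perm m p) = hamming_length m p"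
proof -
  let ?A = "{x \<in> {1..m}. p x \<noteq> x}"
  have "{x \<in> {1..2 * m}. double_perm m p x \<noteq> x} = ?A \<union> (\<lambda>x. x + m) ` ?A"
  proof (rule subset_antisym; rule subsetI)
    fix x assume x: "x \<in> {x \<in> {1..2 * m}. double_perm m p x \<noteq> x}"
    show "x \<in> ?A \<union> (\<lambda>x. x + m) ` ?A"
    proof (cases "x \<in> {m + 1..2 * m}")
      case True
      then have "x - m \<in> ?A" using x double_perm_apply[OF p, of x] by auto
      moreover have "x = (x - m) + m" using True by auto
      ultimately show ?thesis by blast
    next
      case False
      then show ?thesis using x double_perm_apply[OF p, of x] by auto
    qed
  next
    fix x assume "x \<in> ?A \<union> (\<lambda>x. x + m) ` ?A"
    then show "x \<in> {x \<in> {1..2 * m}. double_perm m p x \<noteq> x}"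
      using double_perm_apply[OF p, of x] by auto
  qed
  moreover have "card (?A \<union> (\<lambda>x. x + m) ` ?A) = card ?A + card ((\<lambda>x. x + m) ` ?A)"
    by (rule card_Un_disjoint) auto
  moreover have "card ((\<lambda>x. x + m) ` ?A) = card ?A"
    by (rule card_image) (simp add: inj_on_def)
  ultimately show ?thesis by (simp add: hamming_length_def)
qed

lemma sofic_imp_approximable_Sym: "sofic G \<Longrightarrow> approximable Sym_class G"
proof (rule sofic_imp_approximable)
  fix m :: nat
  have "id \<in> hom (sym_group m) (sym_group m)" by (simp add: hom_def)
  then show "\<exists>M F. F \<in> Sym_class \<and> is_perm_group M F \<and> (\<exists>f\<in>hom (sym_group m) F.
      \<forall>p. p permutes {1..m} \<longrightarrow> hamming_length M (f p) = hamming_length m p)"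
    by (intro exI[of _ m] exI[of _ "sym_group m"] conjI bexI[of _ id])
      (auto simp: Sym_class_def is_perm_group_def)
qed

lemma sofic_imp_approximable_Alt: "sofic G \<Longrightarrow> approximable Alt_class G"
proof (rule sofic_imp_approximable)
  fix m :: nat
  show "\<exists>M F. F \<in> Alt_class \<and> is_perm_group M F \<and> (\<exists>f\<in>hom (sym_group m) F.
      \<forall>p. p permutes {1..m} \<longrightarrow> hamming_length M (f p) = hamming_length m p)"
    using double_perm_hom hamming_length_double_perm
    by (intro exI[of _ "2 * m"] exI[of _ "alt_group (2 * m)"] conjI bexI[of _ "double_perm m"])
      (auto simp: Alt_class_def is_perm_group_def)
qed

lemma approximable_mono: "K \<subseteq> L \<Longrightarrow> approximable K G \<Longrightarrow> approximable L G"
  unfolding approximable_def by (meson subsetD)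

lemma Prod_class_mono: "K \<subseteq> L \<Longrightarrow> Prod_class K \<subseteq> Prod_class L"
  unfolding Prod_class_def by blast

text \<open>A member of the class is replaced by the product with this single factor; the coordinate
  projection carries products of conjugates of defects back to it.\<close>

lemma approximable_Prod_class:
  assumes K: "\<And>H. H \<in> K \<Longrightarrow> group H" and appr: "approximable K G"
  shows "approximable (Prod_class K) G"
  unfolding approximable_def
proof (intro allI impI)
  fix \<Phi> n assume \<Phi>: "finite \<Phi> \<and> \<Phi> \<subseteq> carrier G"
  then obtain H \<phi> where H: "H \<in> K" and \<phi>: "\<phi> \<in> \<Phi> \<rightarrow> carrier H" "\<one>\<^bsub>G\<^esub> \<in> \<Phi> \<longrightarrow> \<phi> \<one>\<^bsub>G\<^esub> = \<one>\<^bsub>H\<^esub>"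
    and sep: "separated_from H n (\<phi> ` (\<Phi> - {\<one>\<^bsub>G\<^esub>})) (defects G H \<Phi> \<phi>)"
    using appr unfolding approximable_def by meson
  interpret group_family "{1..1::nat}" "\<lambda>_. H" using K[OF H] by (rule group_family.intro)
  define \<phi>' where "\<phi>' g = (\<lambda>_\<in>{1..1::nat}. \<phi> g)" for g
  have \<phi>'1: "\<phi>' g 1 = \<phi> g" for g by (simp add: \<phi>'_def)
  have mem: "\<phi>' g \<in> carrier P" if "g \<in> \<Phi>" for g
    unfolding \<phi>'_def using \<phi>(1) that by (intro P_restrict) auto
  have proj: "(\<lambda>a. a 1) \<in> hom P H"
    by (rule homI) (rule P_mem[of _ 1] P_mult[of 1]; simp)+
  have img: "(\<lambda>a. a 1) ` defects G P \<Phi> \<phi>' \<subseteq> defects G H \<Phi> \<phi>"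
  proof -
    have "(\<phi>' a \<otimes>\<^bsub>P\<^esub> \<phi>' b \<otimes>\<^bsub>P\<^esub> inv\<^bsub>P\<^esub> (\<phi>' c)) 1 = \<phi> a \<otimes>\<^bsub>H\<^esub> \<phi> b \<otimes>\<^bsub>H\<^esub> inv\<^bsub>H\<^esub> (\<phi> c)"
      if "c \<in> \<Phi>" for a b c
      using P_inv[OF mem[OF that], of 1]
      by (simp add: P_mult[of 1] \<phi>'1 del: One_nat_def atLeastAtMost_singleton)
    then show ?thesis unfolding defects_def by blast
  qed
  have "separated_from P n (\<phi>' ` (\<Phi> - {\<one>\<^bsub>G\<^esub>})) (defects G P \<Phi> \<phi>')"
    unfolding separated_from_def
  proof (rule ccontr)
    assume "\<phi>' ` (\<Phi> - {\<one>\<^bsub>G\<^esub>}) \<inter> conj_products P (defects G P \<Phi> \<phi>') n \<noteq> {}"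
    then obtain g where g: "g \<in> \<Phi> - {\<one>\<^bsub>G\<^esub>}" "\<phi>' g \<in> conj_products P (defects G P \<Phi> \<phi>') n" by auto
    have "\<phi> g \<in> conj_products H ((\<lambda>a. a 1) ` defects G P \<Phi> \<phi>') n"
      using P.conj_products_hom[OF K[OF H] proj g(2)] by (simp only: \<phi>'1)
    also have "\<dots> \<subseteq> conj_products H (defects G H \<Phi> \<phi>) n"
      using img unfolding conj_products_def by blast
    finally show False using sep g(1) unfolding separated_from_def by blast
  qed
  moreover have "P \<in> Prod_class K" by (rule single_factor_iso(1)[OF H])
  moreover have "\<one>\<^bsub>G\<^esub> \<in> \<Phi> \<longrightarrow> \<phi>' \<one>\<^bsub>G\<^esub> = \<one>\<^bsub>P\<^esub>"
    using \<phi>(2) by (auto simp: \<phi>'_def one_product_group intro: restrict_ext)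
  ultimately show "\<exists>H\<in>Prod_class K. \<exists>\<phi>\<in>\<Phi> \<rightarrow> carrier H. (\<one>\<^bsub>G\<^esub> \<in> \<Phi> \<longrightarrow> \<phi> \<one>\<^bsub>G\<^esub> = \<one>\<^bsub>H\<^esub>) \<and>
           separated_from H n (\<phi> ` (\<Phi> - {\<one>\<^bsub>G\<^esub>})) (defects G H \<Phi> \<phi>)"
    using mem by blast
qed

section \<open>From approximability to soficity\<close>

text \<open>The order of the quantifiers is the point: \<open>n\<close> is found from
  \<open>\<Phi>\<close> and \<open>k\<close> alone and then works for every product and every
  map.\<close>

lemma uniform_separating_hom:
  fixes k :: nat
  assumes G: "group G" and \<Phi>: "finite \<Phi>" "\<Phi> \<subseteq> carrier G" "\<one>\<^bsub>G\<^esub> \<in> \<Phi>" and k: "k \<ge> 2"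
  shows "\<exists>n. \<forall>P\<in>Prod_class (Sym_class \<union> Alt_class). \<forall>\<phi>\<in>\<Phi> \<rightarrow> carrier P. \<forall>g\<in>\<Phi>.
    \<phi> \<one>\<^bsub>G\<^esub> = \<one>\<^bsub>P\<^esub> \<longrightarrow> \<phi> g \<notin> conj_products P (defects G P \<Phi> \<phi>) n \<longrightarrow>
    (\<exists>L\<ge>1. \<exists>\<psi>\<in>hom P (sym_group L). hamming_length L (\<psi> (\<phi> g)) \<ge> 1 / 2 \<and>
       (\<forall>x\<in>defects G P \<Phi> \<phi>. hamming_length L (\<psi> x) \<le> 2 / real k))"
proof -
  let ?S4 = "{p :: nat \<Rightarrow> nat. p permutes {1..4}}"
  let ?D = "\<lambda>T. product_group T (\<lambda>t::(nat \<Rightarrow> nat) set \<times> ('a \<Rightarrow> nat \<Rightarrow> nat). (sym_group 4)\<lparr>carrier := fst t\<rparr>)"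
  \<comment> \<open>A type consists of the image of a factor in \<open>sym_group 4\<close> and the
    small quotients of all values of the map on \<open>\<Phi>\<close>. The set of conceivable types
    is finite and known in advance.\<close>
  define T where "T = Pow ?S4 \<times> (\<Phi> \<rightarrow>\<^sub>E ?S4)"
  have fS4: "finite ?S4" by (rule finite_permutations) simp
  have fT: "finite T"
    unfolding T_def using fS4 \<Phi>(1) by (intro finite_cartesian_product finite_PiE) auto
  \<comment> \<open>The types that occur depend on the product and the map; the sum bounds the order
    of the reduced product for every possible set of types.\<close>
  define M where "M = (\<Sum>T0\<in>Pow T. order (?D T0))"
  have M: "order (?D T0) \<le> M" if "T0 \<subseteq> T" for T0
    unfolding M_def using that fT by (intro member_le_sum) auto
  define n where "n = M + 2 * (30 * (M + k) + 8) * (card \<Phi> * card \<Phi>)"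
  show ?thesis
  proof (rule exI[of _ n], intro ballI impI)
    fix H \<phi> g
    assume H: "H \<in> Prod_class (Sym_class \<union> Alt_class)" and \<phi>: "\<phi> \<in> \<Phi> \<rightarrow> carrier H" and g: "g \<in> \<Phi>"
      and \<phi>1: "\<phi> \<one>\<^bsub>G\<^esub> = \<one>\<^bsub>H\<^esub>" and sep: "\<phi> g \<notin> conj_products H (defects G H \<Phi> \<phi>) n"
    obtain l F where HF: "H = product_group {1..l} F" and F: "\<forall>i\<in>{1..l::nat}. F i \<in> Sym_class \<union> Alt_class"
      using H unfolding Prod_class_def by blast
    have "\<forall>i\<in>{1..l}. \<exists>m. is_perm_group m (F i)"
      using F by (auto simp: Sym_class_def Alt_class_def is_perm_group_def)
    from bchoice[OF this] obtain deg where deg: "\<And>i. i \<in> {1..l} \<Longrightarrow> is_perm_group (deg i) (F i)" by blast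
    interpret perm_family "{1..l}" F deg using deg by (rule perm_family.intro)
    have \<phi>m: "\<phi> a \<in> carrier P" if "a \<in> \<Phi>" for a using \<phi> that unfolding HF by blast
    define X where "X = defects G P \<Phi> \<phi>"
    have X_img: "X \<subseteq> (\<lambda>(a, b). \<phi> a \<otimes>\<^bsub>P\<^esub> \<phi> b \<otimes>\<^bsub>P\<^esub> inv\<^bsub>P\<^esub> (\<phi> (a \<otimes>\<^bsub>G\<^esub> b))) ` (\<Phi> \<times> \<Phi>)"
      unfolding X_def defects_def by auto
    have Xfin: "finite X" by (rule finite_subset[OF X_img]) (simp add: \<Phi>(1))
    have "card X \<le> card ((\<lambda>(a, b). \<phi> a \<otimes>\<^bsub>P\<^esub> \<phi> b \<otimes>\<^bsub>P\<^esub> inv\<^bsub>P\<^esub> (\<phi> (a \<otimes>\<^bsub>G\<^esub> b))) ` (\<Phi> \<times> \<Phi>))"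
      by (rule card_mono[OF _ X_img]) (simp add: \<Phi>(1))
    also have "\<dots> \<le> card (\<Phi> \<times> \<Phi>)" by (rule card_image_le) (simp add: \<Phi>(1))
    finally have Xc: "card X \<le> card \<Phi> * card \<Phi>" by (simp add: card_cartesian_product)
    have XP: "X \<subseteq> carrier P" unfolding X_def defects_def using \<phi>m by (auto simp del: One_nat_def)
    have "\<one>\<^bsub>P\<^esub> = \<phi> \<one>\<^bsub>G\<^esub> \<otimes>\<^bsub>P\<^esub> \<phi> \<one>\<^bsub>G\<^esub> \<otimes>\<^bsub>P\<^esub> inv\<^bsub>P\<^esub> (\<phi> (\<one>\<^bsub>G\<^esub> \<otimes>\<^bsub>G\<^esub> \<one>\<^bsub>G\<^esub>))"
      using \<phi>1 group.is_monoid[OF G] by (simp add: HF monoid.l_one monoid.one_closed del: One_nat_def)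
    \<comment> \<open>The pair of units has the unit as its defect, which makes padding
      available.\<close>
    then have X1: "\<one>\<^bsub>P\<^esub> \<in> X"
      unfolding X_def defects_def using \<Phi>(3) group.is_monoid[OF G] by (force simp: monoid.l_one monoid.one_closed)
    define ty where "ty i = (quotients i, \<lambda>a\<in>\<Phi>. small_quotient (deg i) (\<phi> a i))" for i
    have sq_mem: "small_quotient (deg i) (\<phi> a i) \<in> ?S4" if "a \<in> \<Phi>" "i \<in> {1..l}" for a i
      using hom_in_carrier[OF small_quotient_hom[OF deg[OF that(2)]] P_mem[OF \<phi>m[OF that(1)] that(2)]]
      by (simp only: sym_group_carrier mem_Collect_eq)
    have qS: "quotients i \<subseteq> ?S4" if "i \<in> {1..l}" for i
      using subgroup.subset[OF subgroup_quotients[OF that]] by (auto simp: sym_group_def)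
    have tyT: "ty ` {1..l} \<subseteq> T"
    proof (rule image_subsetI)
      fix i assume i: "i \<in> {1..l}"
      have "(\<lambda>a\<in>\<Phi>. small_quotient (deg i) (\<phi> a i)) \<in> \<Phi> \<rightarrow>\<^sub>E ?S4"
        using sq_mem[OF _ i] by (simp only: restrict_PiE_iff) blast
      then show "ty i \<in> T" unfolding T_def ty_def using qS[OF i] by blast
    qed
    have ty_eq: "small_quotient (deg i) (\<phi> a i) = small_quotient (deg j) (\<phi> a j)"
      if "ty i = ty j" "a \<in> \<Phi>" for a i j
      using that unfolding ty_def by (metis (no_types, lifting) prod.inject restrict_apply')
    have unif: "small_quotient (deg i) (a i) = small_quotient (deg j) (a j)"
      if a: "a \<in> insert (\<phi> g) X" and ij: "i \<in> {1..l}" "j \<in> {1..l}" "ty i = ty j" for a i j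
    proof (cases "a = \<phi> g")
      case True
      then show ?thesis using ty_eq[OF ij(3) g] by simp
    next
      case False
      then obtain b c where bc: "b \<in> \<Phi>" "c \<in> \<Phi>" "b \<otimes>\<^bsub>G\<^esub> c \<in> \<Phi>"
        "a = \<phi> b \<otimes>\<^bsub>P\<^esub> \<phi> c \<otimes>\<^bsub>P\<^esub> inv\<^bsub>P\<^esub> (\<phi> (b \<otimes>\<^bsub>G\<^esub> c))"
        using a unfolding X_def defects_def by blast
      \<comment> \<open>Taking small quotients is multiplicative, so on a defect the result is
        determined by three values that the type records.\<close>
      have "small_quotient (deg i') (a i') = small_quotient (deg i') (\<phi> b i') \<circ> small_quotient (deg i') (\<phi> c i') \<circ>
          inv' (small_quotient (deg i') (\<phi> (b \<otimes>\<^bsub>G\<^esub> c) i'))" if i': "i' \<in> {1..l}" for i'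
        unfolding bc(4) using bc(1-3) \<phi>m i'
        by (simp only: small_quotient_mult small_quotient_inv P.m_closed P.inv_closed)
      then show ?thesis using ij ty_eq[OF ij(3)] bc(1-3) by simp
    qed
    have "\<exists>L\<ge>1. \<exists>\<psi>\<in>hom P (sym_group L). hamming_length L (\<psi> (\<phi> g)) \<ge> 1 / 2 \<and>
            (\<forall>x\<in>X. hamming_length L (\<psi> x) \<le> 2 / real k)"
    proof (rule separating_hom[where q = fst and ty = ty, OF _ _ Xfin XP X1 \<phi>m[OF g] unif M[OF tyT] k Xc])
      show "\<phi> g \<notin> conj_products P X (M + 2 * (30 * (M + k) + 8) * (card \<Phi> * card \<Phi>))"
        using sep unfolding HF X_def n_def .
    qed (simp_all add: ty_def)
    then show "\<exists>L\<ge>1. \<exists>\<psi>\<in>hom H (sym_group L). hamming_length L (\<psi> (\<phi> g)) \<ge> 1 / 2 \<and>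
       (\<forall>x\<in>defects G H \<Phi> \<phi>. hamming_length L (\<psi> x) \<le> 2 / real k)"
      unfolding HF X_def .
  qed
qed

text \<open>Proportions of fixed points multiply under tensoring. Hence every nontrivial element
  inherits length at least 1/2 from the factor made for it, while each factor lengthens a defect by
  at most \<open>2 / k\<close>.\<close>

lemma approximable_imp_sofic:
  assumes G: "group G" and appr: "approximable (Prod_class (Sym_class \<union> Alt_class)) G"
  shows "sofic G"
  unfolding sofic_def
proof (intro exI[of _ "\<lambda>g. if g = \<one>\<^bsub>G\<^esub> then 0 else 1 / 2"] conjI ballI allI impI)
  fix \<Phi>' :: "'a set" and \<epsilon> :: real assume \<Phi>': "finite \<Phi>' \<and> \<Phi>' \<subseteq> carrier G \<and> \<epsilon> > 0"
  \<comment> \<open>The unit is added so that it occurs among the defects.\<close>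
  define \<Phi> where "\<Phi> = insert \<one>\<^bsub>G\<^esub> \<Phi>'"
  define c where "c = card \<Phi>"
  have \<Phi>: "finite \<Phi>" "\<Phi> \<subseteq> carrier G" "\<one>\<^bsub>G\<^esub> \<in> \<Phi>"
    using \<Phi>' group.is_monoid[OF G] by (auto simp: \<Phi>_def monoid.one_closed)
  \<comment> \<open>At most \<open>c\<close> factors will be tensored, so \<open>k\<close> is chosen
    to bring \<open>c\<close> times \<open>2 / k\<close> below \<open>\<epsilon>\<close>.\<close>
  obtain k0 :: nat where k0: "2 * real c / \<epsilon> < real k0" using reals_Archimedean2 by blast
  define k where "k = max 2 k0"
  have k: "k \<ge> 2" by (simp add: k_def)
  have "2 * real c / \<epsilon> < real k" using k0 by (simp add: k_def)
  then have kc: "real c * (2 / real k) < \<epsilon>" using \<Phi>' k by (simp add: field_simps)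
  obtain n where n: "\<forall>P\<in>Prod_class (Sym_class \<union> Alt_class). \<forall>\<phi>\<in>\<Phi> \<rightarrow> carrier P. \<forall>g\<in>\<Phi>.
    \<phi> \<one>\<^bsub>G\<^esub> = \<one>\<^bsub>P\<^esub> \<longrightarrow> \<phi> g \<notin> conj_products P (defects G P \<Phi> \<phi>) n \<longrightarrow>
    (\<exists>L\<ge>1. \<exists>\<psi>\<in>hom P (sym_group L). hamming_length L (\<psi> (\<phi> g)) \<ge> 1 / 2 \<and>
       (\<forall>x\<in>defects G P \<Phi> \<phi>. hamming_length L (\<psi> x) \<le> 2 / real k))"
    using uniform_separating_hom[OF G \<Phi> k] by blast
  have "finite \<Phi> \<and> \<Phi> \<subseteq> carrier G" using \<Phi> by blast
  note ex = appr[unfolded approximable_def, THEN spec, THEN spec, THEN mp, OF this, of n]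
  obtain P \<phi> where P: "P \<in> Prod_class (Sym_class \<union> Alt_class)" and \<phi>: "\<phi> \<in> \<Phi> \<rightarrow> carrier P"
    and \<phi>1: "\<one>\<^bsub>G\<^esub> \<in> \<Phi> \<longrightarrow> \<phi> \<one>\<^bsub>G\<^esub> = \<one>\<^bsub>P\<^esub>"
    and sep: "separated_from P n (\<phi> ` (\<Phi> - {\<one>\<^bsub>G\<^esub>})) (defects G P \<Phi> \<phi>)"
    using ex by (elim bexE conjE) (rule that)
  have Pg: "group P"
    using P sym_group_is_group alt_group_is_group
    by (auto simp: Prod_class_def Sym_class_def Alt_class_def intro!: product_group)
  interpret P: group P by (rule Pg)
  define A where "A = \<Phi> - {\<one>\<^bsub>G\<^esub>}"
  have "\<forall>a\<in>A. \<exists>L \<psi>. L \<ge> 1 \<and> \<psi> \<in> hom P (sym_group L) \<and> hamming_length L (\<psi> (\<phi> a)) \<ge> 1 / 2 \<and>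
       (\<forall>x\<in>defects G P \<Phi> \<phi>. hamming_length L (\<psi> x) \<le> 2 / real k)"
  proof
    fix a assume a: "a \<in> A"
    then have "\<phi> a \<notin> conj_products P (defects G P \<Phi> \<phi>) n"
      using sep unfolding separated_from_def A_def by blast
    moreover have "a \<in> \<Phi>" using a by (simp add: A_def)
    ultimately show "\<exists>L \<psi>. L \<ge> 1 \<and> \<psi> \<in> hom P (sym_group L) \<and> hamming_length L (\<psi> (\<phi> a)) \<ge> 1 / 2 \<and>
       (\<forall>x\<in>defects G P \<Phi> \<phi>. hamming_length L (\<psi> x) \<le> 2 / real k)"
      using n P \<phi> \<phi>1 \<Phi>(3) by meson
  qed
  then obtain L \<psi> where L: "\<And>a. a \<in> A \<Longrightarrow> L a \<ge> 1" "\<And>a. a \<in> A \<Longrightarrow> \<psi> a \<in> hom P (sym_group (L a))"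
    and big: "\<And>a. a \<in> A \<Longrightarrow> hamming_length (L a) (\<psi> a (\<phi> a)) \<ge> 1 / 2"
    and small: "\<And>a x. a \<in> A \<Longrightarrow> x \<in> defects G P \<Phi> \<phi> \<Longrightarrow> hamming_length (L a) (\<psi> a x) \<le> 2 / real k"
    by metis
  have Afin: "finite A" using \<Phi>(1) by (simp add: A_def)
  obtain m \<Psi> where m: "m \<ge> 1" and \<Psi>: "\<Psi> \<in> hom P (sym_group m)"
    and len: "\<And>y. y \<in> carrier P \<Longrightarrow> 1 - hamming_length m (\<Psi> y) = (\<Prod>a\<in>A. 1 - hamming_length (L a) (\<psi> a y))"
    using tensor_family_hom[of A L \<psi> P] Afin L by blast
  interpret S: group "sym_group m" by (rule sym_group_is_group)
  interpret \<Psi>: group_hom P "sym_group m" \<Psi>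
    using \<Psi> by (simp add: group_hom_def group_hom_axioms_def Pg S.is_group)
  have \<phi>m: "\<phi> g \<in> carrier P" if "g \<in> \<Phi>" for g using \<phi> that by blast
  have sub: "\<Phi>' \<subseteq> \<Phi>" by (auto simp: \<Phi>_def)
  have far: "(if g = \<one>\<^bsub>G\<^esub> then 0 else 1 / 2) \<le> hamming_length m (\<Psi> (\<phi> g))" if g: "g \<in> \<Phi>'" for g
  proof (cases "g = \<one>\<^bsub>G\<^esub>")
    case True
    then show ?thesis by (simp add: hamming_length_nonneg)
  next
    case False
    then have gA: "g \<in> A" using g sub by (auto simp: A_def)
    \<comment> \<open>The factors made for other elements can only lower the proportion of points
      fixed by \<open>g\<close>.\<close>
    have "(\<Prod>a\<in>A - {g}. 1 - hamming_length (L a) (\<psi> a (\<phi> g))) \<le> 1"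
      by (intro prod_le_1) (simp add: hamming_length_nonneg hamming_length_le_1)
    then have "(1 - hamming_length (L g) (\<psi> g (\<phi> g))) * (\<Prod>a\<in>A - {g}. 1 - hamming_length (L a) (\<psi> a (\<phi> g)))
        \<le> 1 / 2 * 1"
      using big[OF gA] by (intro mult_mono prod_nonneg) (auto simp: hamming_length_le_1)
    then have "1 - hamming_length m (\<Psi> (\<phi> g)) \<le> 1 / 2"
      unfolding len[OF \<phi>m[OF subsetD[OF sub g]]] prod.remove[OF Afin gA] by (simp only: mult_1_right)
    then show ?thesis using False by simp
  qed
  have near: "hamming_length m (\<Psi> x) < \<epsilon>" if x: "x \<in> defects G P \<Phi> \<phi>" for x
  proof -
    have xP: "x \<in> carrier P" using x \<phi>m unfolding defects_def by auto
    have k1: "2 / real k \<le> 1" using k by simp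
    \<comment> \<open>Bernoulli's inequality is available because \<open>k \<ge> 2\<close> keeps
      \<open>2 / k\<close> at most 1.\<close>
    have "1 + real (card A) * (- (2 / real k)) \<le> (1 + (- (2 / real k))) ^ card A"
      by (rule Bernoulli_inequality) (use k1 in simp)
    also have "\<dots> = (\<Prod>a\<in>A. 1 - 2 / real k)" by (simp add: prod_constant)
    also have "\<dots> \<le> (\<Prod>a\<in>A. 1 - hamming_length (L a) (\<psi> a x))"
      using small[OF _ x] k1 by (intro prod_mono) (auto simp: hamming_length_le_1)
    finally have "hamming_length m (\<Psi> x) \<le> real (card A) * (2 / real k)"
      using len[OF xP] by simp
    also have "\<dots> \<le> real c * (2 / real k)"
      using \<Phi>(1) unfolding c_def A_def by (intro mult_right_mono) (auto intro: card_mono)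
    finally show ?thesis using kc by linarith
  qed
  have def: "hamming_length m (\<Psi> (\<phi> (g \<otimes>\<^bsub>G\<^esub> h)) \<otimes>\<^bsub>sym_group m\<^esub>
      inv\<^bsub>sym_group m\<^esub> (\<Psi> (\<phi> g) \<otimes>\<^bsub>sym_group m\<^esub> \<Psi> (\<phi> h))) < \<epsilon>"
    if gh: "g \<in> \<Phi>'" "h \<in> \<Phi>'" "g \<otimes>\<^bsub>G\<^esub> h \<in> \<Phi>'" for g h
  proof -
    define x where "x = \<phi> g \<otimes>\<^bsub>P\<^esub> \<phi> h \<otimes>\<^bsub>P\<^esub> inv\<^bsub>P\<^esub> (\<phi> (g \<otimes>\<^bsub>G\<^esub> h))"
    have mem: "\<phi> g \<in> carrier P" "\<phi> h \<in> carrier P" "\<phi> (g \<otimes>\<^bsub>G\<^esub> h) \<in> carrier P"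
      using gh sub \<phi>m by auto
    have xX: "x \<in> defects G P \<Phi> \<phi>" using gh sub unfolding defects_def x_def by blast
    have xP: "x \<in> carrier P" using mem by (simp add: x_def)
    have "\<Psi> (\<phi> (g \<otimes>\<^bsub>G\<^esub> h)) \<otimes>\<^bsub>sym_group m\<^esub> inv\<^bsub>sym_group m\<^esub> (\<Psi> (\<phi> g) \<otimes>\<^bsub>sym_group m\<^esub> \<Psi> (\<phi> h)) =
        \<Psi> (inv\<^bsub>P\<^esub> x)"
      using mem by (simp add: x_def P.inv_mult_group S.inv_mult_group S.m_assoc P.m_assoc del: sym_group_inv_equality)
    also have "\<dots> = inv' (\<Psi> x)" using xP by simp
    finally show ?thesis
      using near[OF xX] hamming_length_inv[of "\<Psi> x" m] \<Psi>.hom_closed[OF xP]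
      by (simp add: sym_group_carrier del: One_nat_def)
  qed
  show "\<exists>m \<ge> 1. \<exists>\<phi>\<in>\<Phi>' \<rightarrow> carrier (sym_group m).
              (\<one>\<^bsub>G\<^esub> \<in> \<Phi>' \<longrightarrow> \<phi> \<one>\<^bsub>G\<^esub> = \<one>\<^bsub>sym_group m\<^esub>) \<and>
              (\<forall>g\<in>\<Phi>'. hamming_length m (\<phi> g) \<ge> (if g = \<one>\<^bsub>G\<^esub> then 0 else 1 / 2)) \<and>
              (\<forall>g\<in>\<Phi>'. \<forall>h\<in>\<Phi>'. g \<otimes>\<^bsub>G\<^esub> h \<in> \<Phi>' \<longrightarrow>
                 hamming_length m
                   (\<phi> (g \<otimes>\<^bsub>G\<^esub> h) \<otimes>\<^bsub>sym_group m\<^esub>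
                     inv\<^bsub>sym_group m\<^esub> (\<phi> g \<otimes>\<^bsub>sym_group m\<^esub> \<phi> h)) < \<epsilon>)"
  proof (intro exI[of _ m] conjI bexI[of _ "\<Psi> \<circ> \<phi>"] ballI impI)
    show "\<Psi> \<circ> \<phi> \<in> \<Phi>' \<rightarrow> carrier (sym_group m)" using \<phi>m sub by auto
    show "(\<Psi> \<circ> \<phi>) \<one>\<^bsub>G\<^esub> = \<one>\<^bsub>sym_group m\<^esub>" using \<phi>1 \<Phi>(3) by simp
  qed (use m far def in \<open>simp_all only: comp_apply\<close>)
qed auto

theorem proposition9:
  shows "(approximable_groups Sym_class :: 'a monoid set) = sofic_groups \<and>
         (approximable_groups (Prod_class Sym_class) :: 'a monoid set) = sofic_groups \<and>
         (approximable_groups Alt_class :: 'a monoid set) = sofic_groups \<and>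
         (approximable_groups (Prod_class Alt_class) :: 'a monoid set) = sofic_groups"
proof -
  \<comment> \<open>The implications close up for either class: soficity gives approximability by
    \<open>K\<close>, then by products from \<open>K\<close>, then by mixed products of symmetric
    and alternating groups, and these lead back to soficity.\<close>
  have eq: "(approximable_groups K :: 'a monoid set) = sofic_groups \<and>
      (approximable_groups (Prod_class K) :: 'a monoid set) = sofic_groups"
    if sub: "K \<subseteq> Sym_class \<union> Alt_class" and K: "\<And>G :: 'a monoid. sofic G \<Longrightarrow> approximable K G" for K
  proof -
    have "group H" if "H \<in> K" for H
      using that sub sym_group_is_group alt_group_is_group by (auto simp: Sym_class_def Alt_class_def)
    then have prod: "approximable (Prod_class K) G" if "approximable K G" for G :: "'a monoid"
      using approximable_Prod_class that by blast
    have "sofic G" if "group G" "approximable (Prod_class K) G" for G :: "'a monoid"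
      using approximable_imp_sofic[OF that(1) approximable_mono[OF Prod_class_mono[OF sub] that(2)]] .
    with prod K show ?thesis
      unfolding approximable_groups_def sofic_groups_def by blast
  qed
  show ?thesis
    using eq[OF _ sofic_imp_approximable_Sym] eq[OF _ sofic_imp_approximable_Alt] by blast
qed

end
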